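(* Let $d,n\ge 1$ and let $X_1,\dots,X_n\in\mathbb{R}^d$ be a martingale difference sequence adapted to a filtration $\mathcal F_0,\mathcal F_1,\dots,\mathcal F_n$, with conditional covariances $V_k=\mathbb{E}[X_kX_k^\top\mid\mathcal F_{k-1}]$ almost surely. Let $S_n=\sum_{i=1}^n X_i$, for $k\in\{1,\dots,n\}$ let $P_k=\sum_{i=k}^n V_i$, and let $\Sigma_n=\mathrm{Var}(S_n)$ be the covariance matrix of $S_n$. Assume that $\Sigma_n$ is positive definite, that each $P_k$ is almost surely positive definite, and that $$P_1=\Sigma_n\quad\text{almost surely.}$$ Let $Z\sim\mathcal N_d(0,I)$ and let $h:\mathbb{R}^d\to\mathbb{R}$ be a twice differentiable function with $M_2(h)<\infty$. Then $$\left|\mathbb{E}\big[h(\Sigma_n^{-1/2}S_n)\big]-\mathbb{E}[h(Z)]\right|\le \frac{3\pi}{8}\sqrt d\,M_2(h)\sum_{k=1}^n\mathbb{E}\left[\big\|\Sigma_n^{1/2}P_k^{-1}\Sigma_n^{1/2}\big\|_2^{1/2}\,\big\|\Sigma_n^{-1/2}X_k\big\|_2^3\right].$$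
   Context: Martingale difference sequence: each $X_k$ is $\mathcal F_k$-measurable, square integrable, and $\mathbb{E}[X_k\mid\mathcal F_{k-1}]=0$ almost surely. For vectors $\|\cdot\|_2$ is the Euclidean norm; for matrices $\|\cdot\|_2$ is the operator (spectral) norm. $\Sigma_n^{1/2}$ is the symmetric positive definite square root. For a twice differentiable $h:\mathbb{R}^d\to\mathbb{R}$, $$M_2(h)=\sup_{x,y\in\mathbb{R}^d,\,x\ne y}\frac{\|\nabla h(x)-\nabla h(y)\|_2}{\|x-y\|_2}.$$ $\mathcal N_d(0,I)$ is the standard Gaussian distribution on $\mathbb{R}^d$. The right-hand side is allowed to be $+\infty$. *)

theory Defs
  imports "HOL-Probability.Probability"
begin

definition finite_filtration :: "'a measure \<Rightarrow> nat \<Rightarrow> (nat \<Rightarrow> 'a measure) \<Rightarrow> bool" where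
  "finite_filtration M n F \<longleftrightarrow>
     (\<forall>k\<le>n. subalgebra M (F k)) \<and> (\<forall>j k. j \<le> k \<longrightarrow> k \<le> n \<longrightarrow> subalgebra (F k) (F j))"

text \<open>The library's conditional expectation is real-valued, so the vector and matrix versions
  are taken entry by entry.\<close>

definition vec_cond_exp ::
  "'a measure \<Rightarrow> 'a measure \<Rightarrow> ('a \<Rightarrow> real ^ 'd) \<Rightarrow> 'a \<Rightarrow> real ^ 'd" where
  "vec_cond_exp M F Y \<omega> = (\<chi> i. real_cond_exp M F (\<lambda>\<omega>'. Y \<omega>' $ i) \<omega>)"

definition mat_cond_exp ::
  "'a measure \<Rightarrow> 'a measure \<Rightarrow> ('a \<Rightarrow> real ^ 'd ^ 'e) \<Rightarrow> 'a \<Rightarrow> real ^ 'd ^ 'e" where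
  "mat_cond_exp M F Y \<omega> = (\<chi> i j. real_cond_exp M F (\<lambda>\<omega>'. Y \<omega>' $ i $ j) \<omega>)"

definition outer_prod :: "real ^ 'd \<Rightarrow> real ^ 'e \<Rightarrow> real ^ 'e ^ 'd" where
  "outer_prod x y = (\<chi> i j. x $ i * y $ j)"

definition martingale_difference ::
  "'a measure \<Rightarrow> nat \<Rightarrow> (nat \<Rightarrow> 'a measure) \<Rightarrow> (nat \<Rightarrow> 'a \<Rightarrow> real ^ 'd) \<Rightarrow> bool" where
  "martingale_difference M n F X \<longleftrightarrow>
     (\<forall>k\<in>{1..n}.
        X k \<in> borel_measurable (F k) \<and>
        integrable M (\<lambda>\<omega>. (norm (X k \<omega>))\<^sup>2) \<and>
        (AE \<omega> in M. vec_cond_exp M (F (k - 1)) (X k) \<omega> = 0))"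

definition covariance_matrix :: "'a measure \<Rightarrow> ('a \<Rightarrow> real ^ 'd) \<Rightarrow> real ^ 'd ^ 'd" where
  "covariance_matrix M Y =
     (\<chi> i j. \<integral>\<omega>. (Y \<omega> $ i - (\<integral>\<omega>'. Y \<omega>' $ i \<partial>M)) * (Y \<omega> $ j - (\<integral>\<omega>'. Y \<omega>' $ j \<partial>M)) \<partial>M)"

definition pos_def_matrix :: "real ^ 'd ^ 'd \<Rightarrow> bool" where
  "pos_def_matrix A \<longleftrightarrow> transpose A = A \<and> (\<forall>x. x \<noteq> 0 \<longrightarrow> 0 < x \<bullet> (A *v x))"

text \<open>Only meaningful for positive definite arguments.\<close>

definition matrix_sqrt :: "real ^ 'd ^ 'd \<Rightarrow> real ^ 'd ^ 'd" where
  "matrix_sqrt A = (THE B. pos_def_matrix B \<and> B ** B = A)"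

definition spectral_norm :: "real ^ 'd ^ 'e \<Rightarrow> real" where
  "spectral_norm A = onorm (\<lambda>x. A *v x)"

definition grad :: "('v::real_inner \<Rightarrow> real) \<Rightarrow> 'v \<Rightarrow> 'v" where
  "grad h x = (THE g. GDERIV h x :> g)"

definition twice_differentiable :: "(real ^ 'd \<Rightarrow> real) \<Rightarrow> bool" where
  "twice_differentiable h \<longleftrightarrow>
     (\<forall>x. h differentiable (at x)) \<and> (\<forall>x. grad h differentiable (at x))"

text \<open>The supremum is taken in the extended nonnegative reals, so that it may be infinite.\<close>

definition M2 :: "(real ^ 'd \<Rightarrow> real) \<Rightarrow> ennreal" where
  "M2 h = (SUP (x, y) \<in> {(x, y). x \<noteq> y}. ennreal (norm (grad h x - grad h y) / norm (x - y)))"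

definition std_gaussian_density :: "real ^ 'd \<Rightarrow> real" where
  "std_gaussian_density x = (\<Prod>i\<in>UNIV. std_normal_density (x $ i))"

end

theory Submission
  imports Defs
begin

text \<open>Lindeberg's exchange, one summand at a time, after normalising to \<open>\<Sigma> = 1\<close>. The sum of the first
  \<open>k\<close> increments plus an independent Gaussian vector with covariance \<open>P (k + 1)\<close> is compared with the sum
  of the first \<open>k - 1\<close> increments plus a Gaussian vector with covariance \<open>P k = P (k + 1) + V k\<close>. As
  \<open>P 1\<close> is deterministic, \<open>P (k + 1)\<close> is known at time \<open>k - 1\<close>, so that the conditional moments of the
  two differ only from order three on. Convolving \<open>h\<close> with a Gaussian of covariance \<open>A\<close> gives a function
  whose second derivative is Lipschitz with constant \<open>M2 h / sqrt \<lambda>\<close>, where \<open>\<lambda>\<close> is the least eigenvalue of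
  \<open>A\<close>. Let now \<open>\<lambda>\<close> be the least eigenvalue of \<open>P k\<close>. If \<open>trace (V k) \<le> 4/5 * \<lambda>\<close>, then \<open>P (k + 1)\<close> is at
  least \<open>\<lambda>/5\<close> and a third order expansion gives the estimate; otherwise \<open>trace (V k)\<close> is so large that the
  second order expansion suffices. Both cases give the constant \<open>sqrt 5 / 2 < 3 * pi / 8\<close>, without the
  factor \<open>sqrt d\<close>.\<close>

section \<open>Positive definite matrices\<close>

text \<open>No Gaussian vectors are adjoined to the probability space. The Gaussian part is
  integrated out: \<open>U k w x\<close> is the mean of \<open>h\<close> under a Gaussian centred at
  \<open>x\<close> whose covariance depends on \<open>w\<close>, and the exchange compares integrals
  of these random functions at the partial sums. Gaussian measures are given by densities, which
  excludes singular covariances, yet these occur in two places. A conditional covariance may be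
  merely semidefinite: add \<epsilon> times the identity and let \<epsilon> tend to 0. The
  covariance paired with the full sum is 0: there the smoothed function is \<open>h\<close> itself
  and the second order expansion has to suffice, which it does because the last \<open>V k\<close>
  is all of \<open>P k\<close>. As only the gradient of \<open>h\<close> is Lipschitz, the third
  order expansion puts one derivative on the Gaussian density and gains the last from the Lipschitz
  bound. It is needed only along the increment, a one-dimensional estimate, so the dimension does
  not enter. Its constants 1/6 (increment) and 2/6 (Gaussian, whose third absolute moment is at most
  twice the trace to the power 3/2) add up to 1/2; the bound \<lambda>/5 contributes the factor
  \<open>sqrt 5\<close>.\<close>

definition psd_matrix :: "real ^ 'd ^ 'd \<Rightarrow> bool" where
  "psd_matrix A \<longleftrightarrow> transpose A = A \<and> (\<forall>x. 0 \<le> x \<bullet> (A *v x))"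

lemma pos_def_imp_psd: "pos_def_matrix A \<Longrightarrow> psd_matrix A"
  unfolding pos_def_matrix_def psd_matrix_def
  by (metis inner_zero_left order.refl order.strict_implies_order)

lemma inner_mv_transpose: "(A *v x) \<bullet> y = x \<bullet> (transpose A *v y)" for A :: "real ^ 'n ^ 'm"
  by (metis dot_lmul_matrix inner_commute vector_transpose_matrix)

lemma inner_mv_symm: "transpose A = A \<Longrightarrow> (A *v x) \<bullet> y = x \<bullet> (A *v y)" for A :: "real ^ 'n ^ 'n"
  by (metis inner_mv_transpose)

lemma transpose_add: "transpose (A + B) = transpose A + transpose B"
  by (simp add: transpose_def vec_eq_iff)

lemma transpose_diff: "transpose (A - B) = transpose A - transpose B"
  by (simp add: transpose_def vec_eq_iff)

lemma transpose_scaleR: "transpose (c *\<^sub>R A) = c *\<^sub>R transpose A"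
  by (simp add: transpose_def vec_eq_iff)

lemma transpose_mat1 [simp]: "transpose (mat 1) = mat 1"
  by (fact transpose_mat)

lemma symmetricI:
  fixes A :: "real ^ 'n ^ 'n"
  assumes "\<And>x y. (A *v x) \<bullet> y = x \<bullet> (A *v y)"
  shows "transpose A = A"
proof -
  have "transpose A *v y = A *v y" for y
    by (rule vector_eq_ldot[THEN iffD1]) (metis assms inner_mv_transpose)
  then show ?thesis by (simp add: matrix_eq)
qed

text \<open>Compactness of the unit sphere gives a positive minimum of the form there; homogeneity
  carries it to all vectors.\<close>

lemma pos_def_coercive:
  fixes A :: "real ^ 'n ^ 'n"
  assumes "pos_def_matrix A"
  obtains a where "a > 0" "\<And>x. a * (norm x)\<^sup>2 \<le> x \<bullet> (A *v x)"
proof -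
  have "\<exists>u\<in>sphere (0 :: real ^ 'n) 1. \<forall>x\<in>sphere 0 1. u \<bullet> (A *v u) \<le> x \<bullet> (A *v x)"
    by (rule continuous_attains_inf) (auto intro!: continuous_intros)
  then obtain u where u: "u \<in> sphere 0 1"
      "\<And>x. x \<in> sphere 0 1 \<Longrightarrow> u \<bullet> (A *v u) \<le> x \<bullet> (A *v x)"
    by auto
  show ?thesis
  proof
    show "u \<bullet> (A *v u) > 0"
      using assms u(1) unfolding pos_def_matrix_def by (metis mem_sphere_0 norm_zero zero_neq_one)
    show "u \<bullet> (A *v u) * (norm x)\<^sup>2 \<le> x \<bullet> (A *v x)" for x
    proof (cases "x = 0")
      case False
      have "u \<bullet> (A *v u) \<le> (x /\<^sub>R norm x) \<bullet> (A *v (x /\<^sub>R norm x))"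
        using False by (intro u(2)) auto
      then show ?thesis using False
        by (simp add: matrix_vector_mult_scaleR field_simps power2_eq_square)
    qed simp
  qed
qed

lemma pos_def_invertible:
  fixes A :: "real ^ 'n ^ 'n"
  assumes "pos_def_matrix A"
  shows "invertible A"
proof -
  have "\<forall>x. A *v x = 0 \<longrightarrow> x = 0"
    using assms unfolding pos_def_matrix_def by (metis inner_zero_right less_irrefl)
  then show ?thesis
    by (metis invertible_left_inverse matrix_left_invertible_ker)
qed

lemma matrix_inv_mult:
  fixes A :: "real ^ 'n ^ 'n"
  assumes "invertible A"
  shows "A ** matrix_inv A = mat 1" "matrix_inv A ** A = mat 1"
proof -
  have "A ** matrix_inv A = mat 1 \<and> matrix_inv A ** A = mat 1"
    using assms unfolding invertible_def matrix_inv_def by (rule someI_ex)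
  then show "A ** matrix_inv A = mat 1" "matrix_inv A ** A = mat 1" by auto
qed

lemma matrix_inv_eqI:
  fixes A :: "real ^ 'n ^ 'n"
  assumes "A ** B = mat 1"
  shows "matrix_inv A = B"
proof -
  have "invertible A" using assms by (metis invertible_right_inverse)
  then have "matrix_inv A ** (A ** B) = B"
    by (simp add: matrix_mul_assoc matrix_inv_mult)
  then show ?thesis by (simp add: assms)
qed

lemma pos_def_mat1: "pos_def_matrix (mat 1 :: real ^ 'n ^ 'n)"
  by (simp add: pos_def_matrix_def)

lemma pos_def_inv:
  fixes A :: "real ^ 'n ^ 'n"
  assumes "pos_def_matrix A"
  shows "pos_def_matrix (matrix_inv A)"
proof -
  note inv = matrix_inv_mult[OF pos_def_invertible[OF assms]]
  have sym: "transpose A = A" using assms by (simp add: pos_def_matrix_def)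
  have AB: "A *v (matrix_inv A *v x) = x" for x by (simp add: matrix_vector_mul_assoc inv)
  have "transpose (matrix_inv A) = matrix_inv A"
    by (metis inv(1) matrix_inv_eqI matrix_transpose_mul sym transpose_mat1 inv(2))
  moreover have "0 < x \<bullet> (matrix_inv A *v x)" if "x \<noteq> 0" for x
  proof -
    have "matrix_inv A *v x \<noteq> 0" using AB[of x] that by (metis matrix_vector_mult_0_right)
    then have "0 < (matrix_inv A *v x) \<bullet> (A *v (matrix_inv A *v x))"
      using assms unfolding pos_def_matrix_def by blast
    then show ?thesis by (simp add: AB inner_commute)
  qed
  ultimately show ?thesis unfolding pos_def_matrix_def by blast
qed

lemma pos_def_add_psd:
  assumes "pos_def_matrix A" "psd_matrix B"
  shows "pos_def_matrix (A + B)"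
  using assms unfolding pos_def_matrix_def psd_matrix_def
  by (auto simp: transpose_add matrix_vector_mult_add_rdistrib inner_add_right add_pos_nonneg)

lemma pos_def_scaleR:
  assumes "pos_def_matrix A" "c > 0"
  shows "pos_def_matrix (c *\<^sub>R A)"
  using assms unfolding pos_def_matrix_def
  by (auto simp: transpose_scaleR simp flip: scaleR_matrix_vector_assoc)

lemma axis_form: "axis i 1 \<bullet> (A *v axis j 1) = A $ i $ j" for A :: "real ^ 'n ^ 'n"
  by (simp add: inner_axis' matrix_vector_mult_basis column_def)

lemma psd_diag_nonneg: "psd_matrix A \<Longrightarrow> 0 \<le> A $ i $ i"
  unfolding psd_matrix_def by (metis axis_form)

lemma pos_def_diag_pos: "pos_def_matrix A \<Longrightarrow> 0 < A $ i $ i"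
proof -
  assume A: "pos_def_matrix A"
  have "axis i (1::real) \<noteq> 0" by (simp add: axis_eq_0_iff)
  then show ?thesis using A unfolding pos_def_matrix_def by (metis axis_form)
qed

lemma psd_trace_nonneg: "psd_matrix A \<Longrightarrow> 0 \<le> trace A"
  unfolding trace_def by (intro sum_nonneg psd_diag_nonneg)

lemma pos_def_trace_pos: "pos_def_matrix A \<Longrightarrow> 0 < trace A"
  unfolding trace_def by (intro sum_pos pos_def_diag_pos) auto

lemma quad_form_sum: "x \<bullet> (A *v x) = (\<Sum>i\<in>UNIV. \<Sum>j\<in>UNIV. A $ i $ j * (x $ i * x $ j))"
  for A :: "real ^ 'n ^ 'n"
  by (simp add: inner_vec_def matrix_vector_mult_def sum_distrib_left ac_simps)

text \<open>Summing the nonnegative values of the form at x_j e_i - x_i e_j over all i and j gives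
  twice the difference of the two sides.\<close>

lemma psd_le_trace:
  fixes A :: "real ^ 'n ^ 'n"
  assumes "psd_matrix A"
  shows "x \<bullet> (A *v x) \<le> trace A * (norm x)\<^sup>2"
proof -
  have sym: "A $ i $ j = A $ j $ i" for i j
  proof -
    have "transpose A $ j $ i = A $ j $ i" using assms unfolding psd_matrix_def by simp
    then show ?thesis by (simp add: transpose_def)
  qed
  have "0 \<le> (\<Sum>i\<in>UNIV. \<Sum>j\<in>UNIV. (x$j)\<^sup>2 * A$i$i - 2 * (A$i$j * (x$i * x$j)) + (x$i)\<^sup>2 * A$j$j)"
  proof (intro sum_nonneg)
    fix i j
    let ?v = "x$j *\<^sub>R axis i 1 - x$i *\<^sub>R axis j (1::real)"
    have "0 \<le> ?v \<bullet> (A *v ?v)" using assms unfolding psd_matrix_def by blast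
    also have "?v \<bullet> (A *v ?v) = (x$j)\<^sup>2 * A$i$i - 2 * (A$i$j * (x$i * x$j)) + (x$i)\<^sup>2 * A$j$j"
      by (simp add: matrix_vector_mult_diff_distrib matrix_vector_mult_scaleR inner_diff_left
          inner_diff_right axis_form sym[of j i] power2_eq_square algebra_simps)
    finally show "0 \<le> (x$j)\<^sup>2 * A$i$i - 2 * (A$i$j * (x$i * x$j)) + (x$i)\<^sup>2 * A$j$j" .
  qed
  also have "\<dots> = 2 * (trace A * (\<Sum>j\<in>UNIV. (x$j)\<^sup>2)) - 2 * (x \<bullet> (A *v x))"
  proof -
    have e1: "(\<Sum>i\<in>UNIV. \<Sum>j\<in>UNIV. (x$j)\<^sup>2 * A$i$i) = trace A * (\<Sum>j\<in>UNIV. (x$j)\<^sup>2)"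
      unfolding trace_def sum_product by (simp only: mult.commute)
    then have e2: "(\<Sum>i\<in>UNIV. \<Sum>j\<in>UNIV. (x$i)\<^sup>2 * A$j$j) = trace A * (\<Sum>j\<in>UNIV. (x$j)\<^sup>2)"
      by (subst sum.swap)
    have e3: "(\<Sum>i\<in>UNIV. \<Sum>j\<in>UNIV. 2 * (A$i$j * (x$i * x$j))) = 2 * (x \<bullet> (A *v x))"
      by (simp only: quad_form_sum sum_distrib_left)
    show ?thesis by (simp only: sum.distrib sum_subtractf e1 e2 e3)
  qed
  also have "(\<Sum>j\<in>UNIV. (x$j)\<^sup>2) = (norm x)\<^sup>2"
    by (simp add: norm_vec_def L2_set_def sum_nonneg)
  finally show ?thesis by simp
qed

text \<open>With \<open>z = matrix_inv A *v v\<close>, coercivity and Cauchy-Schwarz give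
  \<open>a * norm z ^ 2 \<le> z \<bullet> v \<le> norm z * norm v\<close>, hence
  \<open>norm z \<le> norm v / a\<close>. This turns a lower bound on a covariance into an upper
  bound on its precision matrix.\<close>

lemma inverse_form_le:
  fixes A :: "real ^ 'n ^ 'n"
  assumes "pos_def_matrix A" "a > 0" "\<And>x. a * (norm x)\<^sup>2 \<le> x \<bullet> (A *v x)"
  shows "v \<bullet> (matrix_inv A *v v) \<le> (norm v)\<^sup>2 / a"
proof -
  let ?z = "matrix_inv A *v v"
  have Az: "A *v ?z = v"
    by (simp add: matrix_vector_mul_assoc matrix_inv_mult[OF pos_def_invertible[OF assms(1)]])
  have "a * (norm ?z)\<^sup>2 \<le> ?z \<bullet> v" using assms(3)[of ?z] Az by simp
  also have "\<dots> \<le> norm ?z * norm v" by (rule norm_cauchy_schwarz)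
  finally have "norm ?z * (a * norm ?z) \<le> norm ?z * norm v"
    by (simp add: power2_eq_square algebra_simps)
  then have "a * norm ?z \<le> norm v"
    by (cases "?z = 0") (auto intro: mult_left_le_imp_le[of "norm ?z"])
  then have "norm v * (a * norm ?z) \<le> norm v * norm v" by (intro mult_left_mono) auto
  moreover have "a * (v \<bullet> ?z) \<le> a * (norm v * norm ?z)"
    using assms(2) norm_cauchy_schwarz by (intro mult_left_mono) auto
  ultimately have "a * (v \<bullet> ?z) \<le> (norm v)\<^sup>2"
    by (simp add: power2_eq_square mult.left_commute)
  then show ?thesis using assms(2) by (simp add: pos_le_divide_eq mult.commute)
qed

lemma quad_form_le_spectral_norm:
  "v \<bullet> (B *v v) \<le> spectral_norm B * (norm v)\<^sup>2" for B :: "real ^ 'n ^ 'n"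
proof -
  have *: "v \<bullet> (B *v v) \<le> norm v * norm (B *v v)" by (rule norm_cauchy_schwarz)
  have "norm (B *v v) \<le> spectral_norm B * norm v"
    unfolding spectral_norm_def by (intro onorm) auto
  then have "norm v * norm (B *v v) \<le> norm v * (spectral_norm B * norm v)"
    by (rule mult_left_mono) simp
  with * show ?thesis by (simp add: power2_eq_square ac_simps)
qed

lemma spectral_norm_pos_def_pos:
  fixes B :: "real ^ 'n ^ 'n"
  assumes "pos_def_matrix B"
  shows "0 < spectral_norm B"
proof -
  obtain v :: "real ^ 'n" where "v \<noteq> 0" by (metis axis_eq_0_iff zero_neq_one)
  then have "0 < v \<bullet> (B *v v)" using assms unfolding pos_def_matrix_def by blast
  then have "0 < spectral_norm B * (norm v)\<^sup>2"
    using quad_form_le_spectral_norm[of v B] by linarith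
  then show ?thesis by (simp add: zero_less_mult_iff)
qed

text \<open>The reciprocal of the operator norm of the inverse is the least eigenvalue. This links
  the norm in the final bound to a lower bound on the remaining covariance, without
  diagonalisation.\<close>

lemma coercive_inverse_spectral_norm:
  fixes A :: "real ^ 'n ^ 'n"
  assumes "pos_def_matrix A"
  shows "(norm y)\<^sup>2 / spectral_norm (matrix_inv A) \<le> y \<bullet> (A *v y)"
proof -
  define s where "s = spectral_norm (matrix_inv A)"
  have s: "s > 0" unfolding s_def by (intro spectral_norm_pos_def_pos pos_def_inv assms)
  note inv = matrix_inv_mult[OF pos_def_invertible[OF assms]]
  have sym: "transpose A = A" using assms by (simp add: pos_def_matrix_def)
  let ?z = "matrix_inv A *v y"
  have Az: "A *v ?z = y" by (simp add: matrix_vector_mul_assoc inv)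
  \<comment> \<open>Since \<open>A *v ?z = y\<close>, both cross terms of the form at this vector
    equal the squared norm of \<open>y\<close> divided by \<open>s\<close>, and the last term is the
    form of the inverse, bounded by its norm \<open>s\<close>.\<close>
  have "0 \<le> (y - ?z /\<^sub>R s) \<bullet> (A *v (y - ?z /\<^sub>R s))"
    using pos_def_imp_psd[OF assms] unfolding psd_matrix_def by blast
  also have "\<dots> = y \<bullet> (A *v y) - 2 * (norm y)\<^sup>2 / s + (y \<bullet> ?z) / s\<^sup>2"
  proof -
    have "?z \<bullet> (A *v y) = (norm y)\<^sup>2"
      by (metis Az inner_mv_symm sym power2_norm_eq_inner)
    moreover have "y \<bullet> y = (norm y)\<^sup>2" "?z \<bullet> y = y \<bullet> ?z"
      by (simp_all add: power2_norm_eq_inner inner_commute)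
    ultimately show ?thesis using s
      by (simp add: matrix_vector_mult_diff_distrib matrix_vector_mult_scaleR inner_diff_left
          inner_diff_right Az field_simps power2_eq_square)
  qed
  also have "(y \<bullet> ?z) / s\<^sup>2 \<le> s * (norm y)\<^sup>2 / s\<^sup>2"
    unfolding s_def by (intro divide_right_mono quad_form_le_spectral_norm) auto
  also have "s * (norm y)\<^sup>2 / s\<^sup>2 = (norm y)\<^sup>2 / s" using s by (simp add: power2_eq_square)
  finally show ?thesis unfolding s_def[symmetric] by simp
qed

section \<open>The positive definite square root\<close>

text \<open>Write the root as \<open>(1 / sqrt c) *\<^sub>R (x - Y x)\<close>. Its square is
  \<open>A\<close> exactly when \<open>Y\<close> equals half of \<open>T\<close> plus the square of
  \<open>Y\<close>, where \<open>T\<close> is the identity minus \<open>c\<close> times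
  \<open>A\<close>. For small \<open>c\<close> the operator \<open>T\<close> has norm below 1, and
  Banach's fixed point theorem applies on a ball of symmetric operators.\<close>

lemma pos_def_sqrt_exists:
  fixes A :: "real ^ 'n ^ 'n"
  assumes "pos_def_matrix A"
  shows "\<exists>B. pos_def_matrix B \<and> B ** B = A"
proof -
  obtain a where a: "a > 0" "\<And>x. a * (norm x)\<^sup>2 \<le> x \<bullet> (A *v x)"
    using pos_def_coercive[OF assms] by blast
  have symA: "(A *v x) \<bullet> y = x \<bullet> (A *v y)" for x y
    using assms inner_mv_symm unfolding pos_def_matrix_def by blast
  define K where "K = onorm ((*v) A) + 1"
  have K: "norm (A *v x) \<le> K * norm x" for x
  proof -
    have "norm (A *v x) \<le> onorm ((*v) A) * norm x" by (intro onorm) auto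
    also have "\<dots> \<le> K * norm x" unfolding K_def by (intro mult_right_mono) auto
    finally show ?thesis .
  qed
  have "0 \<le> onorm ((*v) A)" by (intro onorm_pos_le) auto
  then have Kpos: "K > 0" unfolding K_def by linarith
  \<comment> \<open>The two terms of the denominator yield the two smallness conditions:
    \<open>c * K\<^sup>2 \<le> a\<close> lets the quadratic term absorb only half of the gain
    \<open>2 * c * a\<close> in the estimate of \<open>norm T\<close>, and \<open>c * a < 1\<close>
    makes \<open>q\<close> a real number.\<close>
  define c where "c = a / (2 * K\<^sup>2 + 2 * a\<^sup>2)"
  have c: "c > 0" using a Kpos unfolding c_def by (simp add: add_pos_pos)
  define q where "q = sqrt (1 - c * a)"
  have Ka: "0 < 2 * K\<^sup>2 + 2 * a\<^sup>2" using a Kpos by (simp add: add_pos_pos)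
  have ca: "c * a < 1"
  proof -
    have "a * a < 2 * K\<^sup>2 + 2 * a\<^sup>2"
      using a Kpos by (simp add: power2_eq_square add_pos_pos)
    then show ?thesis using Ka unfolding c_def by (simp add: divide_simps)
  qed
  have cK: "c * K\<^sup>2 \<le> a"
  proof -
    show ?thesis unfolding c_def using a Ka by (simp add: divide_simps mult_le_cancel_left algebra_simps)
  qed
  have q: "0 \<le> q" "q < 1" unfolding q_def using ca c a by (auto simp: )
  define T where "T = Blinfun (\<lambda>x. x - c *\<^sub>R (A *v x))"
  have T: "blinfun_apply T = (\<lambda>x. x - c *\<^sub>R (A *v x))"
    unfolding T_def by (intro bounded_linear_Blinfun_apply bounded_linear_intros) auto
  have "norm T \<le> q"
  proof (rule norm_blinfun_bound[OF q(1)])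
    fix x :: "real ^ 'n"
    have "(norm (T x))\<^sup>2 = (norm x)\<^sup>2 - 2 * c * (x \<bullet> (A *v x)) + c\<^sup>2 * (norm (A *v x))\<^sup>2"
      unfolding T power2_norm_eq_inner
      by (simp add: inner_diff_left inner_diff_right inner_commute power2_eq_square algebra_simps)
    also have "\<dots> \<le> (norm x)\<^sup>2 - 2 * c * (a * (norm x)\<^sup>2) + c\<^sup>2 * (K * norm x)\<^sup>2"
      using c a(2)[of x] K[of x] by (intro add_mono diff_mono mult_left_mono power_mono) auto
    also have "\<dots> = (norm x)\<^sup>2 * (1 - 2 * c * a + c * (c * K\<^sup>2))"
      by (simp add: power2_eq_square algebra_simps)
    also have "\<dots> \<le> (norm x)\<^sup>2 * (1 - 2 * c * a + c * a)"
      using cK c by (intro mult_left_mono add_mono) auto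
    also have "\<dots> = (q * norm x)\<^sup>2" unfolding q_def power_mult_distrib using ca by simp
    finally show "norm (T x) \<le> q * norm x"
      using q(1) by (intro power2_le_imp_le[of "norm (T x)"]) auto
  qed
  \<comment> \<open>The smaller root of \<open>q + r\<^sup>2 = 2 * r\<close>: the ball of this
    radius is mapped into itself, and \<open>r\<close> is also the contraction factor.\<close>
  define r where "r = 1 - sqrt (1 - q)"
  have r: "0 \<le> r" "r < 1" "q + r\<^sup>2 = 2 * r" unfolding r_def using q
    by (auto simp: power2_eq_square algebra_simps)
  define sy :: "((real ^ 'n) \<Rightarrow>\<^sub>L (real ^ 'n)) \<Rightarrow> bool"
    where "sy Y \<longleftrightarrow> (\<forall>x y. Y x \<bullet> y = x \<bullet> Y y)" for Y
  define S where "S = {Y. norm Y \<le> r \<and> sy Y}"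
  define f where "f Y = (1/2) *\<^sub>R (T + (Y o\<^sub>L Y))" for Y
  have "closed {Y :: (real ^ 'n) \<Rightarrow>\<^sub>L (real ^ 'n). sy Y}"
    unfolding sy_def by (intro closed_Collect_all closed_Collect_eq continuous_intros)
  then have "closed S"
    unfolding S_def Collect_conj_eq by (intro closed_Int closed_Collect_le continuous_intros)
  note compl = complete_eq_closed[THEN iffD2, OF this]
  have ne: "S \<noteq> {}"
    using r by (intro ex_in_conv[THEN iffD1] exI[of _ 0]) (auto simp: S_def sy_def)
  have fS: "f ` S \<subseteq> S"
  proof
    fix Z assume "Z \<in> f ` S"
    then obtain Y where Y: "norm Y \<le> r" "sy Y" "Z = f Y" unfolding S_def by auto
    have "norm (Y o\<^sub>L Y) \<le> norm Y * norm Y" by (rule norm_blinfun_compose)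
    also have "\<dots> \<le> r * r" using Y r by (intro mult_mono) auto
    finally have "norm (Y o\<^sub>L Y) \<le> r\<^sup>2" by (simp add: power2_eq_square)
    then have "norm (T + (Y o\<^sub>L Y)) \<le> q + r\<^sup>2"
      using \<open>norm T \<le> q\<close> norm_triangle_ineq[of T "Y o\<^sub>L Y"] by linarith
    then have "norm Z \<le> r" using r Y unfolding f_def by simp
    moreover have "sy Z"
      using Y(2) symA unfolding Y(3) f_def sy_def
      by (auto simp: T blinfun.bilinear_simps inner_add_left inner_add_right inner_diff_left
          inner_diff_right)
    ultimately show "Z \<in> S" unfolding S_def by simp
  qed
  \<comment> \<open>The difference of the squares of two noncommuting operators splits as
    \<open>Y\<close> after \<open>Y - Z\<close> plus \<open>Y - Z\<close> after
    \<open>Z\<close>.\<close>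
  have lip: "dist (f Y) (f Z) \<le> r * dist Y Z" if "Y \<in> S \<and> Z \<in> S" for Y Z
  proof -
    have "f Y - f Z = (1/2) *\<^sub>R ((Y o\<^sub>L (Y - Z)) + ((Y - Z) o\<^sub>L Z))"
      unfolding f_def by (rule blinfun_eqI) (simp add: blinfun.bilinear_simps algebra_simps)
    then have "dist (f Y) (f Z) \<le> (1/2) * (norm (Y o\<^sub>L (Y - Z)) + norm ((Y - Z) o\<^sub>L Z))"
      by (simp add: dist_norm norm_triangle_ineq)
    also have "\<dots> \<le> (1/2) * (norm Y * norm (Y - Z) + norm (Y - Z) * norm Z)"
      by (intro mult_left_mono add_mono norm_blinfun_compose) auto
    also have "\<dots> \<le> (1/2) * (r * norm (Y - Z) + norm (Y - Z) * r)"
      using that unfolding S_def by (intro mult_left_mono add_mono mult_right_mono) auto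
    finally show ?thesis by (simp add: dist_norm)
  qed
  obtain Y where "Y \<in> S" "f Y = Y"
    using Banach_fix[OF compl ne r(1,2) fS] lip by blast
  then have Y: "norm Y \<le> r" "sy Y" "\<And>x. T x + Y (Y x) = 2 *\<^sub>R Y x"
  proof -
    show "norm Y \<le> r" "sy Y" using \<open>Y \<in> S\<close> unfolding S_def by auto
    fix x
    have "2 *\<^sub>R Y x = 2 *\<^sub>R f Y x" using \<open>f Y = Y\<close> by simp
    then show "T x + Y (Y x) = 2 *\<^sub>R Y x"
      unfolding f_def by (simp add: blinfun.bilinear_simps)
  qed
  define B where "B = matrix (\<lambda>x. (1 / sqrt c) *\<^sub>R (x - Y x))"
  have linY: "linear (blinfun_apply Y)" by (intro bounded_linear.linear blinfun.bounded_linear_right)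
  then have B: "B *v x = (1 / sqrt c) *\<^sub>R (x - Y x)" for x
    unfolding B_def by (intro matrix_works linear_matrix_vector_mul_eq[THEN iffD2] linear_compose_scale_right linear_compose_sub linear_ident)
  have "B ** B = A"
  proof -
    have "(B ** B) *v x = A *v x" for x
    proof -
      have "(B ** B) *v x = (1 / c) *\<^sub>R (x - 2 *\<^sub>R Y x + Y (Y x))"
        using c by (simp add: matrix_vector_mul_assoc[symmetric] B blinfun.bilinear_simps
            algebra_simps scaleR_2)
      also have "x - 2 *\<^sub>R Y x + Y (Y x) = c *\<^sub>R (A *v x)"
        using Y(3)[of x] unfolding T by (simp add: algebra_simps)
      finally show ?thesis using c by simp
    qed
    then show ?thesis by (simp add: matrix_eq)
  qed
  moreover have "pos_def_matrix B"
    unfolding pos_def_matrix_def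
  proof (intro conjI allI impI)
    show "transpose B = B"
      using Y(2) unfolding sy_def by (intro symmetricI) (simp add: B inner_diff_left inner_diff_right)
    fix x :: "real ^ 'n" assume x: "x \<noteq> 0"
    have "x \<bullet> Y x \<le> norm x * norm (Y x)" by (rule norm_cauchy_schwarz)
    also have "\<dots> \<le> norm x * (r * norm x)"
      using Y(1) by (intro mult_left_mono order.trans[OF norm_blinfun] mult_right_mono) auto
    also have "\<dots> < norm x * norm x" using x r by simp
    finally show "0 < x \<bullet> (B *v x)"
      using c by (simp add: B inner_diff_right power2_norm_eq_inner[symmetric] power2_eq_square)
  qed
  ultimately show ?thesis by blast
qed

text \<open>With D = B - C one has B D + D C = 0, and the trace of D (B D + D C) is a sum of
  nonnegative terms.\<close>

lemma pos_def_sqrt_unique: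
  fixes B C :: "real ^ 'n ^ 'n"
  assumes B: "pos_def_matrix B" and C: "pos_def_matrix C" and eq: "B ** B = C ** C"
  shows "B = C"
proof -
  define D where "D = B - C"
  have symB: "transpose B = B" and symC: "transpose C = C"
    using B C by (auto simp: pos_def_matrix_def)
  have symD: "transpose D = D" by (simp add: D_def transpose_diff symB symC)
  have BD: "B *v (D *v x) + D *v (C *v x) = 0" for x
  proof -
    have "B *v (B *v x) = C *v (C *v x)" using eq by (simp add: matrix_vector_mul_assoc)
    then show ?thesis
      unfolding D_def by (simp add: matrix_vector_mult_diff_rdistrib matrix_vector_mult_diff_distrib)
  qed
  have quad: "trace (D ** (M ** D)) = (\<Sum>i\<in>UNIV. (D *v axis i 1) \<bullet> (M *v (D *v axis i 1)))"
    for M :: "real ^ 'n ^ 'n"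
    unfolding trace_def
  proof (rule sum.cong[OF refl])
    fix i
    have "(D ** (M ** D)) $ i $ i = axis i 1 \<bullet> ((D ** (M ** D)) *v axis i 1)"
      by (simp add: axis_form)
    also have "\<dots> = axis i 1 \<bullet> (D *v (M *v (D *v axis i 1)))"
      by (simp add: matrix_vector_mul_assoc)
    finally show "(D ** (M ** D)) $ i $ i = (D *v axis i 1) \<bullet> (M *v (D *v axis i 1))"
      by (simp add: inner_mv_symm[OF symD])
  qed
  have "B ** D + D ** C = 0" using BD by (simp add: matrix_eq matrix_vector_mult_add_rdistrib
        matrix_vector_mul_assoc)
  then have "D ** (B ** D + D ** C) = D ** 0" by simp
  then have "D ** (B ** D) + D ** (D ** C) = 0"
    unfolding matrix_add_ldistrib by (simp add: matrix_matrix_mult_def vec_eq_iff)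
  then have tr1: "trace (D ** (B ** D)) + trace (D ** (D ** C)) = 0"
    by (metis trace_add trace_0 mat_0)
  have tr2: "trace (D ** (D ** C)) = trace (D ** (C ** D))"
    by (metis matrix_mul_assoc trace_mul_sym)
  have "0 \<le> trace (D ** (M ** D))" if "psd_matrix M" for M
    unfolding quad using that by (intro sum_nonneg) (auto simp: psd_matrix_def)
  from this[OF pos_def_imp_psd[OF B]] this[OF pos_def_imp_psd[OF C]]
  have "trace (D ** (B ** D)) = 0"
    using tr1 tr2 by linarith
  then have "\<forall>i\<in>UNIV. (D *v axis i 1) \<bullet> (B *v (D *v axis i 1)) = 0"
    unfolding quad using pos_def_imp_psd[OF B]
    by (subst (asm) sum_nonneg_eq_0_iff) (auto simp: psd_matrix_def)
  then have "D *v axis i 1 = 0" for i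
    using B unfolding pos_def_matrix_def by (metis UNIV_I less_irrefl)
  then have "D = 0"
    by (simp add: vec_eq_iff matrix_vector_mult_basis column_def)
  then show ?thesis by (simp add: D_def)
qed

lemma matrix_sqrt_props:
  assumes "pos_def_matrix A"
  shows "pos_def_matrix (matrix_sqrt A)" "matrix_sqrt A ** matrix_sqrt A = A"
proof -
  have "\<exists>!B. pos_def_matrix B \<and> B ** B = A"
    using pos_def_sqrt_exists[OF assms] pos_def_sqrt_unique by blast
  from theI'[OF this]
  show "pos_def_matrix (matrix_sqrt A)" "matrix_sqrt A ** matrix_sqrt A = A"
    unfolding matrix_sqrt_def by auto
qed

section \<open>Gaussian measures\<close>

lemma borel_measurable_mv [measurable (raw)]:
  fixes f :: "'a \<Rightarrow> real ^ 'n ^ 'm"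
  assumes [measurable]: "f \<in> borel_measurable M" "g \<in> borel_measurable M"
  shows "(\<lambda>x. f x *v g x) \<in> borel_measurable M"
proof (rule borel_measurable_continuous_Pair[OF assms])
  show "continuous_on UNIV (\<lambda>x :: (real ^ 'n ^ 'm) \<times> (real ^ 'n). fst x *v snd x)"
    unfolding matrix_vector_mult_def by (intro continuous_intros)
qed

lemma borel_measurable_vec_lambda [measurable (raw)]:
  fixes f :: "'a \<Rightarrow> 'n::finite \<Rightarrow> 'b :: euclidean_space"
  assumes "\<And>i. (\<lambda>x. f x i) \<in> borel_measurable M"
  shows "(\<lambda>x. \<chi> i. f x i) \<in> borel_measurable M"
proof (subst borel_measurable_euclidean_space, intro ballI)
  fix b :: "'b ^ 'n" assume "b \<in> Basis"
  then obtain i u where "b = axis i u" unfolding Basis_vec_def by auto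
  then show "(\<lambda>x. (\<chi> i. f x i) \<bullet> b) \<in> borel_measurable M"
    using assms by (simp add: inner_axis)
qed

lemma borel_measurable_vec_component [measurable (raw)]:
  fixes f :: "'a \<Rightarrow> 'b :: euclidean_space ^ 'n"
  assumes "f \<in> borel_measurable M"
  shows "(\<lambda>x. f x $ i) \<in> borel_measurable M"
  by (rule borel_measurable_continuous_on[OF _ assms]) (intro continuous_intros)

text \<open>Kept unnormalised: \<open>gaussian\<close> divides by the integral, so no determinant
  formula for the constant is required.\<close>

definition gauss_kernel :: "real ^ 'd ^ 'd \<Rightarrow> real ^ 'd \<Rightarrow> real" where
  "gauss_kernel W y = exp (- (y \<bullet> (W *v y)) / 2)"

text \<open>The parameter is the precision matrix, that is, the inverse of the covariance.\<close>

definition gaussian :: "real ^ 'd ^ 'd \<Rightarrow> (real ^ 'd) measure" where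
  "gaussian W = density lborel
     (\<lambda>y. ennreal (gauss_kernel W y / (\<integral>y. gauss_kernel W y \<partial>lborel)))"

lemma gauss_kernel_pos [simp]: "0 < gauss_kernel W y"
  by (simp add: gauss_kernel_def)

lemma borel_measurable_gauss_kernel [measurable (raw)]:
  assumes [measurable]: "f \<in> borel_measurable M" "g \<in> borel_measurable M"
  shows "(\<lambda>x. gauss_kernel (f x) (g x)) \<in> borel_measurable M"
  unfolding gauss_kernel_def by measurable

lemma sets_gaussian [simp, measurable_cong]: "sets (gaussian W) = sets borel"
  by (simp add: gaussian_def)

lemma space_gaussian [simp]: "space (gaussian W) = UNIV"
  by (simp add: gaussian_def)

lemma integral_gaussian:
  fixes f :: "real ^ 'd \<Rightarrow> real"
  assumes [measurable]: "f \<in> borel_measurable borel"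
  shows "(\<integral>y. f y \<partial>gaussian W) =
    (\<integral>y. gauss_kernel W y * f y \<partial>lborel) / (\<integral>y. gauss_kernel W y \<partial>lborel)"
proof -
  have "(\<integral>y. f y \<partial>gaussian W) =
      (\<integral>y. gauss_kernel W y * f y / (\<integral>y. gauss_kernel W y \<partial>lborel) \<partial>lborel)"
    unfolding gaussian_def
    by (subst integral_density)
       (auto intro!: AE_I2 divide_nonneg_nonneg Bochner_Integration.integral_nonneg simp: less_imp_le)
  then show ?thesis by simp
qed

lemma integrable_exp_square:
  fixes a :: real
  assumes "a > 0"
  shows "integrable lborel (\<lambda>t :: real. exp (- a * t\<^sup>2))"
proof -
  define s where "s = 1 / sqrt (2 * a)"
  have s: "s > 0" "2 * s\<^sup>2 = 1 / a" using assms by (auto simp: s_def power_divide)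
  have "integrable lborel (\<lambda>t. sqrt (2 * pi * s\<^sup>2) * normal_density 0 s t)"
    using s by (intro integrable_mult_right integrable_normal_density)
  also have "(\<lambda>t. sqrt (2 * pi * s\<^sup>2) * normal_density 0 s t) = (\<lambda>t. exp (- a * t\<^sup>2))"
    unfolding normal_density_def using s by (auto simp: fun_eq_iff)
  finally show ?thesis .
qed

text \<open>Half of the quadratic term absorbs the linear one, \<open>c * t - a * t\<^sup>2 \<le>
  c\<^sup>2 / (2 * a) - (a / 2) * t\<^sup>2\<close>; the remaining bound factorises over the
  coordinates into one-dimensional normal densities.\<close>

lemma integrable_exp_norm_square:
  fixes a c :: real
  assumes "a > 0"
  shows "integrable lborel (\<lambda>y :: 'a :: euclidean_space. exp (c * norm y - a * (norm y)\<^sup>2))"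
proof (rule integrableI_bounded)
  show "(\<lambda>y :: 'a. exp (c * norm y - a * (norm y)\<^sup>2)) \<in> borel_measurable lborel" by simp
  let ?C = "exp (c\<^sup>2 / (2 * a))"
  have "(\<integral>\<^sup>+ y. ennreal (norm (exp (c * norm (y :: 'a) - a * (norm y)\<^sup>2))) \<partial>lborel)
      \<le> (\<integral>\<^sup>+ y. ennreal ?C * (\<Prod>b\<in>Basis. ennreal (exp (- (a/2) * ((y :: 'a) \<bullet> b)\<^sup>2))) \<partial>lborel)"
  proof (intro nn_integral_mono)
    fix y :: 'a
    have "0 \<le> (c - a * norm y)\<^sup>2" by simp
    then have "c * norm y - a * (norm y)\<^sup>2 \<le> c\<^sup>2 / (2 * a) - (a/2) * (norm y)\<^sup>2"
      using assms by (simp add: field_simps power2_eq_square)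
    also have "\<dots> = c\<^sup>2 / (2 * a) + (\<Sum>b\<in>Basis. - (a/2) * (y \<bullet> b)\<^sup>2)"
    proof -
      have "(norm y)\<^sup>2 = (\<Sum>b\<in>Basis. (y \<bullet> b)\<^sup>2)"
        unfolding power2_norm_eq_inner by (subst euclidean_inner) (simp add: power2_eq_square)
      then show ?thesis by (simp only: sum_distrib_left[symmetric])
    qed
    finally have "exp (c * norm y - a * (norm y)\<^sup>2)
        \<le> exp (c\<^sup>2 / (2 * a) + (\<Sum>b\<in>Basis. - (a/2) * (y \<bullet> b)\<^sup>2))"
      by simp
    also have "\<dots> = ?C * (\<Prod>b\<in>Basis. exp (- (a/2) * (y \<bullet> b)\<^sup>2))"
      by (simp only: exp_add exp_sum[OF finite_Basis])
    finally show "ennreal (norm (exp (c * norm y - a * (norm y)\<^sup>2)))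
        \<le> ennreal ?C * (\<Prod>b\<in>Basis. ennreal (exp (- (a/2) * (y \<bullet> b)\<^sup>2)))"
      by (simp add: prod_ennreal ennreal_mult[symmetric] prod_nonneg)
  qed
  also have "\<dots> = ennreal ?C * (\<Prod>b\<in>(Basis :: 'a set). (\<integral>\<^sup>+ t. ennreal (exp (- (a/2) * t\<^sup>2)) \<partial>lborel))"
    by (subst nn_integral_cmult, simp, subst nn_integral_lborel_prod) auto
  also have "\<dots> < \<infinity>"
  proof -
    have "(\<integral>\<^sup>+ t. ennreal (exp (- (a/2) * t\<^sup>2)) \<partial>lborel) < \<infinity>"
      using integrable_exp_square[of "a/2"] assms by (simp add: integrable_iff_bounded)
    then show ?thesis
      by (simp add: ennreal_mult_less_top power_less_top_ennreal)
  qed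
  finally show "(\<integral>\<^sup>+ y. ennreal (norm (exp (c * norm (y :: 'a) - a * (norm y)\<^sup>2))) \<partial>lborel) < \<infinity>" .
qed

lemma lborel_integral_shift:
  fixes f :: "'a::euclidean_space \<Rightarrow> real"
  assumes [measurable]: "f \<in> borel_measurable borel"
  shows "(\<integral>x. f (x + c) \<partial>lborel) = (\<integral>x. f x \<partial>lborel)"
proof -
  have "(\<integral>x. f x \<partial>lborel) = (\<integral>x. f x \<partial>distr lborel borel ((+) c))"
    by (simp add: lborel_distr_plus)
  also have "\<dots> = (\<integral>x. f (c + x) \<partial>lborel)" by (subst integral_distr) auto
  finally show ?thesis by (simp add: add.commute)
qed

lemma lborel_nn_integral_shift:
  fixes f :: "'a::euclidean_space \<Rightarrow> ennreal"
  assumes [measurable]: "f \<in> borel_measurable borel"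
  shows "(\<integral>\<^sup>+x. f (x + c) \<partial>lborel) = (\<integral>\<^sup>+x. f x \<partial>lborel)"
proof -
  have "(\<integral>\<^sup>+x. f x \<partial>lborel) = (\<integral>\<^sup>+x. f x \<partial>distr lborel borel ((+) c))"
    by (simp add: lborel_distr_plus)
  also have "\<dots> = (\<integral>\<^sup>+x. f (c + x) \<partial>lborel)" by (subst nn_integral_distr) auto
  finally show ?thesis by (simp add: add.commute)
qed

section \<open>Differentiation under the integral sign, and functions of exponential growth\<close>

text \<open>Dominated convergence for difference quotients along an arbitrary sequence tending to 0;
  the mean value theorem bounds them by the dominating function of the derivative.\<close>

lemma has_derivative_integral_at_0:
  fixes \<phi> :: "real \<Rightarrow> 'a \<Rightarrow> real"
  assumes int: "\<And>s. integrable M (\<phi> s)"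
    and der: "\<And>s y. ((\<lambda>s. \<phi> s y) has_real_derivative \<phi>' s y) (at s)"
    and meas: "\<phi>' 0 \<in> borel_measurable M"
    and bound: "\<And>s y. \<bar>s\<bar> \<le> 1 \<Longrightarrow> \<bar>\<phi>' s y\<bar> \<le> D y"
    and D: "integrable M D"
  shows "((\<lambda>s. \<integral>y. \<phi> s y \<partial>M) has_real_derivative (\<integral>y. \<phi>' 0 y \<partial>M)) (at 0)"
proof -
  have "((\<lambda>s. ((\<integral>y. \<phi> s y \<partial>M) - (\<integral>y. \<phi> 0 y \<partial>M)) / (s - 0)) \<longlongrightarrow> (\<integral>y. \<phi>' 0 y \<partial>M)) (at 0)"
    unfolding tendsto_at_iff_sequentially comp_def
  proof (intro allI impI)
    fix X :: "nat \<Rightarrow> real" assume X: "\<forall>i. X i \<in> UNIV - {0}" and lim: "X \<longlonglongrightarrow> 0"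
    then have "eventually (\<lambda>i. \<bar>X i\<bar> < 1) sequentially"
      using tendstoD[OF lim, of 1] by simp
    then obtain N where N: "\<And>i. i \<ge> N \<Longrightarrow> \<bar>X i\<bar> < 1"
      by (auto simp: eventually_sequentially)
    show "(\<lambda>i. ((\<integral>y. \<phi> (X i) y \<partial>M) - (\<integral>y. \<phi> 0 y \<partial>M)) / (X i - 0)) \<longlonglongrightarrow> (\<integral>y. \<phi>' 0 y \<partial>M)"
    \<comment> \<open>The domination holds only for parameters in \<open>{-1..1}\<close>, so the
      terms before \<open>N\<close> are dropped.\<close>
    proof (rule LIMSEQ_offset[where k = N])
      have "(\<lambda>i. \<integral>y. (\<phi> (X (i + N)) y - \<phi> 0 y) / (X (i + N) - 0) \<partial>M) \<longlonglongrightarrow> (\<integral>y. \<phi>' 0 y \<partial>M)"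
      proof (rule integral_dominated_convergence[OF meas _ D])
        show "(\<lambda>y. (\<phi> (X (i + N)) y - \<phi> 0 y) / (X (i + N) - 0)) \<in> borel_measurable M" for i
          using int by (intro borel_measurable_divide borel_measurable_diff) auto
        show "AE y in M. (\<lambda>i. (\<phi> (X (i + N)) y - \<phi> 0 y) / (X (i + N) - 0)) \<longlonglongrightarrow> \<phi>' 0 y"
        proof (rule AE_I2)
          fix y
          have "((\<lambda>s. (\<phi> s y - \<phi> 0 y) / (s - 0)) \<longlongrightarrow> \<phi>' 0 y) (at 0)"
            using der[of y 0] by (simp add: has_field_derivative_iff)
          moreover have "(\<lambda>i. X (i + N)) \<longlonglongrightarrow> 0" using lim by (rule LIMSEQ_ignore_initial_segment)
          ultimately show "(\<lambda>i. (\<phi> (X (i + N)) y - \<phi> 0 y) / (X (i + N) - 0)) \<longlonglongrightarrow> \<phi>' 0 y"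
            using X unfolding tendsto_at_iff_sequentially comp_def by auto
        qed
        show "AE y in M. norm ((\<phi> (X (i + N)) y - \<phi> 0 y) / (X (i + N) - 0)) \<le> D y" for i
        proof (rule AE_I2)
          fix y
          have "norm (\<phi> (X (i + N)) y - \<phi> 0 y) \<le> D y * norm (X (i + N) - 0)"
          proof (rule field_differentiable_bound[where S = "{-1..1}"])
            show "((\<lambda>s. \<phi> s y) has_real_derivative \<phi>' s y) (at s within {-1..1})" for s
              using der by (rule has_field_derivative_at_within)
            show "norm (\<phi>' s y) \<le> D y" if "s \<in> {-1..1}" for s
              using bound[of s y] that by auto
            show "X (i + N) \<in> {-1..1}" using N[of "i + N"] by auto
          qed auto
          moreover have "X (i + N) \<noteq> 0" using X by auto
          ultimately show "norm ((\<phi> (X (i + N)) y - \<phi> 0 y) / (X (i + N) - 0)) \<le> D y"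
            by (simp add: field_simps abs_mult)
        qed
      qed
      then show "(\<lambda>i. ((\<integral>y. \<phi> (X (i + N)) y \<partial>M) - (\<integral>y. \<phi> 0 y \<partial>M)) / (X (i + N) - 0))
          \<longlonglongrightarrow> (\<integral>y. \<phi>' 0 y \<partial>M)"
        using int by simp
    qed
  qed
  then show ?thesis by (simp add: has_field_derivative_iff)
qed

text \<open>A class closed under sums, products, powers and translations and integrable against
  every nondegenerate Gaussian, so that integrability becomes a matter of syntax. It contains
  functions with Lipschitz gradient and their products with polynomials.\<close>

definition exp_growth :: "('a :: real_normed_vector \<Rightarrow> real) \<Rightarrow> bool" where
  "exp_growth f \<longleftrightarrow> f \<in> borel_measurable borel \<and> (\<exists>K c. \<forall>y. \<bar>f y\<bar> \<le> K * exp (c * norm y))"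

lemma exp_growthD:
  fixes f :: "'a :: real_normed_vector \<Rightarrow> real"
  assumes "exp_growth f"
  shows "\<exists>K c. K \<ge> 0 \<and> c \<ge> 0 \<and> (\<forall>y. \<bar>f y\<bar> \<le> K * exp (c * norm y))"
proof -
  obtain K c where *: "\<bar>f y\<bar> \<le> K * exp (c * norm y)" for y
    using assms unfolding exp_growth_def by auto
  have "\<bar>f y\<bar> \<le> \<bar>K\<bar> * exp (\<bar>c\<bar> * norm y)" for y
  proof -
    have "\<bar>f y\<bar> \<le> K * exp (c * norm y)" by (rule *)
    also have "\<dots> \<le> \<bar>K\<bar> * exp (\<bar>c\<bar> * norm y)"
      by (intro mult_mono) (auto intro: mult_right_mono)
    finally show ?thesis .
  qed
  then show ?thesis by (intro exI[of _ "\<bar>K\<bar>"] exI[of _ "\<bar>c\<bar>"]) auto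
qed

lemma exp_growthI:
  assumes "f \<in> borel_measurable borel" "\<And>y. \<bar>f y\<bar> \<le> K * exp (c * norm y)"
  shows "exp_growth f"
  using assms unfolding exp_growth_def by auto

lemma exp_growth_measurable [measurable_dest]: "exp_growth f \<Longrightarrow> f \<in> borel_measurable borel"
  by (simp add: exp_growth_def)

lemma exp_growth_const [simp, intro]: "exp_growth (\<lambda>_ :: 'a :: real_normed_vector. k)"
  by (rule exp_growthI[of _ "\<bar>k\<bar>" 0]) auto

lemma exp_growth_norm [simp, intro]: "exp_growth (norm :: 'a :: real_normed_vector \<Rightarrow> real)"
proof (rule exp_growthI[of _ 1 1])
  show "\<bar>norm y\<bar> \<le> 1 * exp (1 * norm y)" for y :: 'a
    using exp_ge_add_one_self[of "norm y"] by (simp del: exp_ge_add_one_self)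
qed simp

lemma exp_growth_le:
  assumes "exp_growth g" "f \<in> borel_measurable borel" "\<And>y. \<bar>f y\<bar> \<le> \<bar>g y\<bar>"
  shows "exp_growth f"
proof -
  obtain K c where g: "K \<ge> 0" "c \<ge> 0" "\<And>y. \<bar>g y\<bar> \<le> K * exp (c * norm y)"
    using exp_growthD[OF assms(1)] by auto
  show ?thesis by (rule exp_growthI[OF assms(2)]) (rule order_trans[OF assms(3) g(3)])
qed

lemma exp_growth_add [intro]:
  assumes "exp_growth f" "exp_growth g"
  shows "exp_growth (\<lambda>y. f y + g y)"
proof -
  obtain K c where f: "K \<ge> 0" "c \<ge> 0" "\<And>y. \<bar>f y\<bar> \<le> K * exp (c * norm y)"
    using exp_growthD[OF assms(1)] by auto
  obtain K' c' where g: "K' \<ge> 0" "c' \<ge> 0" "\<And>y. \<bar>g y\<bar> \<le> K' * exp (c' * norm y)"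
    using exp_growthD[OF assms(2)] by auto
  have "\<bar>f y + g y\<bar> \<le> (K + K') * exp ((c + c') * norm y)" for y
  proof -
    have "\<bar>f y + g y\<bar> \<le> K * exp (c * norm y) + K' * exp (c' * norm y)"
      using f(3)[of y] g(3)[of y] by linarith
    also have "\<dots> \<le> K * exp ((c + c') * norm y) + K' * exp ((c + c') * norm y)"
      using f g by (intro add_mono mult_left_mono) (auto simp: distrib_right)
    finally show ?thesis by (simp add: distrib_right)
  qed
  moreover have "(\<lambda>y. f y + g y) \<in> borel_measurable borel"
    using assms by (intro borel_measurable_add) (auto simp: exp_growth_def)
  ultimately show ?thesis by (intro exp_growthI)
qed

lemma exp_growth_mult [intro]:
  assumes "exp_growth f" "exp_growth g"
  shows "exp_growth (\<lambda>y. f y * g y)"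
proof -
  obtain K c where f: "K \<ge> 0" "c \<ge> 0" "\<And>y. \<bar>f y\<bar> \<le> K * exp (c * norm y)"
    using exp_growthD[OF assms(1)] by auto
  obtain K' c' where g: "K' \<ge> 0" "c' \<ge> 0" "\<And>y. \<bar>g y\<bar> \<le> K' * exp (c' * norm y)"
    using exp_growthD[OF assms(2)] by auto
  have "\<bar>f y * g y\<bar> \<le> (K * K') * exp ((c + c') * norm y)" for y
  proof -
    have "\<bar>f y * g y\<bar> \<le> (K * exp (c * norm y)) * (K' * exp (c' * norm y))"
      unfolding abs_mult using f g by (intro mult_mono) auto
    then show ?thesis unfolding distrib_right exp_add by (simp only: mult_ac)
  qed
  moreover have "(\<lambda>y. f y * g y) \<in> borel_measurable borel"
    using assms by (intro borel_measurable_times) (auto simp: exp_growth_def)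
  ultimately show ?thesis by (intro exp_growthI)
qed

lemma exp_growth_power [intro]: "exp_growth f \<Longrightarrow> exp_growth (\<lambda>y. f y ^ n)"
  by (induction n) auto

lemma exp_growth_sum [intro]: "(\<And>i. i \<in> I \<Longrightarrow> exp_growth (f i)) \<Longrightarrow> exp_growth (\<lambda>y. \<Sum>i\<in>I. f i y)"
  by (induction I rule: infinite_finite_induct) auto

lemma exp_growth_inner [simp, intro]: "exp_growth (\<lambda>y. u \<bullet> y)" for u :: "'a::euclidean_space"
proof (rule exp_growth_le)
  show "exp_growth (\<lambda>y :: 'a. norm u * norm y)" by (intro exp_growth_mult) auto
  show "\<bar>u \<bullet> y\<bar> \<le> \<bar>norm u * norm y\<bar>" for y
    using Cauchy_Schwarz_ineq2[of u y] by simp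
qed simp

lemma exp_growth_shift:
  fixes f :: "'a::euclidean_space \<Rightarrow> real"
  assumes "exp_growth f"
  shows "exp_growth (\<lambda>y. f (y + x))"
proof -
  obtain K c where f: "K \<ge> 0" "c \<ge> 0" "\<And>y. \<bar>f y\<bar> \<le> K * exp (c * norm y)"
    using exp_growthD[OF assms(1)] by auto
  have "\<bar>f (y + x)\<bar> \<le> (K * exp (c * norm x)) * exp (c * norm y)" for y
  proof -
    have "\<bar>f (y + x)\<bar> \<le> K * exp (c * norm (y + x))" by (rule f)
    also have "\<dots> \<le> K * exp (c * norm x + c * norm y)"
      using f norm_triangle_ineq[of y x]
      by (intro mult_left_mono) (auto simp flip: distrib_left intro: mult_left_mono)
    finally show ?thesis by (simp add: exp_add mult_ac)
  qed
  moreover have "(\<lambda>y. f (y + x)) \<in> borel_measurable borel"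
    using exp_growth_measurable[OF assms] by simp
  ultimately show ?thesis by (intro exp_growthI)
qed

section \<open>Integration by parts and moments of a nondegenerate Gaussian\<close>

locale gauss =
  fixes W :: "real ^ 'd ^ 'd"
  assumes pd: "pos_def_matrix W"
begin

lemma symm: "(W *v x) \<bullet> y = x \<bullet> (W *v y)"
  using pd inner_mv_symm unfolding pos_def_matrix_def by blast

lemma form_nonneg: "0 \<le> y \<bullet> (W *v y)"
  using pos_def_imp_psd[OF pd] by (simp add: psd_matrix_def)

lemma integrable_kernel_exp: "integrable lborel (\<lambda>y. gauss_kernel W y * exp (c * norm y))"
proof -
  obtain a where a: "a > 0" "\<And>x. a * (norm x)\<^sup>2 \<le> x \<bullet> (W *v x)"
    using pos_def_coercive[OF pd] by blast
  show ?thesis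
  proof (rule Bochner_Integration.integrable_bound)
    show "integrable lborel (\<lambda>y :: real ^ 'd. exp (c * norm y - (a/2) * (norm y)\<^sup>2))"
      using a by (intro integrable_exp_norm_square) auto
    show "AE y in lborel. norm (gauss_kernel W y * exp (c * norm y))
        \<le> norm (exp (c * norm y - (a/2) * (norm y)\<^sup>2))"
      using a(2) by (auto simp: gauss_kernel_def simp flip: exp_add)
  qed measurable
qed

lemma integrable_kernel: "integrable lborel (gauss_kernel W)"
  using integrable_kernel_exp[of 0] by simp

lemma kernel_integral_pos: "0 < (\<integral>y. gauss_kernel W y \<partial>lborel)"
proof -
  have "(\<integral>y. gauss_kernel W y \<partial>lborel) \<noteq> 0"
  proof
    assume "(\<integral>y. gauss_kernel W y \<partial>lborel) = 0"
    then have "AE y in (lborel :: (real ^ 'd) measure). gauss_kernel W y = 0"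
      using integral_nonneg_eq_0_iff_AE[OF integrable_kernel] by (auto simp: less_imp_le)
    then have "AE y in (lborel :: (real ^ 'd) measure). False"
      by eventually_elim (metis gauss_kernel_pos less_irrefl)
    then show False by (simp add: AE_iff_null emeasure_lborel_UNIV null_sets_def)
  qed
  moreover have "0 \<le> (\<integral>y. gauss_kernel W y \<partial>lborel)"
    by (intro Bochner_Integration.integral_nonneg) (auto simp: less_imp_le)
  ultimately show ?thesis by simp
qed

lemma integrable_gaussian:
  assumes "exp_growth f"
  shows "integrable (gaussian W) f"
proof -
  obtain K c where f: "K \<ge> 0" "c \<ge> 0" "\<And>y. \<bar>f y\<bar> \<le> K * exp (c * norm y)"
    using exp_growthD[OF assms(1)] by auto
  note [measurable] = exp_growth_measurable[OF assms]
  have "integrable lborel (\<lambda>y. gauss_kernel W y * f y)"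
  proof (rule Bochner_Integration.integrable_bound)
    show "integrable lborel (\<lambda>y. K * (gauss_kernel W y * exp (c * norm y)))"
      by (intro integrable_mult_right integrable_kernel_exp)
    show "AE y in lborel. norm (gauss_kernel W y * f y)
        \<le> norm (K * (gauss_kernel W y * exp (c * norm y)))"
      using f by (auto simp: abs_mult less_imp_le mult.left_commute[of K] intro!: mult_left_mono)
  qed measurable
  then have "integrable lborel (\<lambda>y. gauss_kernel W y * f y / (\<integral>y. gauss_kernel W y \<partial>lborel))"
    by simp
  then show ?thesis unfolding gaussian_def
    using kernel_integral_pos
    by (subst integrable_density) (auto simp: less_imp_le)
qed

lemma prob_space_gaussian: "prob_space (gaussian W)"
proof
  have "emeasure (gaussian W) (space (gaussian W)) =
      (\<integral>\<^sup>+y. ennreal (gauss_kernel W y / (\<integral>y. gauss_kernel W y \<partial>lborel)) \<partial>lborel)"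
    by (simp add: gaussian_def emeasure_density)
  also have "\<dots> = ennreal (\<integral>y. gauss_kernel W y / (\<integral>y. gauss_kernel W y \<partial>lborel) \<partial>lborel)"
    using integrable_kernel kernel_integral_pos
    by (intro nn_integral_eq_integral) (auto simp: less_imp_le)
  also have "\<dots> = 1" using kernel_integral_pos by simp
  finally show "emeasure (gaussian W) (space (gaussian W)) = 1" .
qed

text \<open>Translating the integrand is the same as translating the density, so no smoothness of
  the integrand is needed.\<close>

lemma has_derivative_gaussian_shift:
  assumes f: "exp_growth f"
  shows "((\<lambda>s. \<integral>y. f (y + s *\<^sub>R w) \<partial>gaussian W) has_real_derivative
    (\<integral>y. f (y + s *\<^sub>R w) * (w \<bullet> (W *v y)) \<partial>gaussian W)) (at s)"
proof -
  \<comment> \<open>The derivative at 0 suffices: a general \<open>s\<close> is reached by applying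
    this to the translate of \<open>f\<close> by \<open>s *\<^sub>R w\<close>, which has exponential
    growth as well.\<close>
  have main: "((\<lambda>s. \<integral>y. f (y + s *\<^sub>R w) \<partial>gaussian W) has_real_derivative
    (\<integral>y. f y * (w \<bullet> (W *v y)) \<partial>gaussian W)) (at 0)" if f: "exp_growth f" for f
  proof -
    note [measurable] = exp_growth_measurable[OF f]
    let ?Z = "\<integral>y. gauss_kernel W y \<partial>lborel"
    obtain K c where K: "K \<ge> 0" "c \<ge> 0" "\<And>y. \<bar>f y\<bar> \<le> K * exp (c * norm y)"
      using exp_growthD[OF f] by auto
    define u where "u = W *v w"
    have wWy: "w \<bullet> (W *v y) = u \<bullet> y" for y unfolding u_def by (simp add: symm)
    have kern: "gauss_kernel W (y - s *\<^sub>R w) =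
        gauss_kernel W y * exp (s * (u \<bullet> y) - s\<^sup>2 * (w \<bullet> u) / 2)" for s y
    proof -
      have "(y - s *\<^sub>R w) \<bullet> (W *v (y - s *\<^sub>R w)) =
          y \<bullet> (W *v y) - s * (y \<bullet> u) - s * (w \<bullet> (W *v y)) + s * s * (w \<bullet> u)"
        by (simp only: matrix_vector_mult_diff_distrib matrix_vector_mult_scaleR inner_diff_left
            inner_diff_right inner_scaleR_left inner_scaleR_right u_def) (simp add: algebra_simps)
      also have "\<dots> = y \<bullet> (W *v y) - 2 * s * (u \<bullet> y) + s\<^sup>2 * (w \<bullet> u)"
        by (simp add: wWy inner_commute[of y u] power2_eq_square)
      finally have "(y - s *\<^sub>R w) \<bullet> (W *v (y - s *\<^sub>R w)) =
          y \<bullet> (W *v y) - 2 * s * (u \<bullet> y) + s\<^sup>2 * (w \<bullet> u)" .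
      then show ?thesis unfolding gauss_kernel_def exp_add[symmetric]
        by (intro arg_cong[of _ _ exp]) (simp add: field_simps)
    qed
    have wu: "0 \<le> w \<bullet> u" unfolding u_def by (rule form_nonneg)
    define \<phi> where "\<phi> s y = f y * gauss_kernel W (y - s *\<^sub>R w)" for s y
    define \<phi>' where "\<phi>' s y = f y * (gauss_kernel W (y - s *\<^sub>R w) * (u \<bullet> y - s * (w \<bullet> u)))" for s y
    \<comment> \<open>The exponent collects three sources: \<open>c\<close> from \<open>f\<close>,
      \<open>norm u\<close> from the shifted kernel, and 1 from estimating the linear factor of the
      derivative by an exponential.\<close>
    define D where "D y = K * (1 + norm u + w \<bullet> u) * (gauss_kernel W y * exp ((c + norm u + 1) * norm y))" for y
    have kb: "gauss_kernel W (y - s *\<^sub>R w) \<le> gauss_kernel W y * exp (\<bar>s\<bar> * norm u * norm y)" for s y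
    proof -
      have "s * (u \<bullet> y) \<le> \<bar>s\<bar> * (norm u * norm y)"
      proof -
        have "s * (u \<bullet> y) \<le> \<bar>s\<bar> * \<bar>u \<bullet> y\<bar>" by (simp flip: abs_mult)
        also have "\<dots> \<le> \<bar>s\<bar> * (norm u * norm y)"
          by (intro mult_left_mono Cauchy_Schwarz_ineq2) auto
        finally show ?thesis .
      qed
      moreover have "0 \<le> s\<^sup>2 * (w \<bullet> u) / 2" using wu by simp
      ultimately show ?thesis unfolding kern by (intro mult_left_mono) (auto simp: less_imp_le mult.assoc)
    qed
    have int: "integrable lborel (\<phi> s)" for s
    proof (rule Bochner_Integration.integrable_bound)
      show "integrable lborel (\<lambda>y. K * (gauss_kernel W y * exp ((c + \<bar>s\<bar> * norm u) * norm y)))"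
        by (intro integrable_mult_right integrable_kernel_exp)
      show "AE y in lborel. norm (\<phi> s y) \<le> norm (K * (gauss_kernel W y * exp ((c + \<bar>s\<bar> * norm u) * norm y)))"
      proof (rule AE_I2)
        fix y
        have "\<bar>\<phi> s y\<bar> \<le> (K * exp (c * norm y)) * (gauss_kernel W y * exp (\<bar>s\<bar> * norm u * norm y))"
          unfolding \<phi>_def abs_mult using K kb by (intro mult_mono) (auto simp: less_imp_le)
        also have "\<dots> = K * (gauss_kernel W y * exp ((c + \<bar>s\<bar> * norm u) * norm y))"
          unfolding distrib_right exp_add by (simp only: mult_ac)
        finally show "norm (\<phi> s y) \<le> norm (K * (gauss_kernel W y * exp ((c + \<bar>s\<bar> * norm u) * norm y)))"
          using K by (simp add: abs_mult less_imp_le)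
      qed
    qed (unfold \<phi>_def[abs_def], measurable)
    have "((\<lambda>s. \<integral>y. \<phi> s y \<partial>lborel) has_real_derivative (\<integral>y. \<phi>' 0 y \<partial>lborel)) (at 0)"
    proof (rule has_derivative_integral_at_0[OF int])
      show "((\<lambda>s. \<phi> s y) has_real_derivative \<phi>' s y) (at s)" for s y
        unfolding \<phi>_def \<phi>'_def kern
        by (auto intro!: derivative_eq_intros simp: field_simps power2_eq_square)
      show "\<phi>' 0 \<in> borel_measurable lborel" unfolding \<phi>'_def by measurable
      show "integrable lborel D" unfolding D_def
        by (intro integrable_mult_right integrable_kernel_exp)
      fix s :: real and y assume s: "\<bar>s\<bar> \<le> 1"
      have "\<bar>u \<bullet> y - s * (w \<bullet> u)\<bar> \<le> norm u * norm y + 1 * (w \<bullet> u)"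
      proof -
        have "\<bar>s * (w \<bullet> u)\<bar> \<le> 1 * (w \<bullet> u)"
          unfolding abs_mult using s wu by (intro mult_mono) auto
        then show ?thesis using Cauchy_Schwarz_ineq2[of u y] by linarith
      qed
      also have "\<dots> \<le> norm u * exp (norm y) + (1 + w \<bullet> u) * exp (norm y)"
      proof (rule add_mono)
        have "norm y \<le> exp (norm y)" using exp_ge_add_one_self[of "norm y"] by linarith
        then show "norm u * norm y \<le> norm u * exp (norm y)" by (rule mult_left_mono) simp
        have "1 * (w \<bullet> u) \<le> exp (norm y) * (1 + w \<bullet> u)"
          using wu by (intro mult_mono) auto
        then show "1 * (w \<bullet> u) \<le> (1 + w \<bullet> u) * exp (norm y)" by (simp only: mult.commute)
      qed
      finally have b1: "\<bar>u \<bullet> y - s * (w \<bullet> u)\<bar> \<le> (1 + norm u + w \<bullet> u) * exp (norm y)"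
        by (simp add: distrib_right)
      have "gauss_kernel W (y - s *\<^sub>R w) \<le> gauss_kernel W y * exp (\<bar>s\<bar> * norm u * norm y)" by (rule kb)
      also have "\<dots> \<le> gauss_kernel W y * exp (1 * norm u * norm y)"
        using s by (intro mult_left_mono) (auto intro!: mult_right_mono simp: less_imp_le mult_left_le_one_le)
      finally have b2: "gauss_kernel W (y - s *\<^sub>R w) \<le> gauss_kernel W y * exp (norm u * norm y)" by simp
      have "\<bar>\<phi>' s y\<bar> \<le> (K * exp (c * norm y)) *
          ((gauss_kernel W y * exp (norm u * norm y)) * ((1 + norm u + w \<bullet> u) * exp (norm y)))"
        unfolding \<phi>'_def abs_mult using K b1 b2 by (intro mult_mono) (auto simp: less_imp_le)
      also have "\<dots> = D y" unfolding D_def distrib_right[of _ _ "norm y"] exp_add by (simp add: mult_ac)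
      finally show "\<bar>\<phi>' s y\<bar> \<le> D y" .
    qed
    then have "((\<lambda>s. (\<integral>y. \<phi> s y \<partial>lborel) / ?Z) has_real_derivative (\<integral>y. \<phi>' 0 y \<partial>lborel) / ?Z) (at 0)"
      by (rule DERIV_cdivide)
    moreover have "(\<integral>y. \<phi> s y \<partial>lborel) / ?Z = (\<integral>y. f (y + s *\<^sub>R w) \<partial>gaussian W)" for s
      using lborel_integral_shift[of "\<lambda>y. gauss_kernel W (y - s *\<^sub>R w) * f y" "s *\<^sub>R w"]
      unfolding \<phi>_def by (subst integral_gaussian) (auto simp: mult.commute)
    moreover have "(\<integral>y. \<phi>' 0 y \<partial>lborel) / ?Z = (\<integral>y. f y * (w \<bullet> (W *v y)) \<partial>gaussian W)"
      unfolding \<phi>'_def by (subst integral_gaussian) (auto simp: wWy mult_ac)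
    ultimately show ?thesis by simp
  qed
  have "((\<lambda>t. \<integral>y. f (y + t *\<^sub>R w + s *\<^sub>R w) \<partial>gaussian W) has_real_derivative
      (\<integral>y. f (y + s *\<^sub>R w) * (w \<bullet> (W *v y)) \<partial>gaussian W)) (at 0)"
    by (rule main[OF exp_growth_shift[OF f]])
  then have "((\<lambda>t. \<integral>y. f (y + (t + s) *\<^sub>R w) \<partial>gaussian W) has_real_derivative
      (\<integral>y. f (y + s *\<^sub>R w) * (w \<bullet> (W *v y)) \<partial>gaussian W)) (at 0)"
    by (simp add: scaleR_add_left add.assoc)
  then show ?thesis using DERIV_shift[of "\<lambda>t. \<integral>y. f (y + t *\<^sub>R w) \<partial>gaussian W" _ 0 s] by simp
qed

end

lemma inner_matrix: "A \<bullet> D = (\<Sum>i\<in>UNIV. \<Sum>j\<in>UNIV. A $ i $ j * D $ i $ j)"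
  for A :: "real ^ 'n ^ 'm"
  by (simp add: inner_vec_def)

context gauss
begin

lemma inv_simps [simp]: "W *v (matrix_inv W *v v) = v" "matrix_inv W *v (W *v v) = v"
  using matrix_inv_mult[OF pos_def_invertible[OF pd]] by (simp_all add: matrix_vector_mul_assoc)

text \<open>In the direction \<open>matrix_inv W *v v\<close> the factor
  \<open>w \<bullet> (W *v y)\<close> of the shift formula becomes \<open>v \<bullet> y\<close>.
  This is Gaussian integration by parts with the derivative outside the integral; moments follow by
  computing the shifted mean as a polynomial in \<open>s\<close> and comparing derivatives at
  0.\<close>

lemma stein:
  assumes "exp_growth f"
  shows "((\<lambda>s. \<integral>y. f (y + s *\<^sub>R (matrix_inv W *v v)) \<partial>gaussian W) has_real_derivative
    (\<integral>y. f y * (v \<bullet> y) \<partial>gaussian W)) (at 0)"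
proof -
  have "(matrix_inv W *v v) \<bullet> (W *v y) = v \<bullet> y" for y
    by (subst symm[symmetric]) simp
  then show ?thesis using has_derivative_gaussian_shift[OF assms, of "matrix_inv W *v v" 0] by simp
qed

lemma measure_UNIV [simp]: "measure (gaussian W) UNIV = 1"
  using prob_space.prob_space[OF prob_space_gaussian] by simp

lemma integrable_const [simp]: "integrable (gaussian W) (\<lambda>_. c :: real)"
  by (intro integrable_gaussian) auto

lemma mean_zero: "(\<integral>y. v \<bullet> y \<partial>gaussian W) = 0"
proof -
  have "((\<lambda>s. 1 :: real) has_real_derivative (\<integral>y. v \<bullet> y \<partial>gaussian W)) (at 0)"
    using stein[of "\<lambda>_. 1" v] by simp
  moreover have "((\<lambda>s. 1 :: real) has_real_derivative 0) (at 0)" by simp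
  ultimately show ?thesis by (rule DERIV_unique)
qed

lemma covariance: "(\<integral>y. (u \<bullet> y) * (v \<bullet> y) \<partial>gaussian W) = u \<bullet> (matrix_inv W *v v)"
proof -
  have "(\<integral>y. u \<bullet> (y + s *\<^sub>R (matrix_inv W *v v)) \<partial>gaussian W) = s * (u \<bullet> (matrix_inv W *v v))" for s
    by (simp add: inner_add_right integrable_gaussian mean_zero)
  then have "((\<lambda>s. s * (u \<bullet> (matrix_inv W *v v))) has_real_derivative
      (\<integral>y. (u \<bullet> y) * (v \<bullet> y) \<partial>gaussian W)) (at 0)"
    using stein[OF exp_growth_inner, of u v] by simp
  moreover have "((\<lambda>s. s * (u \<bullet> (matrix_inv W *v v))) has_real_derivative (u \<bullet> (matrix_inv W *v v))) (at 0)"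
    by (auto intro!: derivative_eq_intros)
  ultimately show ?thesis by (rule DERIV_unique)
qed

lemma fourth_moment: "(\<integral>y. (u \<bullet> y) ^ 4 \<partial>gaussian W) = 3 * (u \<bullet> (matrix_inv W *v u))\<^sup>2"
proof -
  define k where "k = u \<bullet> (matrix_inv W *v u)"
  \<comment> \<open>The third moment may stay unknown, as it is a constant in \<open>s\<close> and
    disappears on differentiation.\<close>
  define m where "m = (\<integral>y. (u \<bullet> y) ^ 3 \<partial>gaussian W)"
  have m2: "(\<integral>y. (u \<bullet> y)\<^sup>2 \<partial>gaussian W) = k"
    using covariance[of u u] by (simp add: k_def power2_eq_square)
  have int [simp]: "integrable (gaussian W) (\<lambda>y. (u \<bullet> y) ^ j)" for j
    by (intro integrable_gaussian) auto
  have "(\<integral>y. (u \<bullet> (y + s *\<^sub>R (matrix_inv W *v u))) ^ 3 \<partial>gaussian W) = m + 3 * s * k * k + s ^ 3 * k ^ 3" for s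
  proof -
    have "(\<integral>y. (u \<bullet> (y + s *\<^sub>R (matrix_inv W *v u))) ^ 3 \<partial>gaussian W) =
      (\<integral>y. (u \<bullet> y) ^ 3 + 3 * s * k * (u \<bullet> y)\<^sup>2 + 3 * (s * k)\<^sup>2 * (u \<bullet> y) + s ^ 3 * k ^ 3 \<partial>gaussian W)"
      by (intro Bochner_Integration.integral_cong)
         (auto simp: inner_add_right k_def[symmetric] power3_eq_cube power2_eq_square algebra_simps)
    also have "\<dots> = m + 3 * s * k * k + 3 * (s * k)\<^sup>2 * 0 + s ^ 3 * k ^ 3"
      using int[of 1] by (simp add: m2 m_def[symmetric] mean_zero)
    finally show ?thesis by simp
  qed
  then have "((\<lambda>s. m + 3 * s * k * k + s ^ 3 * k ^ 3) has_real_derivative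
      (\<integral>y. (u \<bullet> y) ^ 3 * (u \<bullet> y) \<partial>gaussian W)) (at 0)"
    using stein[of "\<lambda>y. (u \<bullet> y) ^ 3" u] by auto
  moreover have "((\<lambda>s. m + 3 * s * k * k + s ^ 3 * k ^ 3) has_real_derivative (3 * k * k)) (at 0)"
    by (auto intro!: derivative_eq_intros)
  ultimately have "(\<integral>y. (u \<bullet> y) ^ 3 * (u \<bullet> y) \<partial>gaussian W) = 3 * k * k" by (rule DERIV_unique)
  moreover have "(u \<bullet> y) ^ 3 * (u \<bullet> y) = (u \<bullet> y) ^ 4" for y
    by (simp add: power3_eq_cube power4_eq_xxxx)
  ultimately show ?thesis by (simp add: k_def power2_eq_square)
qed

text \<open>The score \<open>w \<bullet> (W *v y)\<close> is a centred Gaussian variable with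
  variance \<open>w \<bullet> (W *v w)\<close>. Averaging
  \<open>\<bar>t\<bar> \<le> (t\<^sup>2 / k + k) / 2\<close> with \<open>k\<close> the standard
  deviation replaces Cauchy-Schwarz. This is the price of moving one derivative onto the
  density.\<close>

lemma abs_score_le: "(\<integral>y. \<bar>w \<bullet> (W *v y)\<bar> \<partial>gaussian W) \<le> sqrt (w \<bullet> (W *v w))"
proof (cases "w = 0")
  case False
  define u where "u = W *v w"
  define k where "k = sqrt (w \<bullet> (W *v w))"
  have k: "k > 0" "k\<^sup>2 = w \<bullet> (W *v w)"
    using pd False unfolding k_def pos_def_matrix_def by (auto simp: less_imp_le)
  have wy: "w \<bullet> (W *v y) = u \<bullet> y" for y by (simp add: u_def symm)
  have "(\<integral>y. \<bar>u \<bullet> y\<bar> \<partial>gaussian W) \<le> (\<integral>y. ((u \<bullet> y)\<^sup>2 / k + k) / 2 \<partial>gaussian W)"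
  proof (rule integral_mono)
    show "integrable (gaussian W) (\<lambda>y. \<bar>u \<bullet> y\<bar>)"
      by (intro integrable_abs integrable_gaussian) auto
    show "integrable (gaussian W) (\<lambda>y. ((u \<bullet> y)\<^sup>2 / k + k) / 2)"
      unfolding divide_inverse by (intro integrable_gaussian exp_growth_mult exp_growth_add) auto
    fix y
    have "0 \<le> (\<bar>u \<bullet> y\<bar> - k)\<^sup>2" by simp
    then have "2 * k * \<bar>u \<bullet> y\<bar> \<le> (u \<bullet> y)\<^sup>2 + k\<^sup>2" by (simp add: power2_diff mult_ac)
    then show "\<bar>u \<bullet> y\<bar> \<le> ((u \<bullet> y)\<^sup>2 / k + k) / 2"
      using k by (simp add: field_simps power2_eq_square)
  qed
  also have "\<dots> = ((\<integral>y. (u \<bullet> y)\<^sup>2 \<partial>gaussian W) / k + k) / 2"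
  proof -
    have "integrable (gaussian W) (\<lambda>y. (u \<bullet> y)\<^sup>2)" by (intro integrable_gaussian) auto
    moreover have "integrable (gaussian W) (\<lambda>y. k)" by (intro integrable_gaussian) auto
    ultimately show ?thesis by (subst integral_divide_zero) (simp)
  qed
  also have "(\<integral>y. (u \<bullet> y)\<^sup>2 \<partial>gaussian W) = k\<^sup>2"
    using covariance[of u u] by (simp add: power2_eq_square k(2)[unfolded power2_eq_square] u_def inner_commute)
  also have "(k\<^sup>2 / k + k) / 2 = k" using k(1) by (simp add: power2_eq_square)
  finally show ?thesis by (simp add: wy k_def u_def)
qed simp

lemma inv_pd: "pos_def_matrix (matrix_inv W)"
  by (rule pos_def_inv[OF pd])

lemma norm_sq_sum: "(norm (y :: real ^ 'd))\<^sup>2 = (\<Sum>i\<in>UNIV. (axis i 1 \<bullet> y)\<^sup>2)"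
  by (simp add: norm_vec_def L2_set_def sum_nonneg inner_axis')

lemma integral_norm_sq: "(\<integral>y. (norm y)\<^sup>2 \<partial>gaussian W) = trace (matrix_inv W)"
proof -
  have "integrable (gaussian W) (\<lambda>y. (axis i 1 \<bullet> y)\<^sup>2)" for i
    by (intro integrable_gaussian) auto
  then show ?thesis unfolding norm_sq_sum trace_def
    using covariance[of "axis _ 1" "axis _ 1"] by (simp add: axis_form power2_eq_square)
qed

text \<open>Each mixed moment is reduced to pure fourth moments by an arithmetic-geometric mean
  inequality. The weights are the ratios of the variances \<open>A i\<close> and \<open>A j\<close>,
  chosen so that both halves contribute equally and the sum is
  \<open>3 * (A i * A j)\<close>.\<close>

lemma integral_norm_4: "(\<integral>y. norm y ^ 4 \<partial>gaussian W) \<le> 3 * (trace (matrix_inv W))\<^sup>2"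
proof -
  define A where "A i = matrix_inv W $ i $ i" for i
  have A: "A i > 0" for i unfolding A_def by (rule pos_def_diag_pos[OF inv_pd])
  have int [simp]: "integrable (gaussian W) (\<lambda>y. (axis i 1 \<bullet> y) ^ k)" for i k
    by (intro integrable_gaussian) auto
  have int2 [simp]: "integrable (gaussian W) (\<lambda>y. (axis i 1 \<bullet> y)\<^sup>2 * (axis j 1 \<bullet> y)\<^sup>2)" for i j
    by (intro integrable_gaussian exp_growth_mult) auto
  have "norm y ^ 4 = (\<Sum>i\<in>UNIV. \<Sum>j\<in>UNIV. (axis i 1 \<bullet> y)\<^sup>2 * (axis j 1 \<bullet> y)\<^sup>2)" for y :: "real ^ 'd"
  proof -
    have "norm y ^ 4 = (norm y)\<^sup>2 * (norm y)\<^sup>2" by (simp add: power2_eq_square power4_eq_xxxx)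
    then show ?thesis unfolding norm_sq_sum sum_product .
  qed
  then have "(\<integral>y. norm y ^ 4 \<partial>gaussian W) =
      (\<Sum>i\<in>UNIV. \<Sum>j\<in>UNIV. \<integral>y. (axis i 1 \<bullet> y)\<^sup>2 * (axis j 1 \<bullet> y)\<^sup>2 \<partial>gaussian W)"
    by simp
  also have "\<dots> \<le> (\<Sum>i\<in>UNIV. \<Sum>j\<in>UNIV. 3 * (A i * A j))"
  proof (intro sum_mono)
    fix i j
    have "(\<integral>y. (axis i 1 \<bullet> y)\<^sup>2 * (axis j 1 \<bullet> y)\<^sup>2 \<partial>gaussian W) \<le>
        (\<integral>y. (A j / (2 * A i)) * (axis i 1 \<bullet> y) ^ 4 + (A i / (2 * A j)) * (axis j 1 \<bullet> y) ^ 4 \<partial>gaussian W)"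
    proof (rule integral_mono[OF int2])
      show "integrable (gaussian W) (\<lambda>y. (A j / (2 * A i)) * (axis i 1 \<bullet> y) ^ 4 + (A i / (2 * A j)) * (axis j 1 \<bullet> y) ^ 4)"
        by (intro Bochner_Integration.integrable_add integrable_mult_right int)
      fix y :: "real ^ 'd"
      define p where "p = (axis i 1 \<bullet> y)\<^sup>2"
      define q where "q = (axis j 1 \<bullet> y)\<^sup>2"
      have "0 \<le> (A j * p - A i * q)\<^sup>2" by simp
      then have "p * q \<le> (A j / (2 * A i)) * p\<^sup>2 + (A i / (2 * A j)) * q\<^sup>2"
        using A[of i] A[of j] by (simp add: field_simps power2_eq_square)
      then show "(axis i 1 \<bullet> y)\<^sup>2 * (axis j 1 \<bullet> y)\<^sup>2 \<le>
          (A j / (2 * A i)) * (axis i 1 \<bullet> y) ^ 4 + (A i / (2 * A j)) * (axis j 1 \<bullet> y) ^ 4"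
        by (simp add: p_def q_def flip: power_mult)
    qed
    also have "\<dots> = (A j / (2 * A i)) * (3 * (A i)\<^sup>2) + (A i / (2 * A j)) * (3 * (A j)\<^sup>2)"
      by (simp add: fourth_moment axis_form A_def)
    also have "\<dots> = 3 * (A i * A j)" using A[of i] A[of j] by (simp add: field_simps power2_eq_square)
    finally show "(\<integral>y. (axis i 1 \<bullet> y)\<^sup>2 * (axis j 1 \<bullet> y)\<^sup>2 \<partial>gaussian W) \<le> 3 * (A i * A j)" .
  qed
  also have "\<dots> = 3 * (trace (matrix_inv W))\<^sup>2"
    unfolding trace_def A_def power2_eq_square sum_product by (simp add: sum_distrib_left)
  finally show ?thesis .
qed

text \<open>Interpolation between the second and the fourth moment at the scale
  \<open>t = sqrt (trace (matrix_inv W))\<close>: the two terms contribute 1/2 and 3/2 times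
  \<open>t ^ 3\<close>.\<close>

lemma integral_norm_3: "(\<integral>y. norm y ^ 3 \<partial>gaussian W) \<le> 2 * sqrt (trace (matrix_inv W)) ^ 3"
proof -
  define t where "t = sqrt (trace (matrix_inv W))"
  have t: "t > 0" "t\<^sup>2 = trace (matrix_inv W)"
    using pos_def_trace_pos[OF inv_pd] by (auto simp: t_def)
  have int [simp]: "integrable (gaussian W) (\<lambda>y. norm y ^ k)" for k
    by (intro integrable_gaussian) auto
  have "(\<integral>y. norm y ^ 3 \<partial>gaussian W) \<le> (\<integral>y. (t / 2) * (norm y)\<^sup>2 + (1 / (2 * t)) * norm y ^ 4 \<partial>gaussian W)"
  proof (rule integral_mono)
    fix y :: "real ^ 'd"
    have "0 \<le> (norm y * (t - norm y))\<^sup>2" by simp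
    then show "norm y ^ 3 \<le> (t / 2) * (norm y)\<^sup>2 + (1 / (2 * t)) * norm y ^ 4"
      using t by (simp add: field_simps power2_eq_square power3_eq_cube power4_eq_xxxx)
  qed (auto intro!: Bochner_Integration.integrable_add integrable_mult_right)
  also have "\<dots> = (t / 2) * t\<^sup>2 + (1 / (2 * t)) * (\<integral>y. norm y ^ 4 \<partial>gaussian W)"
    by (simp add: integral_norm_sq t)
  also have "\<dots> \<le> (t / 2) * t\<^sup>2 + (1 / (2 * t)) * (3 * (t\<^sup>2)\<^sup>2)"
    using integral_norm_4 t by (intro add_left_mono mult_left_mono) auto
  also have "\<dots> = 2 * t ^ 3" using t(1) by (simp add: field_simps power2_eq_square power3_eq_cube)
  finally show ?thesis by (simp add: t_def)
qed

text \<open>The right-hand side is the Frobenius inner product of the covariance with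
  \<open>D\<close>; both sides are expanded in entries.\<close>

lemma integral_quad_form: "(\<integral>y. y \<bullet> (D *v y) \<partial>gaussian W) = matrix_inv W \<bullet> D"
proof -
  have int [simp]: "integrable (gaussian W) (\<lambda>y. y $ i * y $ j)" for i j
  proof -
    have "integrable (gaussian W) (\<lambda>y. (axis i 1 \<bullet> y) * (axis j 1 \<bullet> y))"
      by (intro integrable_gaussian exp_growth_mult) auto
    then show ?thesis by (simp add: inner_axis')
  qed
  have "(\<integral>y. y $ i * y $ j \<partial>gaussian W) = matrix_inv W $ i $ j" for i j
    using covariance[of "axis i 1" "axis j 1"] by (simp add: axis_form) (simp add: inner_axis')
  then show ?thesis unfolding quad_form_sum inner_matrix by (simp add: mult.commute)
qed

end

section \<open>Convolution of Gaussian measures\<close>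

text \<open>Completing the square in \<open>y\<close>. With
  \<open>p = matrix_inv (A + B) *v x\<close> one has \<open>x = A *v p + B *v p\<close>;
  substituting \<open>y = B *v p + t\<close> and \<open>x - y = A *v p - t\<close>, the terms linear
  in \<open>t\<close> cancel. The vector \<open>B *v p\<close> is the conditional mean of the second
  summand given the sum \<open>x\<close>.\<close>

lemma gauss_kernel_conv:
  fixes A B :: "real ^ 'd ^ 'd"
  assumes A: "pos_def_matrix A" and B: "pos_def_matrix B"
  shows "gauss_kernel (matrix_inv A) (x - y) * gauss_kernel (matrix_inv B) y =
    gauss_kernel (matrix_inv (A + B)) x *
    gauss_kernel (matrix_inv A + matrix_inv B) (y - B *v (matrix_inv (A + B) *v x))"
proof -
  define p where "p = matrix_inv (A + B) *v x"
  define t where "t = y - B *v p"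
  have C: "pos_def_matrix (A + B)" by (intro pos_def_add_psd A pos_def_imp_psd B)
  have ia: "matrix_inv A *v (A *v z) = z" for z
    using matrix_inv_mult[OF pos_def_invertible[OF A]] by (simp add: matrix_vector_mul_assoc)
  have ib: "matrix_inv B *v (B *v z) = z" for z
    using matrix_inv_mult[OF pos_def_invertible[OF B]] by (simp add: matrix_vector_mul_assoc)
  have sa: "(A *v u) \<bullet> (matrix_inv A *v v) = u \<bullet> v" for u v
  proof -
    have "(A *v u) \<bullet> (matrix_inv A *v v) = (matrix_inv A *v (A *v u)) \<bullet> v"
      by (metis inner_mv_symm pos_def_inv[OF A] pos_def_matrix_def)
    then show ?thesis by (simp add: ia)
  qed
  have sb: "(B *v u) \<bullet> (matrix_inv B *v v) = u \<bullet> v" for u v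
  proof -
    have "(B *v u) \<bullet> (matrix_inv B *v v) = (matrix_inv B *v (B *v u)) \<bullet> v"
      by (metis inner_mv_symm pos_def_inv[OF B] pos_def_matrix_def)
    then show ?thesis by (simp add: ib)
  qed
  have x: "x = A *v p + B *v p"
    unfolding p_def matrix_vector_mult_add_rdistrib[symmetric]
    using matrix_inv_mult[OF pos_def_invertible[OF C]] by (simp add: matrix_vector_mul_assoc)
  have y: "y = B *v p + t" by (simp add: t_def)
  have xy: "x - y = A *v p - t" by (simp add: x y)
  have "(x - y) \<bullet> (matrix_inv A *v (x - y)) + y \<bullet> (matrix_inv B *v y) =
      (A *v p) \<bullet> p + (B *v p) \<bullet> p + t \<bullet> (matrix_inv A *v t) + t \<bullet> (matrix_inv B *v t)"
    unfolding xy unfolding y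
    by (simp add: matrix_vector_mult_diff_distrib matrix_vector_right_distrib inner_diff_left
        inner_diff_right inner_add_left inner_add_right sa sb ia ib inner_commute[of t p])
  also have "\<dots> = x \<bullet> p + t \<bullet> ((matrix_inv A + matrix_inv B) *v t)"
    unfolding x by (simp add: inner_add_left inner_add_right matrix_vector_mult_add_rdistrib)
  finally have "(x - y) \<bullet> (matrix_inv A *v (x - y)) + y \<bullet> (matrix_inv B *v y) =
      x \<bullet> (matrix_inv (A + B) *v x) + t \<bullet> ((matrix_inv A + matrix_inv B) *v t)"
    by (simp add: p_def)
  then show ?thesis
    unfolding gauss_kernel_def exp_add[symmetric] t_def[symmetric] p_def[symmetric]
    by (intro arg_cong[of _ _ exp]) (simp add: field_simps p_def)
qed

lemma nn_integral_gaussian: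
  assumes [measurable]: "f \<in> borel_measurable borel"
  shows "(\<integral>\<^sup>+y. f y \<partial>gaussian W) =
    (\<integral>\<^sup>+y. ennreal (gauss_kernel W y / (\<integral>y. gauss_kernel W y \<partial>lborel)) * f y \<partial>lborel)"
  unfolding gaussian_def by (subst nn_integral_density) auto

text \<open>After completing the square, the density of the sum at \<open>x\<close> is the expected
  kernel times an integral over \<open>y\<close> that is independent of \<open>x\<close> by
  translation invariance. The value of that constant follows from both measures having total mass
  1.\<close>

lemma gaussian_convolution:
  fixes A B :: "real ^ 'd ^ 'd"
  assumes A: "pos_def_matrix A" and B: "pos_def_matrix B"
  shows "gaussian (matrix_inv (A + B)) =
    distr (gaussian (matrix_inv B) \<Otimes>\<^sub>M gaussian (matrix_inv A)) borel (\<lambda>(y, z). y + z)"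
    (is "_ = ?R")
proof -
  interpret ga: gauss "matrix_inv A" by standard (rule pos_def_inv[OF A])
  interpret gb: gauss "matrix_inv B" by standard (rule pos_def_inv[OF B])
  interpret gc: gauss "matrix_inv (A + B)"
    by standard (intro pos_def_inv pos_def_add_psd A pos_def_imp_psd B)
  interpret pa: prob_space "gaussian (matrix_inv A)" by (rule ga.prob_space_gaussian)
  interpret pb: prob_space "gaussian (matrix_inv B)" by (rule gb.prob_space_gaussian)
  interpret pc: prob_space "gaussian (matrix_inv (A + B))" by (rule gc.prob_space_gaussian)
  interpret pp: pair_prob_space "gaussian (matrix_inv B)" "gaussian (matrix_inv A)" ..
  let ?A = "gaussian (matrix_inv A)" and ?B = "gaussian (matrix_inv B)" and ?C = "gaussian (matrix_inv (A + B))"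
  let ?qA = "gauss_kernel (matrix_inv A)" and ?qB = "gauss_kernel (matrix_inv B)"
    and ?qC = "gauss_kernel (matrix_inv (A + B))"
  define a where "a = (\<integral>y. ?qA y \<partial>lborel)"
  define b where "b = (\<integral>y. ?qB y \<partial>lborel)"
  define c where "c = (\<integral>y. ?qC y \<partial>lborel)"
  have pos: "a > 0" "b > 0" "c > 0"
    unfolding a_def b_def c_def
    by (rule ga.kernel_integral_pos gb.kernel_integral_pos gc.kernel_integral_pos)+
  let ?qN = "gauss_kernel (matrix_inv A + matrix_inv B)"
  define \<kappa> where "\<kappa> = (\<integral>\<^sup>+y. ennreal (?qN y / (a * b)) \<partial>lborel)"
  have em: "emeasure ?R X = (\<integral>\<^sup>+x. ennreal (?qC x) * indicator X x \<partial>lborel) * \<kappa>"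
    if [measurable]: "X \<in> sets borel" for X
  proof -
    have "emeasure ?R X = (\<integral>\<^sup>+w. indicator X w \<partial>?R)" by simp
    also have "\<dots> = (\<integral>\<^sup>+w. indicator X (fst w + snd w) \<partial>(?B \<Otimes>\<^sub>M ?A))"
      by (subst nn_integral_distr) (auto simp: case_prod_beta)
    also have "\<dots> = (\<integral>\<^sup>+y. \<integral>\<^sup>+z. indicator X (y + z) \<partial>?A \<partial>?B)"
      by (subst pa.nn_integral_fst[symmetric]) auto
    also have "\<dots> = (\<integral>\<^sup>+y. ennreal (?qB y / b) *
        (\<integral>\<^sup>+z. ennreal (?qA z / a) * indicator X (y + z) \<partial>lborel) \<partial>lborel)"
      unfolding a_def b_def by (subst nn_integral_gaussian, simp, subst nn_integral_gaussian) auto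
    also have "\<dots> = (\<integral>\<^sup>+y. ennreal (?qB y / b) *
        (\<integral>\<^sup>+x. ennreal (?qA (x - y) / a) * indicator X x \<partial>lborel) \<partial>lborel)"
    proof -
      have "(\<integral>\<^sup>+z. ennreal (?qA z / a) * indicator X (y + z) \<partial>lborel) =
          (\<integral>\<^sup>+x. ennreal (?qA (x - y) / a) * indicator X x \<partial>lborel)" for y
        using lborel_nn_integral_shift[of "\<lambda>x. ennreal (?qA (x - y) / a) * indicator X x" y]
        by (simp add: add.commute)
      then show ?thesis by (simp only:)
    qed
    also have "\<dots> = (\<integral>\<^sup>+y. \<integral>\<^sup>+x. ennreal (?qB y / b) *
        (ennreal (?qA (x - y) / a) * indicator X x) \<partial>lborel \<partial>lborel)"
      by (intro nn_integral_cong nn_integral_cmult[symmetric]) auto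
    also have "\<dots> = (\<integral>\<^sup>+x. \<integral>\<^sup>+y. ennreal (?qB y / b) *
        (ennreal (?qA (x - y) / a) * indicator X x) \<partial>lborel \<partial>lborel)"
      by (rule lborel_pair.Fubini') (simp add: case_prod_beta)
    also have "\<dots> = (\<integral>\<^sup>+x. (ennreal (?qC x) * indicator X x) * \<kappa> \<partial>lborel)"
    proof (intro nn_integral_cong)
      fix x :: "real ^ 'd"
      define m where "m = B *v (matrix_inv (A + B) *v x)"
      have "(\<integral>\<^sup>+y. ennreal (?qB y / b) *
          (ennreal (?qA (x - y) / a) * indicator X x) \<partial>lborel) =
          (\<integral>\<^sup>+y. (ennreal (?qC x) * indicator X x) *
            ennreal (?qN (y - m) / (a * b)) \<partial>lborel)"
      proof (intro nn_integral_cong)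
        fix y :: "real ^ 'd"
        have "?qB y / b * (?qA (x - y) / a) =
            (?qA (x - y) * ?qB y) / (a * b)" by (simp add: mult.commute)
        also have "\<dots> = ?qC x * (?qN (y - m) / (a * b))"
          unfolding gauss_kernel_conv[OF A B] m_def by simp
        finally have "ennreal (?qB y / b) * ennreal (?qA (x - y) / a)
            = ennreal (?qC x) * ennreal (?qN (y - m) / (a * b))"
          using pos by (simp add: ennreal_mult[symmetric] less_imp_le)
        then show "ennreal (?qB y / b) *
          (ennreal (?qA (x - y) / a) * indicator X x) =
          (ennreal (?qC x) * indicator X x) *
            ennreal (?qN (y - m) / (a * b))"
          by (simp add: indicator_def)
      qed
      also have "\<dots> = (ennreal (?qC x) * indicator X x) *
          (\<integral>\<^sup>+y. ennreal (?qN (y - m) / (a * b)) \<partial>lborel)"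
        by (rule nn_integral_cmult) auto
      also have "(\<integral>\<^sup>+y. ennreal (?qN (y - m) / (a * b)) \<partial>lborel) = \<kappa>"
        using lborel_nn_integral_shift[of "\<lambda>y. ennreal (?qN y / (a * b))" "- m"]
        unfolding \<kappa>_def by simp
      finally show "(\<integral>\<^sup>+y. ennreal (?qB y / b) *
          (ennreal (?qA (x - y) / a) * indicator X x) \<partial>lborel) =
          (ennreal (?qC x) * indicator X x) * \<kappa>" .
    qed
    finally show ?thesis by (simp add: nn_integral_multc)
  qed
  have Zc: "(\<integral>\<^sup>+x. ennreal (?qC x) \<partial>lborel) = ennreal c"
    unfolding c_def using gc.integrable_kernel
    by (intro nn_integral_eq_integral) (auto simp: less_imp_le)
  \<comment> \<open>Total mass 1 pins down \<open>\<kappa>\<close> and also shows that it is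
    finite.\<close>
  have "prob_space ?R" by (intro pp.prob_space_distr) measurable
  then have "emeasure ?R UNIV = 1" using prob_space.emeasure_space_1 by fastforce
  then have "ennreal c * \<kappa> = 1" using em[of UNIV] Zc by simp
  then have "\<kappa> = ennreal (1 / c)"
  proof -
    assume *: "ennreal c * \<kappa> = 1"
    have "ennreal (1 / c) * (ennreal c * \<kappa>) = \<kappa>"
      using pos by (simp add: mult.assoc[symmetric] ennreal_mult[symmetric])
    then show ?thesis using * by simp
  qed
  show ?thesis
  proof (rule measure_eqI)
    fix X assume "X \<in> sets (?C)"
    then have [measurable]: "X \<in> sets borel" by simp
    have "emeasure (?C) X = (\<integral>\<^sup>+x. indicator X x \<partial>?C)"
      by simp
    also have "\<dots> = (\<integral>\<^sup>+x. (ennreal (?qC x) * indicator X x) * ennreal (1 / c) \<partial>lborel)"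
      unfolding c_def[symmetric]
      by (subst nn_integral_gaussian)
         (use pos in \<open>auto simp: c_def[symmetric] divide_inverse ennreal_mult less_imp_le mult_ac intro!: nn_integral_cong\<close>)
    also have "\<dots> = emeasure ?R X"
      unfolding em[OF \<open>X \<in> sets borel\<close>] \<open>\<kappa> = ennreal (1 / c)\<close> by (rule nn_integral_multc) auto
    finally show "emeasure (?C) X = emeasure ?R X" .
  qed simp
qed

lemma
  fixes A B :: "real ^ 'd ^ 'd" and f :: "real ^ 'd \<Rightarrow> real"
  assumes A: "pos_def_matrix A" and B: "pos_def_matrix B" and f: "exp_growth f"
  shows integral_gaussian_add: "(\<integral>v. (\<integral>y. f (v + y) \<partial>gaussian (matrix_inv A)) \<partial>gaussian (matrix_inv B)) =
      (\<integral>y. f y \<partial>gaussian (matrix_inv (A + B)))"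
    and integrable_gaussian_add: "integrable (gaussian (matrix_inv B)) (\<lambda>v. \<integral>y. f (v + y) \<partial>gaussian (matrix_inv A))"
proof -
  interpret ga: gauss "matrix_inv A" by standard (rule pos_def_inv[OF A])
  interpret gb: gauss "matrix_inv B" by standard (rule pos_def_inv[OF B])
  interpret gc: gauss "matrix_inv (A + B)"
    by standard (intro pos_def_inv pos_def_add_psd A pos_def_imp_psd B)
  interpret pa: prob_space "gaussian (matrix_inv A)" by (rule ga.prob_space_gaussian)
  interpret pb: prob_space "gaussian (matrix_inv B)" by (rule gb.prob_space_gaussian)
  interpret pp: pair_prob_space "gaussian (matrix_inv B)" "gaussian (matrix_inv A)" ..
  note [measurable] = exp_growth_measurable[OF f]
  have "integrable (distr (gaussian (matrix_inv B) \<Otimes>\<^sub>M gaussian (matrix_inv A)) borel (\<lambda>(y, z). y + z)) f"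
    using gc.integrable_gaussian[OF f] unfolding gaussian_convolution[OF A B] .
  then have int: "integrable (gaussian (matrix_inv B) \<Otimes>\<^sub>M gaussian (matrix_inv A)) (\<lambda>(v, y). f (v + y))"
    by (subst (asm) integrable_distr_eq) (auto simp: case_prod_unfold)
  show "integrable (gaussian (matrix_inv B)) (\<lambda>v. \<integral>y. f (v + y) \<partial>gaussian (matrix_inv A))"
    using pp.integrable_fst[OF int] by simp
  show "(\<integral>v. (\<integral>y. f (v + y) \<partial>gaussian (matrix_inv A)) \<partial>gaussian (matrix_inv B)) =
      (\<integral>y. f y \<partial>gaussian (matrix_inv (A + B)))"
    using pp.integral_fst[OF int] unfolding gaussian_convolution[OF A B]
    by (subst integral_distr) (auto simp: case_prod_unfold)
qed

section \<open>Gaussian smoothing of a function with Lipschitz gradient\<close>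

text \<open>Both \<open>c / (n + 1) * s ^ (n + 1) - f s\<close> and the same with a plus sign are
  nondecreasing. Iterating the lemma yields Taylor remainders with the factorial constants without
  integrating derivatives.\<close>

lemma DERIV_power_bound:
  fixes f :: "real \<Rightarrow> real"
  assumes der: "\<And>s. 0 \<le> s \<Longrightarrow> (f has_real_derivative f' s) (at s)"
    and bd: "\<And>s. 0 \<le> s \<Longrightarrow> \<bar>f' s\<bar> \<le> c * s ^ n"
    and t: "0 \<le> t"
  shows "\<bar>f t - f 0\<bar> \<le> c / (n + 1) * t ^ (n + 1)"
proof -
  have p: "((\<lambda>s. c / (n + 1) * s ^ (n + 1)) has_real_derivative c * s ^ n) (at s)" for s
  proof -
    have "((\<lambda>s. s ^ Suc n) has_real_derivative real (Suc n) * s ^ n) (at s)"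
      using DERIV_pow[of "Suc n" s] by simp
    then have "((\<lambda>s. c / (n + 1) * s ^ Suc n) has_real_derivative c / (n + 1) * (real (Suc n) * s ^ n)) (at s)"
      by (rule DERIV_cmult)
    moreover have "c / (n + 1) * (real (Suc n) * s ^ n) = c * s ^ n"
      by (simp add: divide_simps)
    ultimately show ?thesis by simp
  qed
  have "c / (n + 1) * 0 ^ (n + 1) - f 0 \<le> c / (n + 1) * t ^ (n + 1) - f t"
  proof (rule DERIV_nonneg_imp_nondecreasing[OF t])
    fix s assume s: "0 \<le> s" "s \<le> t"
    show "\<exists>y. ((\<lambda>s. c / (n + 1) * s ^ (n + 1) - f s) has_real_derivative y) (at s) \<and> 0 \<le> y"
      using bd[of s] s by (intro exI[of _ "c * s ^ n - f' s"] conjI DERIV_diff p der) auto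
  qed
  moreover have "c / (n + 1) * 0 ^ (n + 1) + f 0 \<le> c / (n + 1) * t ^ (n + 1) + f t"
  proof (rule DERIV_nonneg_imp_nondecreasing[OF t])
    fix s assume s: "0 \<le> s" "s \<le> t"
    show "\<exists>y. ((\<lambda>s. c / (n + 1) * s ^ (n + 1) + f s) has_real_derivative y) (at s) \<and> 0 \<le> y"
      using bd[of s] s by (intro exI[of _ "c * s ^ n + f' s"] conjI DERIV_add p der) auto
  qed
  ultimately show ?thesis by simp
qed

lemma DERIV_le_Lipschitz:
  fixes f :: "real \<Rightarrow> real"
  assumes der: "(f has_real_derivative d) (at 0)" and L: "\<And>s. \<bar>f s - f 0\<bar> \<le> L * \<bar>s\<bar>"
  shows "\<bar>d\<bar> \<le> L"
proof (rule tendsto_upperbound)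
  show "((\<lambda>s. \<bar>(f s - f 0) / (s - 0)\<bar>) \<longlongrightarrow> \<bar>d\<bar>) (at 0)"
    using der unfolding has_field_derivative_iff by (rule tendsto_rabs)
  show "eventually (\<lambda>s. \<bar>(f s - f 0) / (s - 0)\<bar> \<le> L) (at 0)"
    using L unfolding eventually_at_filter by (intro always_eventually) (auto simp: divide_le_eq abs_divide)
qed simp

locale smooth_fun =
  fixes h :: "real ^ 'd \<Rightarrow> real" and g :: "real ^ 'd \<Rightarrow> real ^ 'd" and L :: real
  assumes gderiv: "\<And>x. GDERIV h x :> g x"
    and lip: "\<And>x y. norm (g x - g y) \<le> L * norm (x - y)"
    and L_nonneg: "0 \<le> L"
begin

definition smooth :: "real ^ 'd ^ 'd \<Rightarrow> real ^ 'd \<Rightarrow> real" where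
  "smooth W x = (\<integral>y. h (x + y) \<partial>gaussian W)"

definition smooth_grad :: "real ^ 'd ^ 'd \<Rightarrow> real ^ 'd \<Rightarrow> real ^ 'd" where
  "smooth_grad W x = (\<chi> i. \<integral>y. g (x + y) $ i \<partial>gaussian W)"

text \<open>The second derivative of \<open>smooth W\<close> with only one derivative on
  \<open>h\<close>; the other is carried by the density, whose logarithmic gradient is
  \<open>- (W *v y)\<close>.\<close>

definition smooth_hess :: "real ^ 'd ^ 'd \<Rightarrow> real ^ 'd \<Rightarrow> real ^ 'd ^ 'd" where
  "smooth_hess W x = (\<chi> i j. \<integral>y. g (x + y) $ i * (W *v y) $ j \<partial>gaussian W)"

lemma measurable_h [measurable]: "h \<in> borel_measurable borel"
proof -
  have "continuous_on UNIV h"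
    using gderiv unfolding gderiv_def by (meson continuous_at_imp_continuous_on has_derivative_continuous)
  then show ?thesis by (rule borel_measurable_continuous_onI)
qed

lemma measurable_g [measurable]: "g \<in> borel_measurable borel"
proof -
  have "L-lipschitz_on UNIV g" using lip L_nonneg by (auto simp: lipschitz_on_def dist_norm)
  then show ?thesis by (intro borel_measurable_continuous_onI lipschitz_on_continuous_on)
qed

lemma DERIV_h: "((\<lambda>s. h (x + s *\<^sub>R v)) has_real_derivative g (x + s *\<^sub>R v) \<bullet> v) (at s)"
proof -
  have "((\<lambda>s. h (x + s *\<^sub>R v)) has_derivative (\<lambda>t. (t *\<^sub>R v) \<bullet> g (x + s *\<^sub>R v))) (at s)"
    using gderiv[of "x + s *\<^sub>R v", unfolded gderiv_def]
    by (rule has_derivative_compose[rotated]) (auto intro!: derivative_eq_intros)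
  then show ?thesis unfolding has_field_derivative_def by (simp add: inner_commute mult_commute_abs)
qed

lemma taylor1: "\<bar>h (x + v) - h x - g x \<bullet> v\<bar> \<le> L / 2 * (norm v)\<^sup>2"
proof -
  have "\<bar>(h (x + 1 *\<^sub>R v) - 1 * (g x \<bullet> v)) - (h (x + 0 *\<^sub>R v) - 0 * (g x \<bullet> v))\<bar> \<le>
      L * (norm v)\<^sup>2 / (1 + 1) * 1 ^ (1 + 1)"
  proof -
    have "((\<lambda>s. h (x + s *\<^sub>R v) - s * (g x \<bullet> v)) has_real_derivative g (x + s *\<^sub>R v) \<bullet> v - g x \<bullet> v) (at s)" for s
      by (rule DERIV_diff[OF DERIV_h]) (auto intro!: derivative_eq_intros)
    moreover have "\<bar>g (x + s *\<^sub>R v) \<bullet> v - g x \<bullet> v\<bar> \<le> L * (norm v)\<^sup>2 * s ^ 1" if "0 \<le> s" for s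
    proof -
      have "\<bar>(g (x + s *\<^sub>R v) - g x) \<bullet> v\<bar> \<le> norm (g (x + s *\<^sub>R v) - g x) * norm v"
        by (rule Cauchy_Schwarz_ineq2)
      also have "\<dots> \<le> (L * norm (s *\<^sub>R v)) * norm v"
        using lip[of "x + s *\<^sub>R v" x] by (intro mult_right_mono) auto
      finally show ?thesis using that by (simp add: inner_diff_left power2_eq_square mult_ac)
    qed
    ultimately show ?thesis
      using DERIV_power_bound[of "\<lambda>s. h (x + s *\<^sub>R v) - s * (g x \<bullet> v)"
        "\<lambda>s. g (x + s *\<^sub>R v) \<bullet> v - g x \<bullet> v" "L * (norm v)\<^sup>2" 1 1] by simp
  qed
  then have "\<bar>h (x + v) - g x \<bullet> v - h x\<bar> \<le> L / 2 * (norm v)\<^sup>2" by simp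
  then show ?thesis by linarith
qed

lemma norm_g_le: "norm (g x) \<le> norm (g 0) + L * norm x"
  using lip[of x 0] norm_triangle_sub[of "g x" "g 0"] by simp

lemma growth_g [intro]: "exp_growth (\<lambda>y. g (x + y) \<bullet> v)"
proof (rule exp_growth_le)
  show "exp_growth (\<lambda>y. (norm (g 0) + L * norm x + L * norm y) * norm v)"
    by (intro exp_growth_mult exp_growth_add) auto
  show "\<bar>g (x + y) \<bullet> v\<bar> \<le> \<bar>(norm (g 0) + L * norm x + L * norm y) * norm v\<bar>" for y
  proof -
    have "\<bar>g (x + y) \<bullet> v\<bar> \<le> norm (g (x + y)) * norm v" by (rule Cauchy_Schwarz_ineq2)
    also have "\<dots> \<le> (norm (g 0) + L * norm x + L * norm y) * norm v"
    proof (rule mult_right_mono)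
      have "L * norm (x + y) \<le> L * (norm x + norm y)"
        by (intro mult_left_mono norm_triangle_ineq L_nonneg)
      then show "norm (g (x + y)) \<le> norm (g 0) + L * norm x + L * norm y"
        using norm_g_le[of "x + y"] by (simp add: distrib_left)
    qed simp
    finally show ?thesis by linarith
  qed
qed measurable

lemma growth_g_nth [intro]: "exp_growth (\<lambda>y. g (x + y) $ i)"
  using growth_g[of x "axis i 1"] by (simp add: inner_axis)

lemma abs_h_le: "\<bar>h y\<bar> \<le> \<bar>h 0\<bar> + norm (g 0) * norm y + L / 2 * (norm y)\<^sup>2"
proof -
  have "\<bar>h y - h 0 - g 0 \<bullet> y\<bar> \<le> L / 2 * (norm y)\<^sup>2" using taylor1[of 0 y] by simp
  then show ?thesis using Cauchy_Schwarz_ineq2[of "g 0" y] by linarith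
qed

lemma growth_h [intro]: "exp_growth (\<lambda>y. h (x + y))"
proof -
  have "exp_growth h"
  proof (rule exp_growth_le)
    show "exp_growth (\<lambda>y :: real ^ 'd. \<bar>h 0\<bar> + norm (g 0) * norm y + L / 2 * (norm y)\<^sup>2)"
      by (intro exp_growth_add exp_growth_mult exp_growth_power) auto
    show "\<bar>h y\<bar> \<le> \<bar>\<bar>h 0\<bar> + norm (g 0) * norm y + L / 2 * (norm y)\<^sup>2\<bar>" for y
      using abs_h_le[of y] by linarith
  qed measurable
  from exp_growth_shift[OF this, of x] show ?thesis by (simp add: add.commute)
qed

lemma smooth_grad_inner:
  assumes "pos_def_matrix W"
  shows "smooth_grad W x \<bullet> v = (\<integral>y. g (x + y) \<bullet> v \<partial>gaussian W)"
proof -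
  interpret gauss W by standard fact
  show ?thesis
    unfolding inner_vec_def smooth_grad_def
    by (simp add: integrable_gaussian growth_g_nth)
qed

lemma smooth_hess_form:
  assumes "pos_def_matrix W"
  shows "v \<bullet> (smooth_hess W x *v v) = (\<integral>y. (g (x + y) \<bullet> v) * (v \<bullet> (W *v y)) \<partial>gaussian W)"
proof -
  interpret gauss W by standard fact
  have gr: "exp_growth (\<lambda>y. (W *v y) $ j)" for j
    using exp_growth_inner[of "W $ j"] by (simp add: matrix_vector_mul_component)
  have "(\<integral>y. (g (x + y) \<bullet> v) * (v \<bullet> (W *v y)) \<partial>gaussian W) =
      (\<integral>y. (\<Sum>i\<in>UNIV. \<Sum>j\<in>UNIV. (g (x + y) $ i * (W *v y) $ j) * (v $ i * v $ j)) \<partial>gaussian W)"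
    unfolding inner_vec_def[of "g _"] inner_vec_def[of v] sum_product
    by (intro Bochner_Integration.integral_cong sum.cong refl) (simp add: mult_ac)
  also have "\<dots> = (\<Sum>i\<in>UNIV. \<Sum>j\<in>UNIV. (\<integral>y. g (x + y) $ i * (W *v y) $ j \<partial>gaussian W) * (v $ i * v $ j))"
    by (simp add: integrable_gaussian exp_growth_mult growth_g_nth gr)
  finally show ?thesis unfolding quad_form_sum smooth_hess_def by simp
qed

text \<open>The entry is a directional derivative of a Gaussian mean of one component of
  \<open>g\<close>, and such a mean inherits the Lipschitz constant. The bound does not involve
  \<open>W\<close>, so the Hessian can serve as a bounded random weight.\<close>

lemma smooth_hess_bound:
  assumes "pos_def_matrix W"
  shows "\<bar>smooth_hess W x $ i $ j\<bar> \<le> L"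
proof -
  interpret gauss W by standard fact
  have "((\<lambda>s. \<integral>y. g (x + (y + s *\<^sub>R axis j 1)) $ i \<partial>gaussian W) has_real_derivative
    (\<integral>y. g (x + (y + 0 *\<^sub>R axis j 1)) $ i * (axis j 1 \<bullet> (W *v y)) \<partial>gaussian W)) (at 0)"
    by (rule has_derivative_gaussian_shift) (rule growth_g_nth)
  then have "((\<lambda>s. \<integral>y. g (x + (y + s *\<^sub>R axis j 1)) $ i \<partial>gaussian W) has_real_derivative
      smooth_hess W x $ i $ j) (at 0)"
    by (simp add: smooth_hess_def inner_axis')
  then show ?thesis
  proof (rule DERIV_le_Lipschitz)
    fix s :: real
    have i1: "integrable (gaussian W) (\<lambda>y. g (x + (y + s *\<^sub>R axis j 1)) $ i)" for s
      using integrable_gaussian[OF growth_g_nth[of "x + s *\<^sub>R axis j 1" i]] by (simp add: ac_simps)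
    have "\<bar>\<integral>y. g (x + (y + s *\<^sub>R axis j 1)) $ i - g (x + (y + 0 *\<^sub>R axis j 1)) $ i \<partial>gaussian W\<bar>
        \<le> (\<integral>y. L * \<bar>s\<bar> \<partial>gaussian W)"
    proof (rule order_trans[OF integral_abs_bound integral_mono])
      fix y
      have "\<bar>g (x + (y + s *\<^sub>R axis j 1)) $ i - g (x + (y + 0 *\<^sub>R axis j 1)) $ i\<bar> \<le>
          norm (g (x + (y + s *\<^sub>R axis j 1)) - g (x + (y + 0 *\<^sub>R axis j 1)))"
        using component_le_norm_cart[of "g (x + (y + s *\<^sub>R axis j 1)) - g (x + (y + 0 *\<^sub>R axis j 1))" i] by simp
      also have "\<dots> \<le> L * \<bar>s\<bar>"
        using lip[of "x + (y + s *\<^sub>R axis j 1)" "x + (y + 0 *\<^sub>R axis j 1)"] by simp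
      finally show "\<bar>g (x + (y + s *\<^sub>R axis j 1)) $ i - g (x + (y + 0 *\<^sub>R axis j 1)) $ i\<bar> \<le> L * \<bar>s\<bar>" .
    qed (rule integrable_abs Bochner_Integration.integrable_diff i1 integrable_const)+
    then show "\<bar>(\<integral>y. g (x + (y + s *\<^sub>R axis j 1)) $ i \<partial>gaussian W) -
        (\<integral>y. g (x + (y + 0 *\<^sub>R axis j 1)) $ i \<partial>gaussian W)\<bar> \<le> L * \<bar>s\<bar>"
      by (simp only: Bochner_Integration.integral_diff[OF i1 i1]) simp
  qed
qed

section \<open>Taylor expansions of the smoothed function\<close>

lemma smooth_taylor1:
  assumes "pos_def_matrix W"
  shows "\<bar>smooth W (x + v) - smooth W x - smooth_grad W x \<bullet> v\<bar> \<le> L / 2 * (norm v)\<^sup>2"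
proof -
  interpret gauss W by standard fact
  have i: "integrable (gaussian W) (\<lambda>y. h (x + y))" "integrable (gaussian W) (\<lambda>y. h (x + v + y))"
      "integrable (gaussian W) (\<lambda>y. g (x + y) \<bullet> v)"
    by (rule integrable_gaussian, rule growth_h growth_g)+
  have "\<bar>\<integral>y. h (x + v + y) - h (x + y) - g (x + y) \<bullet> v \<partial>gaussian W\<bar> \<le> (\<integral>y. L / 2 * (norm v)\<^sup>2 \<partial>gaussian W)"
  proof (rule order_trans[OF integral_abs_bound integral_mono])
    show "\<bar>h (x + v + y) - h (x + y) - g (x + y) \<bullet> v\<bar> \<le> L / 2 * (norm v)\<^sup>2" for y
      using taylor1[of "x + y" v] by (simp add: ac_simps)
  qed (rule integrable_abs Bochner_Integration.integrable_diff i integrable_const)+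
  then show ?thesis unfolding smooth_def smooth_grad_inner[OF assms] by (simp add: i)
qed

lemma DERIV_smooth:
  assumes "pos_def_matrix W"
  shows "((\<lambda>s. smooth W (x + s *\<^sub>R v)) has_real_derivative smooth_grad W (x + s *\<^sub>R v) \<bullet> v) (at s)"
proof -
  interpret gauss W by standard fact
  have main: "((\<lambda>s. smooth W (x + s *\<^sub>R v)) has_real_derivative smooth_grad W x \<bullet> v) (at 0)" for x
  proof -
    have "((\<lambda>s. smooth W (x + s *\<^sub>R v)) has_real_derivative (\<integral>y. g (x + 0 *\<^sub>R v + y) \<bullet> v \<partial>gaussian W)) (at 0)"
      unfolding smooth_def
    proof (rule has_derivative_integral_at_0[where \<phi>' = "\<lambda>s y. g (x + s *\<^sub>R v + y) \<bullet> v"])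
      show "integrable (gaussian W) (\<lambda>y. h (x + s *\<^sub>R v + y))" for s
        by (rule integrable_gaussian) (rule growth_h)
      show "((\<lambda>s. h (x + s *\<^sub>R v + y)) has_real_derivative g (x + s *\<^sub>R v + y) \<bullet> v) (at s)" for s y
        using DERIV_h[of "x + y" v s] by (simp add: ac_simps)
      show "(\<lambda>y. g (x + 0 *\<^sub>R v + y) \<bullet> v) \<in> borel_measurable (gaussian W)" by measurable
      show "integrable (gaussian W) (\<lambda>y. (norm (g 0) + L * (norm x + norm v + norm y)) * norm v)"
        by (intro integrable_gaussian exp_growth_mult exp_growth_add) auto
      fix s :: real and y assume s: "\<bar>s\<bar> \<le> 1"
      have "\<bar>g (x + s *\<^sub>R v + y) \<bullet> v\<bar> \<le> norm (g (x + s *\<^sub>R v + y)) * norm v" by (rule Cauchy_Schwarz_ineq2)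
      also have "\<dots> \<le> (norm (g 0) + L * (norm x + norm v + norm y)) * norm v"
      proof (rule mult_right_mono)
        have "norm (x + s *\<^sub>R v + y) \<le> norm x + \<bar>s\<bar> * norm v + norm y"
          using norm_triangle_ineq[of "x + s *\<^sub>R v" y] norm_triangle_ineq[of x "s *\<^sub>R v"] by simp
        also have "\<bar>s\<bar> * norm v \<le> 1 * norm v" using s by (intro mult_right_mono) auto
        finally have "L * norm (x + s *\<^sub>R v + y) \<le> L * (norm x + norm v + norm y)"
          using L_nonneg by (intro mult_left_mono) auto
        then show "norm (g (x + s *\<^sub>R v + y)) \<le> norm (g 0) + L * (norm x + norm v + norm y)"
          using norm_g_le[of "x + s *\<^sub>R v + y"] by linarith
      qed simp
      finally show "\<bar>g (x + s *\<^sub>R v + y) \<bullet> v\<bar> \<le> (norm (g 0) + L * (norm x + norm v + norm y)) * norm v" .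
    qed
    then show ?thesis by (simp add: smooth_grad_inner[OF assms])
  qed
  have "((\<lambda>t. smooth W (x + (t + s) *\<^sub>R v)) has_real_derivative smooth_grad W (x + s *\<^sub>R v) \<bullet> v) (at 0)"
    using main[of "x + s *\<^sub>R v"] by (simp add: algebra_simps)
  then show ?thesis using DERIV_shift[of "\<lambda>t. smooth W (x + t *\<^sub>R v)" _ 0 s] by simp
qed

text \<open>Along the segment the second derivative \<open>J\<close> is Lipschitz: the increment of
  \<open>g\<close> paired with \<open>v\<close> costs \<open>L * s * (norm v)\<^sup>2\<close>, and
  the mean absolute score in direction \<open>v\<close> is at most \<open>\<kappa> * norm v\<close>.
  Two applications of \<open>DERIV_power_bound\<close> then produce the factors 1/2 and 1/3.\<close>

lemma smooth_taylor2:
  assumes "pos_def_matrix W" and \<kappa>: "v \<bullet> (W *v v) \<le> (\<kappa> * norm v)\<^sup>2" "\<kappa> \<ge> 0"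
  shows "\<bar>smooth W (x + v) - smooth W x - smooth_grad W x \<bullet> v - (v \<bullet> (smooth_hess W x *v v)) / 2\<bar>
    \<le> L * \<kappa> / 6 * norm v ^ 3"
proof -
  interpret gauss W by standard fact
  define c where "c = L * \<kappa> * norm v ^ 3"
  define G where "G s = smooth_grad W (x + s *\<^sub>R v) \<bullet> v" for s
  define J where "J s = (\<integral>y. (g (x + s *\<^sub>R v + y) \<bullet> v) * (v \<bullet> (W *v y)) \<partial>gaussian W)" for s
  have J0: "J 0 = v \<bullet> (smooth_hess W x *v v)" by (simp add: J_def smooth_hess_form[OF assms(1)])
  have derG: "(G has_real_derivative J s) (at s)" for s
  proof -
    have "((\<lambda>s. \<integral>y. g (x + (y + s *\<^sub>R v)) \<bullet> v \<partial>gaussian W) has_real_derivative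
        (\<integral>y. (g (x + (y + s *\<^sub>R v)) \<bullet> v) * (v \<bullet> (W *v y)) \<partial>gaussian W)) (at s)"
      by (rule has_derivative_gaussian_shift) (rule growth_g)
    then show ?thesis unfolding G_def[abs_def] smooth_grad_inner[OF assms(1)] J_def by (simp add: ac_simps)
  qed
  have gr: "exp_growth (\<lambda>y. v \<bullet> (W *v y))"
    using exp_growth_inner[of "W *v v"] by (simp add: symm)
  have iJ: "integrable (gaussian W) (\<lambda>y. (g (z + y) \<bullet> v) * (v \<bullet> (W *v y)))" for z
    by (intro integrable_gaussian exp_growth_mult growth_g gr)
  have lipJ: "\<bar>J s - J 0\<bar> \<le> c * s ^ 1" if s: "0 \<le> s" for s
  proof -
    have "\<bar>J s - J 0\<bar> = \<bar>\<integral>y. (g (x + s *\<^sub>R v + y) \<bullet> v) * (v \<bullet> (W *v y)) - (g (x + y) \<bullet> v) * (v \<bullet> (W *v y)) \<partial>gaussian W\<bar>"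
      unfolding J_def using iJ[of "x + s *\<^sub>R v"] iJ[of x] by simp
    also have "\<dots> \<le> (\<integral>y. (L * s * (norm v)\<^sup>2) * \<bar>v \<bullet> (W *v y)\<bar> \<partial>gaussian W)"
    proof (rule order_trans[OF integral_abs_bound integral_mono])
      fix y
      have "\<bar>(g (x + s *\<^sub>R v + y) - g (x + y)) \<bullet> v\<bar> \<le> norm (g (x + s *\<^sub>R v + y) - g (x + y)) * norm v"
        by (rule Cauchy_Schwarz_ineq2)
      also have "\<dots> \<le> (L * norm (s *\<^sub>R v)) * norm v"
        using lip[of "x + s *\<^sub>R v + y" "x + y"] by (intro mult_right_mono) auto
      finally have "\<bar>(g (x + s *\<^sub>R v + y) - g (x + y)) \<bullet> v\<bar> \<le> L * s * (norm v)\<^sup>2"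
        using s by (simp add: power2_eq_square mult_ac)
      then have "\<bar>(g (x + s *\<^sub>R v + y) - g (x + y)) \<bullet> v\<bar> * \<bar>v \<bullet> (W *v y)\<bar> \<le> (L * s * (norm v)\<^sup>2) * \<bar>v \<bullet> (W *v y)\<bar>"
        by (rule mult_right_mono) simp
      then show "\<bar>(g (x + s *\<^sub>R v + y) \<bullet> v) * (v \<bullet> (W *v y)) - (g (x + y) \<bullet> v) * (v \<bullet> (W *v y))\<bar>
          \<le> (L * s * (norm v)\<^sup>2) * \<bar>v \<bullet> (W *v y)\<bar>"
        by (simp add: inner_diff_left left_diff_distrib flip: abs_mult)
    qed (rule integrable_abs Bochner_Integration.integrable_diff iJ integrable_mult_right
        integrable_gaussian gr)+
    also have "\<dots> = (L * s * (norm v)\<^sup>2) * (\<integral>y. \<bar>v \<bullet> (W *v y)\<bar> \<partial>gaussian W)" by simp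
    also have "\<dots> \<le> (L * s * (norm v)\<^sup>2) * (\<kappa> * norm v)"
    proof (intro mult_left_mono order_trans[OF abs_score_le])
      have "sqrt (v \<bullet> (W *v v)) \<le> sqrt ((\<kappa> * norm v)\<^sup>2)" using \<kappa>(1) by (rule real_sqrt_le_mono)
      then show "sqrt (v \<bullet> (W *v v)) \<le> \<kappa> * norm v" using \<kappa>(2) by simp
    qed (use s L_nonneg in auto)
    also have "\<dots> = c * s ^ 1" by (simp add: c_def power2_eq_square power3_eq_cube)
    finally show ?thesis .
  qed
  have b1: "\<bar>G s - G 0 - s * J 0\<bar> \<le> c / 2 * s ^ 2" if "0 \<le> s" for s
  proof -
    have "((\<lambda>s. G s - s * J 0) has_real_derivative J s - J 0) (at s)" for s
      by (rule DERIV_diff[OF derG]) (auto intro!: derivative_eq_intros)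
    from DERIV_power_bound[of "\<lambda>s. G s - s * J 0", OF this lipJ that]
    have "\<bar>G s - s * J 0 - G 0\<bar> \<le> c / 2 * s ^ 2" by (simp add: power2_eq_square)
    then show ?thesis by linarith
  qed
  have "\<bar>(smooth W (x + 1 *\<^sub>R v) - 1 * G 0 - 1\<^sup>2 * J 0 / 2) - (smooth W (x + 0 *\<^sub>R v) - 0 * G 0 - 0\<^sup>2 * J 0 / 2)\<bar>
      \<le> c / 2 / (2 + 1) * 1 ^ (2 + 1)"
  proof -
    have "((\<lambda>s. smooth W (x + s *\<^sub>R v) - s * G 0 - s\<^sup>2 * J 0 / 2) has_real_derivative G s - G 0 - s * J 0) (at s)" for s
      unfolding G_def[of s] by (auto intro!: derivative_eq_intros DERIV_smooth[OF assms(1)])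
    then show ?thesis
      using DERIV_power_bound[of "\<lambda>s. smooth W (x + s *\<^sub>R v) - s * G 0 - s\<^sup>2 * J 0 / 2" "\<lambda>s. G s - G 0 - s * J 0" "c / 2" 2 1] b1
      by simp
  qed
  then have "\<bar>smooth W (x + v) - smooth_grad W x \<bullet> v - (v \<bullet> (smooth_hess W x *v v)) / 2 - smooth W x\<bar>
      \<le> L * \<kappa> / 6 * norm v ^ 3"
    by (simp add: J0 G_def c_def)
  then show ?thesis by linarith
qed

section \<open>The effect of enlarging the covariance\<close>

text \<open>The first order term has mean zero under the centred Gaussian, and the remainder
  integrates to the trace. This covers the exchange in which the other function is \<open>h\<close>
  itself, and gives integrability of the smoothed functions at the partial sums.\<close>

lemma smooth_sub_le:
  assumes V: "pos_def_matrix V"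
  shows "\<bar>smooth (matrix_inv V) x - h x\<bar> \<le> L / 2 * trace V"
proof -
  interpret gauss "matrix_inv V" by standard (rule pos_def_inv[OF V])
  have inv: "matrix_inv (matrix_inv V) = V"
    by (rule matrix_inv_eqI) (rule matrix_inv_mult(2)[OF pos_def_invertible[OF V]])
  have i: "integrable (gaussian (matrix_inv V)) (\<lambda>y. h (x + y))"
      "integrable (gaussian (matrix_inv V)) (\<lambda>y. g x \<bullet> y)"
      "integrable (gaussian (matrix_inv V)) (\<lambda>y. (norm y)\<^sup>2)"
    by (intro integrable_gaussian growth_h exp_growth_inner exp_growth_power exp_growth_norm)+
  have "\<bar>\<integral>y. h (x + y) - h x - g x \<bullet> y \<partial>gaussian (matrix_inv V)\<bar> \<le> (\<integral>y. L / 2 * (norm y)\<^sup>2 \<partial>gaussian (matrix_inv V))"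
    by (rule order_trans[OF integral_abs_bound integral_mono])
       (rule integrable_abs Bochner_Integration.integrable_diff i integrable_mult_right
          integrable_const taylor1)+
  then show ?thesis by (simp add: i smooth_def mean_zero integral_norm_sq inv)
qed

lemma smooth_add:
  assumes A: "pos_def_matrix A" and V: "pos_def_matrix V"
  shows "smooth (matrix_inv (A + V)) x = (\<integral>v. smooth (matrix_inv A) (x + v) \<partial>gaussian (matrix_inv V))"
    and "integrable (gaussian (matrix_inv V)) (\<lambda>v. smooth (matrix_inv A) (x + v))"
  using integral_gaussian_add[OF A V growth_h[of x]] integrable_gaussian_add[OF A V growth_h[of x]]
  by (simp_all add: smooth_def add.assoc)

text \<open>By convolution, smoothing with \<open>A + V\<close> is smoothing with \<open>V\<close>
  of the function already smoothed with \<open>A\<close>, to which the first order expansion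
  applies.\<close>

lemma smooth_add_le_aux:
  assumes A: "pos_def_matrix A" and V: "pos_def_matrix V"
  shows "\<bar>smooth (matrix_inv (A + V)) x - smooth (matrix_inv A) x\<bar> \<le> L / 2 * trace V"
proof -
  interpret gauss "matrix_inv V" by standard (rule pos_def_inv[OF V])
  have inv: "matrix_inv (matrix_inv V) = V"
    by (rule matrix_inv_eqI) (rule matrix_inv_mult(2)[OF pos_def_invertible[OF V]])
  let ?u = "smooth (matrix_inv A)" and ?g = "smooth_grad (matrix_inv A) x"
  have i: "integrable (gaussian (matrix_inv V)) (\<lambda>v. ?u (x + v))"
      "integrable (gaussian (matrix_inv V)) (\<lambda>v. ?g \<bullet> v)"
      "integrable (gaussian (matrix_inv V)) (\<lambda>y. (norm y)\<^sup>2)"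
    by (rule smooth_add(2)[OF A V]) (intro integrable_gaussian exp_growth_inner exp_growth_power exp_growth_norm)+
  have "\<bar>\<integral>v. ?u (x + v) - ?u x - ?g \<bullet> v \<partial>gaussian (matrix_inv V)\<bar> \<le> (\<integral>y. L / 2 * (norm y)\<^sup>2 \<partial>gaussian (matrix_inv V))"
    by (rule order_trans[OF integral_abs_bound integral_mono])
       (rule integrable_abs Bochner_Integration.integrable_diff i integrable_mult_right
          integrable_const smooth_taylor1 pos_def_inv A)+
  then show ?thesis by (simp add: i smooth_add(1)[OF A V] mean_zero integral_norm_sq inv)
qed

lemma pos_def_add_eps:
  assumes "psd_matrix V" "\<epsilon> > 0"
  shows "pos_def_matrix (V + \<epsilon> *\<^sub>R mat 1 :: real ^ 'd ^ 'd)"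
  using pos_def_add_psd[OF pos_def_scaleR[OF pos_def_mat1 assms(2)] assms(1)] by (simp add: add.commute)

lemma trace_add_eps: "trace (V + \<epsilon> *\<^sub>R mat 1 :: real ^ 'd ^ 'd) = trace V + \<epsilon> * CARD('d)"
  by (simp add: trace_def sum.distrib mat_def)

text \<open>A singular \<open>V\<close> is not the covariance of a Gaussian with a density. The
  estimate is proved for \<open>V\<close> plus a multiple \<epsilon> of the identity and passed to
  the limit.\<close>

lemma smooth_add_le:
  assumes A: "pos_def_matrix A" and V: "psd_matrix V"
  shows "\<bar>smooth (matrix_inv (A + V)) x - smooth (matrix_inv A) x\<bar> \<le> L / 2 * trace V"
proof (rule tendsto_lowerbound)
  show "((\<lambda>\<epsilon> :: real. L / 2 * (trace V + \<epsilon> * CARD('d)) + L / 2 * (\<epsilon> * CARD('d))) \<longlongrightarrow> L / 2 * trace V) (at_right 0)"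
    by (auto intro!: tendsto_eq_intros)
  show "\<forall>\<^sub>F \<epsilon> in at_right (0 :: real). \<bar>smooth (matrix_inv (A + V)) x - smooth (matrix_inv A) x\<bar>
      \<le> L / 2 * (trace V + \<epsilon> * CARD('d)) + L / 2 * (\<epsilon> * CARD('d))"
  proof (rule eventually_at_right_less[THEN eventually_mono])
    fix \<epsilon> :: real assume \<epsilon>: "0 < \<epsilon>"
    have "\<bar>smooth (matrix_inv (A + (V + \<epsilon> *\<^sub>R mat 1))) x - smooth (matrix_inv A) x\<bar>
        \<le> L / 2 * (trace V + \<epsilon> * CARD('d))"
      using smooth_add_le_aux[OF A pos_def_add_eps[OF V \<epsilon>]] by (simp add: trace_add_eps)
    \<comment> \<open>Removing the perturbation is itself an enlargement of covariance, from
      \<open>A + V\<close> by a positive definite matrix of trace \<epsilon> times the dimension, so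
      no separate continuity of \<open>smooth\<close> in the covariance is called for.\<close>
    moreover have "\<bar>smooth (matrix_inv (A + (V + \<epsilon> *\<^sub>R mat 1))) x - smooth (matrix_inv (A + V)) x\<bar>
        \<le> L / 2 * (\<epsilon> * CARD('d))"
      using smooth_add_le_aux[OF pos_def_add_psd[OF A V] pos_def_scaleR[OF pos_def_mat1 \<epsilon>]]
        trace_add_eps[of 0 \<epsilon>] by (simp add: trace_def add.assoc)
    ultimately show "\<bar>smooth (matrix_inv (A + V)) x - smooth (matrix_inv A) x\<bar>
      \<le> L / 2 * (trace V + \<epsilon> * CARD('d)) + L / 2 * (\<epsilon> * CARD('d))"
      by linarith
  qed
qed simp

text \<open>Averaging the expansion of \<open>smooth_taylor2\<close> over a Gaussian with covariance
  \<open>V\<close>: the linear term vanishes, the quadratic one becomes a Frobenius product with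
  \<open>V\<close>, and the third moment bound doubles the remainder constant from 1/6 to
  1/3.\<close>

lemma smooth_add_taylor_aux:
  assumes A: "pos_def_matrix A" and V: "pos_def_matrix V"
    and \<kappa>: "\<And>v. v \<bullet> (matrix_inv A *v v) \<le> (\<kappa> * norm v)\<^sup>2" "\<kappa> \<ge> 0"
  shows "\<bar>smooth (matrix_inv (A + V)) x - smooth (matrix_inv A) x - (V \<bullet> smooth_hess (matrix_inv A) x) / 2\<bar>
    \<le> L * \<kappa> / 3 * sqrt (trace V) ^ 3"
proof -
  interpret gauss "matrix_inv V" by standard (rule pos_def_inv[OF V])
  have inv: "matrix_inv (matrix_inv V) = V"
    by (rule matrix_inv_eqI) (rule matrix_inv_mult(2)[OF pos_def_invertible[OF V]])
  let ?u = "smooth (matrix_inv A)" and ?g = "smooth_grad (matrix_inv A) x"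
    and ?D = "smooth_hess (matrix_inv A) x"
  have gD: "exp_growth (\<lambda>v. v \<bullet> (?D *v v))"
  proof -
    have "exp_growth (\<lambda>v :: real ^ 'd. v $ i)" for i
      using exp_growth_inner[of "axis i (1 :: real)"] by (simp add: inner_axis' inner_real_def)
    then show ?thesis unfolding quad_form_sum by (intro exp_growth_sum exp_growth_mult) auto
  qed
  have i: "integrable (gaussian (matrix_inv V)) (\<lambda>v. ?u (x + v))"
      "integrable (gaussian (matrix_inv V)) (\<lambda>v. ?g \<bullet> v)"
      "integrable (gaussian (matrix_inv V)) (\<lambda>y. norm y ^ 3)"
      "integrable (gaussian (matrix_inv V)) (\<lambda>v. v \<bullet> (?D *v v) / 2)"
    by (rule smooth_add(2)[OF A V])
       (intro integrable_gaussian integrable_divide_zero exp_growth_inner exp_growth_power exp_growth_norm gD)+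
  have "\<bar>\<integral>v. ?u (x + v) - ?u x - ?g \<bullet> v - (v \<bullet> (?D *v v)) / 2 \<partial>gaussian (matrix_inv V)\<bar>
      \<le> (\<integral>y. L * \<kappa> / 6 * norm y ^ 3 \<partial>gaussian (matrix_inv V))"
    by (rule order_trans[OF integral_abs_bound integral_mono])
       (rule integrable_abs Bochner_Integration.integrable_diff i integrable_mult_right
          integrable_const smooth_taylor2 pos_def_inv A \<kappa>)+
  also have "\<dots> = L * \<kappa> / 6 * (\<integral>y. norm y ^ 3 \<partial>gaussian (matrix_inv V))" by simp
  also have "\<dots> \<le> L * \<kappa> / 6 * (2 * sqrt (trace V) ^ 3)"
    using integral_norm_3 L_nonneg \<kappa>(2) by (intro mult_left_mono) (auto simp: inv)
  finally show ?thesis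
    using i(4) by (simp add: i smooth_add(1)[OF A V] mean_zero integral_quad_form inv)
qed

text \<open>The same passage to semidefinite \<open>V\<close>; here the perturbation also shifts the
  Hessian term, by a quantity linear in \<epsilon>.\<close>

lemma smooth_add_taylor:
  assumes A: "pos_def_matrix A" and V: "psd_matrix V"
    and \<kappa>: "\<And>v. v \<bullet> (matrix_inv A *v v) \<le> (\<kappa> * norm v)\<^sup>2" "\<kappa> \<ge> 0"
  shows "\<bar>smooth (matrix_inv (A + V)) x - smooth (matrix_inv A) x - (V \<bullet> smooth_hess (matrix_inv A) x) / 2\<bar>
    \<le> L * \<kappa> / 3 * sqrt (trace V) ^ 3"
proof (rule tendsto_lowerbound)
  let ?D = "smooth_hess (matrix_inv A) x"
  let ?R = "\<lambda>\<epsilon> :: real. L * \<kappa> / 3 * sqrt (trace V + \<epsilon> * CARD('d)) ^ 3 + L / 2 * (\<epsilon> * CARD('d)) + \<epsilon> * \<bar>mat 1 \<bullet> ?D\<bar> / 2"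
  show "(?R \<longlongrightarrow> L * \<kappa> / 3 * sqrt (trace V) ^ 3) (at_right 0)"
    by (auto intro!: tendsto_eq_intros)
  show "\<forall>\<^sub>F \<epsilon> in at_right 0. \<bar>smooth (matrix_inv (A + V)) x - smooth (matrix_inv A) x - (V \<bullet> ?D) / 2\<bar> \<le> ?R \<epsilon>"
  proof (rule eventually_at_right_less[THEN eventually_mono])
    fix \<epsilon> :: real assume \<epsilon>: "0 < \<epsilon>"
    have "\<bar>smooth (matrix_inv (A + (V + \<epsilon> *\<^sub>R mat 1))) x - smooth (matrix_inv A) x - (V \<bullet> ?D + \<epsilon> * (mat 1 \<bullet> ?D)) / 2\<bar>
        \<le> L * \<kappa> / 3 * sqrt (trace V + \<epsilon> * CARD('d)) ^ 3"
      using smooth_add_taylor_aux[OF A pos_def_add_eps[OF V \<epsilon>] \<kappa>]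
      by (simp add: trace_add_eps inner_add_left)
    moreover have "\<bar>smooth (matrix_inv (A + (V + \<epsilon> *\<^sub>R mat 1))) x - smooth (matrix_inv (A + V)) x\<bar>
        \<le> L / 2 * (\<epsilon> * CARD('d))"
      using smooth_add_le_aux[OF pos_def_add_psd[OF A V] pos_def_scaleR[OF pos_def_mat1 \<epsilon>]]
        trace_add_eps[of 0 \<epsilon>] by (simp add: trace_def add.assoc)
    moreover have "\<bar>\<epsilon> * (mat 1 \<bullet> ?D)\<bar> = \<epsilon> * \<bar>mat 1 \<bullet> ?D\<bar>" using \<epsilon> by (simp add: abs_mult)
    ultimately show "\<bar>smooth (matrix_inv (A + V)) x - smooth (matrix_inv A) x - (V \<bullet> ?D) / 2\<bar> \<le> ?R \<epsilon>"
      unfolding add_divide_distrib by linarith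
  qed
qed simp

end

section \<open>Measurability\<close>

text \<open>The measure itself varies with \<open>x\<close>. Written as a quotient of two integrals
  over the fixed measure \<open>lborel\<close>, the expression falls under the usual measurability
  of parameter integrals.\<close>

lemma borel_measurable_gaussian_integral:
  fixes W :: "'a \<Rightarrow> real ^ 'd ^ 'd" and f :: "'a \<Rightarrow> real ^ 'd \<Rightarrow> real"
  assumes W [measurable]: "W \<in> borel_measurable M"
    and f [measurable]: "(\<lambda>(x, y). f x y) \<in> borel_measurable (M \<Otimes>\<^sub>M borel)"
  shows "(\<lambda>x. \<integral>y. f x y \<partial>gaussian (W x)) \<in> borel_measurable M"
proof -
  have "(\<lambda>x. (\<integral>y. gauss_kernel (W x) y * f x y \<partial>lborel) / (\<integral>y. gauss_kernel (W x) y \<partial>lborel))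
      \<in> borel_measurable M"
    by (intro borel_measurable_divide lborel.borel_measurable_lebesgue_integral) measurable
  moreover have "(\<integral>y. f x y \<partial>gaussian (W x)) =
      (\<integral>y. gauss_kernel (W x) y * f x y \<partial>lborel) / (\<integral>y. gauss_kernel (W x) y \<partial>lborel)"
    if "x \<in> space M" for x
    using that by (intro integral_gaussian) measurable
  ultimately show ?thesis by (simp cong: measurable_cong)
qed

lemma borel_measurable_det:
  fixes f :: "'a \<Rightarrow> real ^ 'n ^ 'n"
  assumes [measurable]: "f \<in> borel_measurable M"
  shows "(\<lambda>x. det (f x)) \<in> borel_measurable M"
  unfolding det_def by (intro borel_measurable_sum borel_measurable_times borel_measurable_prod) measurable

text \<open>Cramer's rule makes the entries quotients of determinants where the determinant is
  nonzero. Elsewhere \<open>matrix_inv\<close> is a choice from the empty predicate, hence one fixed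
  matrix \<open>J\<close>.\<close>

lemma borel_measurable_matrix_inv [measurable (raw)]:
  fixes f :: "'a \<Rightarrow> real ^ 'n ^ 'n"
  assumes [measurable]: "f \<in> borel_measurable M"
  shows "(\<lambda>x. matrix_inv (f x)) \<in> borel_measurable M"
proof -
  define J :: "real ^ 'n ^ 'n" where "J = (SOME A'. False)"
  define C :: "real ^ 'n ^ 'n \<Rightarrow> 'n \<Rightarrow> 'n \<Rightarrow> real ^ 'n ^ 'n"
    where "C A i j = (\<chi> k l. if l = i then axis j 1 $ k else A $ k $ l)" for A i j
  have "matrix_inv A = (if det A \<noteq> 0 then (\<chi> i j. det (C A i j) / det A) else J)" for A :: "real ^ 'n ^ 'n"
  proof (cases "det A = 0")
    case True
    then have "\<not> invertible A" by (simp add: invertible_det_nz)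
    then have "(\<lambda>A'. A ** A' = mat 1 \<and> A' ** A = mat 1) = (\<lambda>A'. False)"
      unfolding invertible_def by blast
    then have "matrix_inv A = J" unfolding matrix_inv_def J_def by simp
    then show ?thesis using True by simp
  next
    case False
    then have "A ** matrix_inv A = mat 1" using invertible_det_nz matrix_inv_mult(1) by blast
    then have "A *v (matrix_inv A *v axis j 1) = axis j 1" for j
      by (simp add: matrix_vector_mul_assoc)
    then have "matrix_inv A *v axis j 1 = (\<chi> i. det (C A i j) / det A)" for j
      unfolding cramer[OF False] C_def .
    then have "matrix_inv A $ i $ j = det (C A i j) / det A" for i j
      by (simp add: matrix_vector_mult_basis column_def vec_eq_iff)
    then show ?thesis using False by (simp add: vec_eq_iff)
  qed
  moreover have "(\<lambda>x. if det (f x) \<noteq> 0 then (\<chi> i j. det (C (f x) i j) / det (f x)) else J) \<in> borel_measurable M"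
  proof -
    note [measurable] = borel_measurable_det
    have [measurable]: "(\<lambda>x. C (f x) i j) \<in> borel_measurable M" for i j
      unfolding C_def by measurable
    show ?thesis by measurable
  qed
  ultimately show ?thesis by simp
qed

lemma continuous_on_spectral_norm: "continuous_on UNIV (spectral_norm :: real ^ 'n ^ 'm \<Rightarrow> real)"
proof -
  define f :: "real ^ 'n ^ 'm \<Rightarrow> (real ^ 'n) \<Rightarrow>\<^sub>L (real ^ 'm)" where "f A = Blinfun ((*v) A)" for A
  have f: "blinfun_apply (f A) = (*v) A" for A
    unfolding f_def by (rule bounded_linear_Blinfun_apply) simp
  have "linear f"
    by (intro linearI blinfun_eqI)
       (simp_all add: f blinfun.bilinear_simps matrix_vector_mult_add_rdistrib scaleR_matrix_vector_assoc)
  then have "continuous_on UNIV f" by (intro linear_continuous_on) (simp add: linear_conv_bounded_linear)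
  then have "continuous_on UNIV (\<lambda>A. norm (f A))" by (rule continuous_on_norm)
  also have "(\<lambda>A. norm (f A)) = spectral_norm"
    by (simp add: fun_eq_iff norm_blinfun.rep_eq f spectral_norm_def)
  finally show ?thesis .
qed

lemma borel_measurable_spectral_norm [measurable (raw)]:
  fixes f :: "'a \<Rightarrow> real ^ 'n ^ 'm"
  assumes "f \<in> borel_measurable M"
  shows "(\<lambda>x. spectral_norm (f x)) \<in> borel_measurable M"
  by (rule borel_measurable_continuous_on[OF continuous_on_spectral_norm assms])

lemma borel_measurable_mm [measurable (raw)]:
  fixes f :: "'a \<Rightarrow> real ^ 'n ^ 'm" and g :: "'a \<Rightarrow> real ^ 'k ^ 'n"
  assumes [measurable]: "f \<in> borel_measurable M" "g \<in> borel_measurable M"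
  shows "(\<lambda>x. f x ** g x) \<in> borel_measurable M"
  unfolding matrix_matrix_mult_def by measurable

context smooth_fun
begin

lemma borel_measurable_smooth [measurable (raw)]:
  assumes [measurable]: "W \<in> borel_measurable M" "f \<in> borel_measurable M"
  shows "(\<lambda>x. smooth (W x) (f x)) \<in> borel_measurable M"
  unfolding smooth_def by (rule borel_measurable_gaussian_integral) measurable

lemma borel_measurable_smooth_grad [measurable (raw)]:
  assumes [measurable]: "W \<in> borel_measurable M" "f \<in> borel_measurable M"
  shows "(\<lambda>x. smooth_grad (W x) (f x)) \<in> borel_measurable M"
  unfolding smooth_grad_def
  by (intro borel_measurable_vec_lambda borel_measurable_gaussian_integral) measurable

lemma borel_measurable_smooth_hess [measurable (raw)]:
  assumes [measurable]: "W \<in> borel_measurable M" "f \<in> borel_measurable M"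
  shows "(\<lambda>x. smooth_hess (W x) (f x)) \<in> borel_measurable M"
  unfolding smooth_hess_def
  by (intro borel_measurable_vec_lambda borel_measurable_gaussian_integral) measurable

end

section \<open>One step of the Lindeberg exchange\<close>

lemma integrable_bounded_mult:
  fixes f q :: "'a \<Rightarrow> real"
  assumes "integrable M f" "q \<in> borel_measurable M" "\<And>w. \<bar>q w\<bar> \<le> B"
  shows "integrable M (\<lambda>w. q w * f w)"
proof (rule Bochner_Integration.integrable_bound)
  show "integrable M (\<lambda>w. B * f w)" using assms(1) by simp
  show "(\<lambda>w. q w * f w) \<in> borel_measurable M" using assms by measurable
  have "\<bar>q w\<bar> \<le> \<bar>B\<bar>" for w using assms(3)[of w] by linarith
  then show "AE w in M. norm (q w * f w) \<le> norm (B * f w)"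
    by (auto simp: abs_mult mult_right_mono)
qed

lemma integrable_component_mult:
  fixes X :: "'a \<Rightarrow> real ^ 'd"
  assumes [measurable]: "X \<in> borel_measurable M" and sq: "integrable M (\<lambda>w. (norm (X w))\<^sup>2)"
  shows "integrable M (\<lambda>w. X w $ i * X w $ j)"
proof (rule Bochner_Integration.integrable_bound[OF sq])
  show "AE w in M. norm (X w $ i * X w $ j) \<le> norm ((norm (X w))\<^sup>2)"
    by (auto simp: abs_mult power2_eq_square intro!: mult_mono component_le_norm_cart)
qed measurable

lemma (in finite_measure) integrable_component:
  fixes X :: "'a \<Rightarrow> real ^ 'd"
  assumes [measurable]: "X \<in> borel_measurable M" and sq: "integrable M (\<lambda>w. (norm (X w))\<^sup>2)"
  shows "integrable M (\<lambda>w. X w $ i)"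
  by (rule square_integrable_imp_integrable)
     (use integrable_component_mult[OF assms, of i i] in \<open>auto simp: power2_eq_square\<close>)

text \<open>The conditional mean and covariance enter only through their integrals against bounded
  \<open>F\<close>-measurable weights; in this form they are preserved by linear maps.\<close>

locale cond_moments = prob_space M for M :: "'a measure" +
  fixes F :: "'a measure" and X :: "'a \<Rightarrow> real ^ 'd" and V :: "'a \<Rightarrow> real ^ 'd ^ 'd"
  assumes sub: "subalgebra M F"
    and X_meas [measurable]: "X \<in> borel_measurable M"
    and X_sq: "integrable M (\<lambda>w. (norm (X w))\<^sup>2)"
    and V_meas: "V \<in> borel_measurable F"
    and V_int: "\<And>i j. integrable M (\<lambda>w. V w $ i $ j)"
    and first: "\<And>q B i. q \<in> borel_measurable F \<Longrightarrow> (\<And>w. \<bar>q w\<bar> \<le> B) \<Longrightarrow>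
      (\<integral>w. q w * X w $ i \<partial>M) = 0"
    and second: "\<And>q B i j. q \<in> borel_measurable F \<Longrightarrow> (\<And>w. \<bar>q w\<bar> \<le> B) \<Longrightarrow>
      (\<integral>w. q w * (X w $ i * X w $ j) \<partial>M) = (\<integral>w. q w * V w $ i $ j \<partial>M)"
    and V_sym: "\<And>w. transpose (V w) = V w"
begin

lemma from_F: "f \<in> borel_measurable F \<Longrightarrow> f \<in> borel_measurable M"
  by (rule measurable_from_subalg[OF sub])

lemma V_meas_M [measurable]: "V \<in> borel_measurable M"
  by (rule from_F[OF V_meas])

lemma X_comp_int: "integrable M (\<lambda>w. X w $ i)"
  by (rule integrable_component[OF X_meas X_sq])

lemma XX_int: "integrable M (\<lambda>w. X w $ i * X w $ j)"
  by (rule integrable_component_mult[OF X_meas X_sq])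

text \<open>The gradient that plays \<open>G\<close> is unbounded, while \<open>first\<close> speaks
  of bounded weights only. Cutting off where the norm of \<open>G\<close> exceeds \<open>m\<close>
  keeps the weight bounded and measurable, and dominated convergence removes the cutoff.\<close>

lemma integral_inner_zero:
  assumes G: "G \<in> borel_measurable F" and int: "integrable M (\<lambda>w. G w \<bullet> X w)"
  shows "(\<integral>w. G w \<bullet> X w \<partial>M) = 0"
proof -
  note [measurable] = from_F[OF G] G
  define s where "s m w = (if norm (G w) \<le> real m then G w \<bullet> X w else 0)" for m w
  have "(\<lambda>m. \<integral>w. s m w \<partial>M) \<longlonglongrightarrow> (\<integral>w. G w \<bullet> X w \<partial>M)"
  proof (rule integral_dominated_convergence[OF _ _ integrable_norm[OF int]])
    show "AE w in M. (\<lambda>m. s m w) \<longlonglongrightarrow> G w \<bullet> X w"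
    proof (rule AE_I2, rule tendsto_eventually)
      fix w
      obtain m0 where "norm (G w) \<le> real m0" using real_arch_simple by blast
      then have "s m w = G w \<bullet> X w" if "m0 \<le> m" for m
        using that unfolding s_def by (auto dest: order_trans)
      then show "\<forall>\<^sub>F m in sequentially. s m w = G w \<bullet> X w" by (auto simp: eventually_sequentially)
    qed
  qed (auto simp: s_def)
  moreover have "(\<integral>w. s m w \<partial>M) = 0" for m
  proof -
    define q where "q i w = (if norm (G w) \<le> real m then G w $ i else 0)" for i w
    have q: "q i \<in> borel_measurable F" for i unfolding q_def[abs_def] by measurable
    have qb: "\<bar>q i w\<bar> \<le> real m" for i w
      using component_le_norm_cart[of "G w" i] unfolding q_def by auto
    have "s m w = (\<Sum>i\<in>UNIV. q i w * X w $ i)" for w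
      by (simp add: s_def q_def inner_vec_def)
    moreover have "integrable M (\<lambda>w. q i w * X w $ i)" for i
      by (rule integrable_bounded_mult[OF X_comp_int from_F[OF q] qb])
    ultimately show ?thesis using first[OF q qb] by simp
  qed
  ultimately show ?thesis by (simp add: LIMSEQ_const_iff)
qed

lemma
  assumes D: "D \<in> borel_measurable F" and B: "\<And>w i j. \<bar>D w $ i $ j\<bar> \<le> B"
  shows integral_quad: "(\<integral>w. X w \<bullet> (D w *v X w) \<partial>M) = (\<integral>w. V w \<bullet> D w \<partial>M)"
    and integrable_quad: "integrable M (\<lambda>w. X w \<bullet> (D w *v X w))"
    and integrable_V_inner: "integrable M (\<lambda>w. V w \<bullet> D w)"
proof -
  note [measurable] = from_F[OF D] D
  have Dm: "(\<lambda>w. D w $ i $ j) \<in> borel_measurable F" for i j by measurable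
  have i1: "integrable M (\<lambda>w. D w $ i $ j * (X w $ i * X w $ j))" for i j
    by (rule integrable_bounded_mult[OF XX_int from_F[OF Dm] B])
  have i2: "integrable M (\<lambda>w. D w $ i $ j * V w $ i $ j)" for i j
    by (rule integrable_bounded_mult[OF V_int from_F[OF Dm] B])
  have e1: "X w \<bullet> (D w *v X w) = (\<Sum>i\<in>UNIV. \<Sum>j\<in>UNIV. D w $ i $ j * (X w $ i * X w $ j))" for w
    by (rule quad_form_sum)
  have e2: "V w \<bullet> D w = (\<Sum>i\<in>UNIV. \<Sum>j\<in>UNIV. D w $ i $ j * V w $ i $ j)" for w
    by (simp add: inner_matrix mult.commute)
  show "(\<integral>w. X w \<bullet> (D w *v X w) \<partial>M) = (\<integral>w. V w \<bullet> D w \<partial>M)"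
    unfolding e1 e2 by (simp add: i1 i2 second[OF Dm B])
  show "integrable M (\<lambda>w. X w \<bullet> (D w *v X w))" "integrable M (\<lambda>w. V w \<bullet> D w)"
    unfolding e1 e2 by (intro Bochner_Integration.integrable_sum i1 i2)+
qed

text \<open>\<open>V\<close> is known only through integrals. For a fixed direction
  \<open>x\<close>, testing with the indicator of \<open>x \<bullet> (V w *v x) < 0\<close> gives
  the mean of a nonpositive function on one side and of a square on the other, so the event is
  null.\<close>

lemma V_psd: "AE w in M. psd_matrix (V w)"
proof -
  have fixed: "AE w in M. 0 \<le> x \<bullet> (V w *v x)" for x
  proof -
    define q where "q w = (if x \<bullet> (V w *v x) < 0 then 1 else 0 :: real)" for w
    note [measurable] = V_meas
    have qm [measurable]: "q \<in> borel_measurable F" unfolding q_def[abs_def] by measurable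
    define D where "D w = q w *\<^sub>R outer_prod x x" for w
    have Dm: "D \<in> borel_measurable F" unfolding D_def[abs_def] by measurable
    have Db: "\<bar>D w $ i $ j\<bar> \<le> norm x * norm x" for w i j
      unfolding D_def q_def
      by (auto simp: outer_prod_def abs_mult intro!: mult_mono component_le_norm_cart)
    have e1: "X w \<bullet> (D w *v X w) = q w * (x \<bullet> X w)\<^sup>2" for w
    proof -
      have "(x \<bullet> X w)\<^sup>2 = (\<Sum>i\<in>UNIV. \<Sum>j\<in>UNIV. x $ i * x $ j * (X w $ i * X w $ j))"
        unfolding power2_eq_square inner_vec_def sum_product by (simp add: mult_ac)
      then show ?thesis
        unfolding quad_form_sum by (simp add: D_def outer_prod_def sum_distrib_left mult_ac)
    qed
    have e2: "V w \<bullet> D w = q w * (x \<bullet> (V w *v x))" for w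
      unfolding quad_form_sum inner_matrix sum_distrib_left
      by (simp add: D_def outer_prod_def mult_ac)
    have "0 \<le> (\<integral>w. V w \<bullet> D w \<partial>M)"
      unfolding integral_quad[OF Dm Db, symmetric] e1
      by (intro Bochner_Integration.integral_nonneg) (simp add: q_def)
    moreover have np: "V w \<bullet> D w \<le> 0" for w unfolding e2 by (simp add: q_def)
    moreover have "(\<integral>w. - (V w \<bullet> D w) \<partial>M) \<ge> 0"
      using np by (intro Bochner_Integration.integral_nonneg) simp
    ultimately have "(\<integral>w. - (V w \<bullet> D w) \<partial>M) = 0" by simp
    then have "AE w in M. - (V w \<bullet> D w) = 0"
      using np integrable_V_inner[OF Dm Db]
      by (subst (asm) integral_nonneg_eq_0_iff_AE) auto
    then show ?thesis
      by eventually_elim (auto simp: e2 q_def split: if_splits)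
  qed
  \<comment> \<open>Countably many directions keep the exceptional set null. A negative value of the
    form at some \<open>x\<close> would persist on an open set by continuity, and that set meets
    \<open>E\<close>.\<close>
  obtain E :: "(real ^ 'd) set" where E: "countable E" "\<And>U. open U \<Longrightarrow> U \<noteq> {} \<Longrightarrow> \<exists>d\<in>E. d \<in> U"
    using countable_dense_exists by metis
  have "AE w in M. \<forall>x\<in>E. 0 \<le> x \<bullet> (V w *v x)"
    using fixed by (intro AE_ball_countable'[OF _ E(1)])
  then show ?thesis
  proof eventually_elim
    case (elim w)
    have "0 \<le> x \<bullet> (V w *v x)" for x
    proof (rule ccontr)
      assume neg: "\<not> 0 \<le> x \<bullet> (V w *v x)"
      have "open {x. x \<bullet> (V w *v x) < 0}" by (intro open_Collect_less continuous_intros)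
      moreover have "x \<in> {x. x \<bullet> (V w *v x) < 0}" using neg by simp
      ultimately obtain d where "d \<in> E" "d \<bullet> (V w *v d) < 0"
        using E(2)[of "{x. x \<bullet> (V w *v x) < 0}"] by blast
      then show False using elim by fastforce
    qed
    then show ?case using V_sym by (simp add: psd_matrix_def)
  qed
qed

lemma trace_int: "integrable M (\<lambda>w. trace (V w))"
  unfolding trace_def by (intro Bochner_Integration.integrable_sum V_int)

lemma measurable_trace_F: "(\<lambda>w. trace (V w)) \<in> borel_measurable F"
  using V_meas unfolding trace_def by measurable

lemma integral_trace:
  assumes q: "q \<in> borel_measurable F" "\<And>w. \<bar>q w\<bar> \<le> B"
  shows "(\<integral>w. q w * (norm (X w))\<^sup>2 \<partial>M) = (\<integral>w. q w * trace (V w) \<partial>M)"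
proof -
  have "q w * (norm (X w))\<^sup>2 = (\<Sum>i\<in>UNIV. q w * (X w $ i * X w $ i))" for w
    by (simp add: power2_norm_eq_inner inner_vec_def sum_distrib_left)
  moreover have "q w * trace (V w) = (\<Sum>i\<in>UNIV. q w * V w $ i $ i)" for w
    by (simp add: trace_def sum_distrib_left)
  ultimately show ?thesis
    by (simp add: second[OF q] integrable_bounded_mult[OF XX_int from_F[OF q(1)] q(2)]
        integrable_bounded_mult[OF V_int from_F[OF q(1)] q(2)])
qed

lemma nn_integral_trace:
  assumes q: "q \<in> borel_measurable F" "\<And>w. 0 \<le> q w" "\<And>w. q w \<le> B"
  shows "(\<integral>\<^sup>+w. ennreal (q w * (norm (X w))\<^sup>2) \<partial>M) = ennreal (\<integral>w. q w * trace (V w) \<partial>M)"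
    and "(\<integral>\<^sup>+w. ennreal (q w * trace (V w)) \<partial>M) = ennreal (\<integral>w. q w * trace (V w) \<partial>M)"
proof -
  have qb: "\<bar>q w\<bar> \<le> B" for w using q(2,3)[of w] by simp
  show "(\<integral>\<^sup>+w. ennreal (q w * (norm (X w))\<^sup>2) \<partial>M) = ennreal (\<integral>w. q w * trace (V w) \<partial>M)"
    unfolding integral_trace[OF q(1) qb, symmetric]
    by (intro nn_integral_eq_integral integrable_bounded_mult[OF X_sq from_F[OF q(1)] qb]) (simp add: q(2))
  show "(\<integral>\<^sup>+w. ennreal (q w * trace (V w)) \<partial>M) = ennreal (\<integral>w. q w * trace (V w) \<partial>M)"
  proof (intro nn_integral_eq_integral integrable_bounded_mult[OF trace_int from_F[OF q(1)] qb])
    show "AE w in M. 0 \<le> q w * trace (V w)"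
      using V_psd by eventually_elim (simp add: q(2) psd_trace_nonneg)
  qed
qed

text \<open>A conditional Jensen inequality, obtained by integrating the tangent line inequality
  for \<open>y\<^sup>3\<close> as a function of \<open>y\<^sup>2\<close>.\<close>

lemma third_moment_ge:
  assumes q: "q \<in> borel_measurable F" "\<And>w. 0 \<le> q w"
  shows "(\<integral>\<^sup>+w. ennreal (q w * sqrt (trace (V w)) ^ 3) \<partial>M) \<le>
    (\<integral>\<^sup>+w. ennreal (q w * norm (X w) ^ 3) \<partial>M)"
proof -
  note [measurable] = from_F[OF q(1)] q(1) measurable_trace_F from_F[OF measurable_trace_F]
  define r where "r w = sqrt (max 0 (trace (V w)))" for w
  have r0: "r w \<ge> 0" for w by (simp add: r_def)
  have [measurable]: "r \<in> borel_measurable F" "r \<in> borel_measurable M" unfolding r_def[abs_def] by measurable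
  have rAE: "AE w in M. trace (V w) = (r w)\<^sup>2 \<and> sqrt (trace (V w)) = r w"
    using V_psd by eventually_elim (simp add: r_def psd_trace_nonneg)
  \<comment> \<open>Truncation makes \<open>c m w * r w\<close> a bounded weight, so that the mean
    of \<open>c m w * r w ^ 3\<close> is finite and can later be subtracted from both sides.\<close>
  define c where "c m w = (if q w * r w \<le> real m then q w else 0)" for m w
  have c0: "0 \<le> c m w" for m w by (simp add: c_def q)
  have cq: "c m w \<le> q w" for m w by (simp add: c_def q)
  have cm [measurable]: "c m \<in> borel_measurable F" "c m \<in> borel_measurable M" for m
    unfolding c_def[abs_def] by measurable
  let ?R = "\<integral>\<^sup>+w. ennreal (q w * norm (X w) ^ 3) \<partial>M"
  have bound: "(\<integral>\<^sup>+w. ennreal (c m w * r w ^ 3) \<partial>M) \<le> ?R" for m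
  proof -
    define t where "t = (\<integral>w. (c m w * r w) * trace (V w) \<partial>M)"
    have p: "(\<lambda>w. c m w * r w) \<in> borel_measurable F" "\<And>w. 0 \<le> c m w * r w" "\<And>w. c m w * r w \<le> real m"
      using c0 r0 by (auto simp: c_def)
    have T: "(\<integral>\<^sup>+w. ennreal (c m w * r w ^ 3) \<partial>M) = ennreal t"
    proof -
      have "(\<integral>\<^sup>+w. ennreal (c m w * r w ^ 3) \<partial>M) = (\<integral>\<^sup>+w. ennreal ((c m w * r w) * trace (V w)) \<partial>M)"
        by (rule nn_integral_cong_AE, use rAE in eventually_elim)
           (simp add: power2_eq_square power3_eq_cube mult_ac)
      then show ?thesis unfolding t_def using nn_integral_trace(2)[OF p] by simp
    qed
    have t0: "t \<ge> 0" unfolding t_def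
      by (rule Bochner_Integration.integral_nonneg_AE, use V_psd in eventually_elim)
         (simp add: p psd_trace_nonneg)
    have "ennreal (3 * t) = (\<integral>\<^sup>+w. ennreal (3 * ((c m w * r w) * (norm (X w))\<^sup>2)) \<partial>M)"
      using nn_integral_trace(1)[OF p] t0
      by (simp add: ennreal_mult p nn_integral_cmult t_def[symmetric])
    also have "\<dots> \<le> (\<integral>\<^sup>+w. ennreal (2 * (q w * norm (X w) ^ 3)) + ennreal (c m w * r w ^ 3) \<partial>M)"
    proof (rule nn_integral_mono)
      fix w
      \<comment> \<open>This product equals \<open>2 * x ^ 3 - 3 * r * x\<^sup>2 + r ^ 3\<close>
        with \<open>x = norm (X w)\<close>, the tangent line inequality at \<open>r\<close>.\<close>
      have "0 \<le> (norm (X w) - r w)\<^sup>2 * (2 * norm (X w) + r w)" using r0 by simp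
      then have "3 * (r w * (norm (X w))\<^sup>2) \<le> 2 * norm (X w) ^ 3 + r w ^ 3"
        by (simp add: power2_eq_square power3_eq_cube algebra_simps)
      then have "c m w * (3 * (r w * (norm (X w))\<^sup>2)) \<le> c m w * (2 * norm (X w) ^ 3 + r w ^ 3)"
        by (rule mult_left_mono[OF _ c0])
      also have "\<dots> \<le> 2 * (q w * norm (X w) ^ 3) + c m w * r w ^ 3"
        using mult_right_mono[OF cq, of "norm (X w) ^ 3"] by (simp add: distrib_left mult_ac)
      finally have "3 * ((c m w * r w) * (norm (X w))\<^sup>2) \<le> 2 * (q w * norm (X w) ^ 3) + c m w * r w ^ 3"
        by (simp add: mult_ac)
      then show "ennreal (3 * ((c m w * r w) * (norm (X w))\<^sup>2)) \<le>
          ennreal (2 * (q w * norm (X w) ^ 3)) + ennreal (c m w * r w ^ 3)"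
        using c0 r0 q(2) by (simp add: ennreal_leI flip: ennreal_plus)
    qed
    also have "\<dots> = 2 * ?R + ennreal t"
      by (subst nn_integral_add) (auto simp: T ennreal_mult q nn_integral_cmult)
    finally have le: "ennreal (3 * t) \<le> 2 * ?R + ennreal t" .
    \<comment> \<open>As \<open>t\<close> is a real number it cancels, leaving
      \<open>2 * t \<le> 2 * R\<close>; for an infinite right-hand side nothing is to be
      shown.\<close>
    show ?thesis
    proof (cases "?R = \<infinity>")
      case False
      then obtain R where R: "?R = ennreal R" "R \<ge> 0" by (cases ?R) auto
      have "ennreal (2 * R + t) = 2 * ?R + ennreal t"
        using R t0 by (simp add: ennreal_mult)
      then have "ennreal (3 * t) \<le> ennreal (2 * R + t)" using le by (simp only:)
      moreover have "0 \<le> 2 * R + t" using R t0 by simp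
      ultimately have "3 * t \<le> 2 * R + t" using ennreal_le_iff by blast
      then show ?thesis unfolding T R by (intro ennreal_leI) simp
    qed simp
  qed
  have "(\<integral>\<^sup>+w. ennreal (q w * sqrt (trace (V w)) ^ 3) \<partial>M) = (\<integral>\<^sup>+w. ennreal (q w * r w ^ 3) \<partial>M)"
    by (rule nn_integral_cong_AE, use rAE in eventually_elim) (simp add: r0)
  also have "\<dots> = (\<integral>\<^sup>+w. liminf (\<lambda>m. ennreal (c m w * r w ^ 3)) \<partial>M)"
  proof (rule nn_integral_cong)
    fix w
    obtain m0 where "q w * r w \<le> real m0" using real_arch_simple by blast
    then have "c m w = q w" if "m0 \<le> m" for m
      using that unfolding c_def by (auto dest: order_trans)
    then have "\<forall>\<^sub>F m in sequentially. ennreal (c m w * r w ^ 3) = ennreal (q w * r w ^ 3)"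
      by (auto simp: eventually_sequentially intro!: exI[of _ m0])
    then have "(\<lambda>m. ennreal (c m w * r w ^ 3)) \<longlonglongrightarrow> ennreal (q w * r w ^ 3)" by (rule tendsto_eventually)
    then show "ennreal (q w * r w ^ 3) = liminf (\<lambda>m. ennreal (c m w * r w ^ 3))"
      by (simp add: lim_imp_Liminf)
  qed
  \<comment> \<open>Fatou's lemma lifts the truncation.\<close>
  also have "\<dots> \<le> liminf (\<lambda>m. \<integral>\<^sup>+w. ennreal (c m w * r w ^ 3) \<partial>M)"
    by (rule nn_integral_liminf) measurable
  also have "\<dots> \<le> liminf (\<lambda>m::nat. ?R)" by (intro Liminf_mono always_eventually allI bound)
  also have "\<dots> = ?R" by (simp add: Liminf_const)
  finally show ?thesis .
qed

text \<open>On \<open>A\<close> the third order expansions are used; off \<open>A\<close> the conditional variance is so large,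
  relative to \<open>1 / p\<^sup>2\<close>, that the second order ones suffice. The threshold \<open>\<theta> = 4/5\<close> equates the
  constants \<open>(1 - \<theta>)\<^bsup>-1/2\<^esup>/2\<close> and \<open>\<theta>\<^bsup>-1/2\<^esup>\<close> of the two cases.\<close>

lemma lindeberg_step:
  fixes L :: real and p a b c :: "'a \<Rightarrow> real"
  assumes L: "0 \<le> L"
    and A: "A \<in> sets F"
    and p: "p \<in> borel_measurable F" "\<And>w. 0 \<le> p w"
    and G: "G \<in> borel_measurable F"
    and D: "D \<in> borel_measurable F" "\<And>w i j. \<bar>D w $ i $ j\<bar> \<le> L"
    and int: "integrable M a" "integrable M b" "integrable M c"
    and b1: "AE w in M. \<bar>b w - a w - G w \<bullet> X w\<bar> \<le> L / 2 * (norm (X w))\<^sup>2"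
    and c1: "AE w in M. \<bar>c w - a w\<bar> \<le> L / 2 * trace (V w)"
    and b2: "AE w in M. w \<in> A \<longrightarrow> \<bar>b w - a w - G w \<bullet> X w - (X w \<bullet> (D w *v X w)) / 2\<bar>
      \<le> L * (sqrt 5 * p w) / 6 * norm (X w) ^ 3"
    and c2: "AE w in M. w \<in> A \<longrightarrow> \<bar>c w - a w - (V w \<bullet> D w) / 2\<bar>
      \<le> L * (sqrt 5 * p w) / 3 * sqrt (trace (V w)) ^ 3"
    and bad: "AE w in M. w \<notin> A \<longrightarrow> 4 / 5 \<le> (p w)\<^sup>2 * trace (V w)"
  shows "ennreal \<bar>(\<integral>w. b w \<partial>M) - (\<integral>w. c w \<partial>M)\<bar> \<le>
    ennreal (L * (sqrt 5 / 2)) * (\<integral>\<^sup>+w. ennreal (p w * norm (X w) ^ 3) \<partial>M)"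
proof -
  have [measurable]: "A \<in> sets M" using A sub unfolding subalgebra_def by auto
  note [measurable] = A p(1) from_F[OF p(1)] G from_F[OF G] D(1) from_F[OF D(1)]
    measurable_trace_F from_F[OF measurable_trace_F]
  have [measurable]: "a \<in> borel_measurable M" "b \<in> borel_measurable M" "c \<in> borel_measurable M"
    using int by auto
  \<comment> \<open>Here \<open>a\<close> is the smoothed function at the old partial sum,
    \<open>b\<close> the same function after adding \<open>X\<close>, and \<open>c\<close> the
    function smoothed also with \<open>V\<close>. Restricting the Hessian to \<open>A\<close> keeps
    it \<open>F\<close>-measurable, so the quadratic terms of \<open>b\<close> and \<open>c\<close>
    still have equal means, while off \<open>A\<close> they are absent and the second order bounds
    apply.\<close>
  define D' where "D' w = indicator A w *\<^sub>R D w" for w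
  have D'm [measurable]: "D' \<in> borel_measurable F" unfolding D'_def[abs_def] by measurable
  have D'b: "\<bar>D' w $ i $ j\<bar> \<le> L" for w i j
    using D(2)[of w i j] L by (auto simp: D'_def indicator_def)
  define XD where "XD w = X w \<bullet> (D' w *v X w)" for w
  define VD where "VD w = V w \<bullet> D' w" for w
  have XDint: "integrable M XD" and VDint: "integrable M VD" and XV: "(\<integral>w. XD w \<partial>M) = (\<integral>w. VD w \<partial>M)"
    unfolding XD_def[abs_def] VD_def[abs_def]
    by (rule integrable_quad[OF D'm D'b] integrable_V_inner[OF D'm D'b] integral_quad[OF D'm D'b])+
  \<comment> \<open>Integrability of the linear term is extracted from the expansion itself, since
    all other terms in it are integrable.\<close>
  have Gint: "integrable M (\<lambda>w. G w \<bullet> X w)"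
  proof (rule Bochner_Integration.integrable_bound)
    show "integrable M (\<lambda>w. L / 2 * (norm (X w))\<^sup>2 + (\<bar>b w\<bar> + \<bar>a w\<bar>))"
      using X_sq int by (intro Bochner_Integration.integrable_add integrable_mult_right integrable_abs)
    show "AE w in M. norm (G w \<bullet> X w) \<le> norm (L / 2 * (norm (X w))\<^sup>2 + (\<bar>b w\<bar> + \<bar>a w\<bar>))"
      using b1 by eventually_elim (unfold real_norm_def, linarith)
  qed measurable
  have G0: "(\<integral>w. G w \<bullet> X w \<partial>M) = 0" by (rule integral_inner_zero[OF G Gint])
  \<comment> \<open>The subtracted terms have mean zero or equal means, so the difference of the two
    remainders has the mean of \<open>b\<close> minus \<open>c\<close>.\<close>
  define R1 where "R1 w = b w - a w - G w \<bullet> X w - XD w / 2" for w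
  define R2 where "R2 w = c w - a w - VD w / 2" for w
  have R: "integrable M R1" "integrable M R2"
    unfolding R1_def[abs_def] R2_def[abs_def]
    by (intro Bochner_Integration.integrable_diff integrable_divide_zero int Gint XDint VDint)+
  have eq: "(\<integral>w. R1 w - R2 w \<partial>M) = (\<integral>w. b w \<partial>M) - (\<integral>w. c w \<partial>M)"
    unfolding R1_def R2_def using int Gint XDint VDint G0 XV by simp
  define r where "r w = sqrt (trace (V w))" for w
  have [measurable]: "r \<in> borel_measurable M" unfolding r_def[abs_def] by measurable
  let ?g = "\<lambda>w. indicator A w :: real" and ?b = "\<lambda>w. indicator (space M - A) w :: real"
  have spF: "space F = space M" using sub unfolding subalgebra_def by simp
  have bm [measurable]: "?b \<in> borel_measurable F" unfolding spF[symmetric] by measurable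
  let ?n = "\<lambda>w. norm (X w)" and ?T = "\<integral>\<^sup>+w. ennreal (?b w * trace (V w)) \<partial>M"
  let ?I = "\<lambda>q f. \<integral>\<^sup>+w. ennreal (q w * p w * f w ^ 3) \<partial>M"
  have pw: "AE w in M. ennreal \<bar>R1 w - R2 w\<bar> \<le> ennreal L *
      (ennreal (sqrt 5 / 6) * ennreal (?g w * p w * norm (X w) ^ 3) +
       ennreal (sqrt 5 / 3) * ennreal (?g w * p w * r w ^ 3) +
       (ennreal (1 / 2) * ennreal (?b w * (norm (X w))\<^sup>2) + ennreal (1 / 2) * ennreal (?b w * trace (V w))))"
    using b1 c1 b2 c2 V_psd AE_space
  proof eventually_elim
    case (elim w)
    have r0: "0 \<le> r w" "0 \<le> trace (V w)" using elim(5) by (auto simp: r_def psd_trace_nonneg)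
    have "\<bar>R1 w - R2 w\<bar> \<le> L * (sqrt 5 / 6 * (?g w * p w * norm (X w) ^ 3) +
       sqrt 5 / 3 * (?g w * p w * r w ^ 3) +
       (1 / 2 * (?b w * (norm (X w))\<^sup>2) + 1 / 2 * (?b w * trace (V w))))"
    proof (cases "w \<in> A")
      case True
      then have "XD w = X w \<bullet> (D w *v X w)" "VD w = V w \<bullet> D w" by (simp_all add: XD_def VD_def D'_def)
      then have "\<bar>R1 w\<bar> \<le> L * (sqrt 5 * p w) / 6 * norm (X w) ^ 3"
        "\<bar>R2 w\<bar> \<le> L * (sqrt 5 * p w) / 3 * r w ^ 3"
        using elim(3,4) True by (auto simp: R1_def R2_def r_def)
      then have "\<bar>R1 w - R2 w\<bar> \<le> L * (sqrt 5 * p w) / 6 * norm (X w) ^ 3 + L * (sqrt 5 * p w) / 3 * r w ^ 3"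
        by linarith
      then show ?thesis using True by (simp add: distrib_left mult_ac)
    next
      case False
      then have "XD w = 0" "VD w = 0" by (simp_all add: XD_def VD_def D'_def)
      then have "\<bar>R1 w\<bar> \<le> L / 2 * (norm (X w))\<^sup>2" "\<bar>R2 w\<bar> \<le> L / 2 * trace (V w)"
        using elim(1,2) by (auto simp: R1_def R2_def)
      then have "\<bar>R1 w - R2 w\<bar> \<le> L / 2 * (norm (X w))\<^sup>2 + L / 2 * trace (V w)"
        by linarith
      then show ?thesis using False elim(6) by (simp add: distrib_left mult_ac)
    qed
    then have "ennreal \<bar>R1 w - R2 w\<bar> \<le> ennreal (L * (sqrt 5 / 6 * (?g w * p w * norm (X w) ^ 3) +
       sqrt 5 / 3 * (?g w * p w * r w ^ 3) +
       (1 / 2 * (?b w * (norm (X w))\<^sup>2) + 1 / 2 * (?b w * trace (V w)))))"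
      by (rule ennreal_leI)
    then show ?case using L p(2)[of w] r0
      by (simp only: ennreal_mult ennreal_plus mult_nonneg_nonneg add_nonneg_nonneg zero_le_power
          indicator_pos_le norm_ge_zero divide_nonneg_pos real_sqrt_ge_zero zero_le_numeral zero_less_numeral zero_le_one)
  qed
  have "ennreal \<bar>(\<integral>w. b w \<partial>M) - (\<integral>w. c w \<partial>M)\<bar> \<le> (\<integral>\<^sup>+w. ennreal \<bar>R1 w - R2 w\<bar> \<partial>M)"
    unfolding eq[symmetric]
    using integral_norm_bound_ennreal[OF Bochner_Integration.integrable_diff[OF R]] by simp
  also have "\<dots> \<le> (\<integral>\<^sup>+w. ennreal L *
      (ennreal (sqrt 5 / 6) * ennreal (?g w * p w * norm (X w) ^ 3) +
       ennreal (sqrt 5 / 3) * ennreal (?g w * p w * r w ^ 3) +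
       (ennreal (1 / 2) * ennreal (?b w * (norm (X w))\<^sup>2) + ennreal (1 / 2) * ennreal (?b w * trace (V w)))) \<partial>M)"
    by (rule nn_integral_mono_AE[OF pw])
  also have "\<dots> = ennreal L * (ennreal (sqrt 5 / 6) * ?I ?g (\<lambda>w. norm (X w)) + ennreal (sqrt 5 / 3) * ?I ?g r +
      (ennreal (1 / 2) * (\<integral>\<^sup>+w. ennreal (?b w * (norm (X w))\<^sup>2) \<partial>M) +
       ennreal (1 / 2) * (\<integral>\<^sup>+w. ennreal (?b w * trace (V w)) \<partial>M)))"
    by (simp add: nn_integral_cmult nn_integral_add)
  also have "(\<integral>\<^sup>+w. ennreal (?b w * (norm (X w))\<^sup>2) \<partial>M) = ?T"
    using nn_integral_trace[OF bm, of 1] by (simp add: indicator_def)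
  also have "ennreal (1 / 2) * ?T + ennreal (1 / 2) * ?T = ?T"
  proof -
    have "ennreal (1 / 2) + ennreal (1 / 2) = 1" by (subst ennreal_plus[symmetric]) auto
    then show ?thesis by (simp only: distrib_right[symmetric] mult_1)
  qed
  finally have total: "ennreal \<bar>(\<integral>w. b w \<partial>M) - (\<integral>w. c w \<partial>M)\<bar> \<le>
    ennreal L * (ennreal (sqrt 5 / 6) * ?I ?g ?n + ennreal (sqrt 5 / 3) * ?I ?g r + ?T)" .
  \<comment> \<open>Off \<open>A\<close> the hypothesis \<open>bad\<close> says that
    \<open>sqrt 5 / 2 * (p w * r w)\<close> is at least 1, so one more factor of it may be inserted.
    This turns the second moment into a third one with weight \<open>p\<close>.\<close>
  have "?T \<le> (\<integral>\<^sup>+w. ennreal (sqrt 5 / 2) * ennreal (?b w * p w * r w ^ 3) \<partial>M)"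
  proof (rule nn_integral_mono_AE, use bad V_psd in eventually_elim)
    case (elim w)
    have r0: "0 \<le> r w" "trace (V w) = (r w)\<^sup>2" using elim(2) by (auto simp: r_def psd_trace_nonneg)
    have "?b w * trace (V w) \<le> sqrt 5 / 2 * (?b w * p w * r w ^ 3)"
    proof (cases "w \<in> A")
      case False
      then have "1\<^sup>2 \<le> (sqrt 5 / 2 * (p w * r w))\<^sup>2"
        using elim(1) r0 by (simp add: power_mult_distrib power_divide)
      then have "1 \<le> sqrt 5 / 2 * (p w * r w)"
        by (rule power2_le_imp_le) (use p(2) r0 in auto)
      then have "(r w)\<^sup>2 * 1 \<le> (r w)\<^sup>2 * (sqrt 5 / 2 * (p w * r w))"
        by (intro mult_left_mono) auto
      also have "\<dots> = sqrt 5 / 2 * (p w * r w ^ 3)" by (simp add: power2_eq_square power3_eq_cube)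
      finally show ?thesis using r0 by (auto simp: indicator_def)
    qed (simp add: indicator_def)
    then show ?case using p(2)[of w] r0
      by (subst ennreal_mult[symmetric]) (auto intro!: ennreal_leI mult_nonneg_nonneg)
  qed
  also have "\<dots> = ennreal (sqrt 5 / 2) * ?I ?b r" by (simp add: nn_integral_cmult)
  finally have T: "?T \<le> ennreal (sqrt 5 / 2) * ?I ?b r" .
  have third: "?I ?g r \<le> ?I ?g ?n" "?I ?b r \<le> ?I ?b ?n"
    unfolding r_def by (rule third_moment_ge; use p(2) in \<open>simp add: bm\<close>)+
  have "ennreal (sqrt 5 / 6) * ?I ?g ?n + ennreal (sqrt 5 / 3) * ?I ?g r + ?T \<le>
      ennreal (sqrt 5 / 6) * ?I ?g ?n + ennreal (sqrt 5 / 3) * ?I ?g ?n + ennreal (sqrt 5 / 2) * ?I ?b ?n"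
    by (intro add_mono mult_left_mono order_trans[OF T] third order_refl) auto
  also have "\<dots> = ennreal (sqrt 5 / 2) * (?I ?g ?n + ?I ?b ?n)"
  proof -
    have "ennreal (sqrt 5 / 6) + ennreal (sqrt 5 / 3) = ennreal (sqrt 5 / 2)"
      by (subst ennreal_plus[symmetric]) auto
    then show ?thesis by (simp only: distrib_right[symmetric] distrib_left)
  qed
  also have "?I ?g ?n + ?I ?b ?n = (\<integral>\<^sup>+w. ennreal (p w * norm (X w) ^ 3) \<partial>M)"
  proof -
    have "?I ?g ?n + ?I ?b ?n =
        (\<integral>\<^sup>+w. ennreal (?g w * p w * norm (X w) ^ 3) + ennreal (?b w * p w * norm (X w) ^ 3) \<partial>M)"
      by (rule nn_integral_add[symmetric]) auto
    also have "\<dots> = (\<integral>\<^sup>+w. ennreal (p w * norm (X w) ^ 3) \<partial>M)"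
      by (rule nn_integral_cong) (auto simp: indicator_def)
    finally show ?thesis .
  qed
  finally have "ennreal \<bar>(\<integral>w. b w \<partial>M) - (\<integral>w. c w \<partial>M)\<bar> \<le>
      ennreal L * (ennreal (sqrt 5 / 2) * (\<integral>\<^sup>+w. ennreal (p w * norm (X w) ^ 3) \<partial>M))"
    by (intro order_trans[OF total] mult_left_mono) auto
  then show ?thesis using L by (simp only: ennreal_mult mult.assoc real_sqrt_ge_zero zero_le_numeral divide_nonneg_nonneg)
qed

end

section \<open>From the notions of the statement to the smoothing and moment locales\<close>

lemma gderiv_unique:
  fixes f :: "'a :: real_inner \<Rightarrow> real"
  assumes "GDERIV f x :> a" "GDERIV f x :> b"
  shows "a = b"
proof -
  have "(\<lambda>h. h \<bullet> a) = (\<lambda>h. h \<bullet> b)"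
    using assms unfolding gderiv_def by (rule has_derivative_unique)
  then show ?thesis by (metis vector_eq_ldot)
qed

text \<open>Riesz representation of the derivative in the standard basis gives existence; together
  with uniqueness this makes the description in \<open>grad\<close> denote.\<close>

lemma gderiv_grad:
  fixes f :: "'a :: euclidean_space \<Rightarrow> real"
  assumes "f differentiable (at x)"
  shows "GDERIV f x :> grad f x"
proof -
  obtain f' where f': "(f has_derivative f') (at x)" using assms unfolding differentiable_def by blast
  have lin: "linear f'" using f' by (rule has_derivative_linear)
  have "f' y = y \<bullet> (\<Sum>b\<in>Basis. f' b *\<^sub>R b)" for y
  proof -
    have "f' y = f' (\<Sum>b\<in>Basis. (y \<bullet> b) *\<^sub>R b)" by (simp add: euclidean_representation)
    also have "\<dots> = (\<Sum>b\<in>Basis. (y \<bullet> b) *\<^sub>R f' b)"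
      using lin by (simp add: linear_sum linear_cmul)
    finally show ?thesis by (simp add: inner_sum_right mult.commute)
  qed
  then have "f' = (\<lambda>y. y \<bullet> (\<Sum>b\<in>Basis. f' b *\<^sub>R b))" by (rule ext)
  then have "GDERIV f x :> (\<Sum>b\<in>Basis. f' b *\<^sub>R b)" using f' unfolding gderiv_def by simp
  then have "\<exists>!v. GDERIV f x :> v" using gderiv_unique by blast
  then show ?thesis unfolding grad_def by (rule theI')
qed

lemma grad_Lipschitz:
  assumes "M2 h < \<infinity>"
  shows "norm (grad h x - grad h y) \<le> enn2real (M2 h) * norm (x - y)"
proof (cases "x = y")
  case False
  have "ennreal (norm (grad h x - grad h y) / norm (x - y)) \<le> M2 h"
    unfolding M2_def using False by (intro SUP_upper2[of "(x, y)"]) auto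
  then have "norm (grad h x - grad h y) / norm (x - y) \<le> enn2real (M2 h)"
    using assms by (metis enn2real_ennreal enn2real_mono divide_nonneg_nonneg norm_ge_zero infinity_ennreal_def)
  then show ?thesis using False by (simp add: divide_le_eq)
qed simp

text \<open>Both densities are multiples of the same kernel. Total mass 1 on both sides forces the
  factors to agree, so the Gaussian integral is not computed; the premise is supplied by the law of
  \<open>Z\<close>.\<close>

lemma gaussian_mat_1: "gaussian (mat 1) = density lborel (\<lambda>x :: real ^ 'd. ennreal (std_gaussian_density x))"
  if "prob_space (density lborel (\<lambda>x :: real ^ 'd. ennreal (std_gaussian_density x)))"
proof -
  interpret gauss "mat 1 :: real ^ 'd ^ 'd" by standard (rule pos_def_mat1)
  define k where "k = (1 / sqrt (2 * pi)) ^ CARD('d)"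
  define c where "c = (\<integral>y. gauss_kernel (mat 1) (y :: real ^ 'd) \<partial>lborel)"
  have c: "c > 0" unfolding c_def by (rule kernel_integral_pos)
  have k: "k > 0" unfolding k_def by simp
  have dens: "std_gaussian_density x = k * gauss_kernel (mat 1) x" for x :: "real ^ 'd"
  proof -
    have "std_gaussian_density x = (\<Prod>i\<in>UNIV. 1 / sqrt (2 * pi) * exp (- (x $ i)\<^sup>2 / 2))"
      unfolding std_gaussian_density_def std_normal_density_def ..
    also have "\<dots> = k * exp (\<Sum>i\<in>UNIV. - (x $ i)\<^sup>2 / 2)"
      by (simp only: prod.distrib prod_constant k_def exp_sum finite)
    also have "(\<Sum>i\<in>UNIV. - (x $ i)\<^sup>2 / 2) = - (x \<bullet> x) / 2"
      by (simp add: inner_vec_def power2_eq_square sum_negf flip: sum_divide_distrib)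
    finally show ?thesis by (simp add: gauss_kernel_def)
  qed
  have "1 = emeasure (density lborel (\<lambda>x :: real ^ 'd. ennreal (std_gaussian_density x))) UNIV"
    using prob_space.emeasure_space_1[OF that] by simp
  also have "\<dots> = (\<integral>\<^sup>+x. ennreal (k * gauss_kernel (mat 1) (x :: real ^ 'd)) \<partial>lborel)"
    unfolding dens by (simp add: emeasure_density)
  also have "\<dots> = ennreal (\<integral>x. k * gauss_kernel (mat 1) (x :: real ^ 'd) \<partial>lborel)"
    using integrable_kernel k by (intro nn_integral_eq_integral) (auto simp: less_imp_le)
  also have "\<dots> = ennreal (k * c)" by (simp add: c_def)
  finally have "k * c = 1" using k c by (metis ennreal_eq_1)
  then have "k = 1 / c" using c by (simp add: field_simps)
  then show ?thesis unfolding gaussian_def dens c_def[symmetric] by simp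
qed

text \<open>Applied with the inverse square root of the covariance of the sum, this normalises the
  increments. Entries of the new vector and matrix are finite combinations of the old ones, against
  the same weight \<open>q\<close>.\<close>

lemma (in cond_moments) cond_moments_linear:
  assumes T: "transpose T = T"
  shows "cond_moments M F (\<lambda>w. T *v X w) (\<lambda>w. T ** V w ** T)"
proof -
  have TX: "(T *v X w) $ i = (\<Sum>k\<in>UNIV. T $ i $ k * X w $ k)" for w i
    by (simp add: matrix_vector_mult_def)
  have Tsym: "T $ i $ j = T $ j $ i" for i j
  proof -
    have "transpose T $ i $ j = T $ i $ j" using T by simp
    then show ?thesis by (simp add: transpose_def)
  qed
  have TV: "(T ** V w ** T) $ i $ j = (\<Sum>l\<in>UNIV. \<Sum>k\<in>UNIV. T $ i $ k * T $ j $ l * V w $ k $ l)" for w i j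
    by (simp add: matrix_matrix_mult_def sum_distrib_right sum_distrib_left Tsym[of _ j] mult_ac)
  note [measurable] = V_meas
  show ?thesis
  proof (unfold_locales)
    show "subalgebra M F" by (rule sub)
    show "(\<lambda>w. T *v X w) \<in> borel_measurable M" by measurable
    show "(\<lambda>w. T ** V w ** T) \<in> borel_measurable F" by measurable
    show "integrable M (\<lambda>w. (norm (T *v X w))\<^sup>2)"
    proof (rule Bochner_Integration.integrable_bound)
      show "integrable M (\<lambda>w. (onorm ((*v) T))\<^sup>2 * (norm (X w))\<^sup>2)" using X_sq by simp
      show "AE w in M. norm ((norm (T *v X w))\<^sup>2) \<le> norm ((onorm ((*v) T))\<^sup>2 * (norm (X w))\<^sup>2)"
      proof (rule AE_I2)
        fix w
        have "norm (T *v X w) \<le> onorm ((*v) T) * norm (X w)" by (rule onorm) simp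
        then have "(norm (T *v X w))\<^sup>2 \<le> (onorm ((*v) T) * norm (X w))\<^sup>2" by (rule power_mono) simp
        then show "norm ((norm (T *v X w))\<^sup>2) \<le> norm ((onorm ((*v) T))\<^sup>2 * (norm (X w))\<^sup>2)"
          by (simp add: power_mult_distrib)
      qed
    qed measurable
    show "integrable M (\<lambda>w. (T ** V w ** T) $ i $ j)" for i j
      unfolding TV by (intro Bochner_Integration.integrable_sum integrable_mult_right V_int)
    show "transpose (T ** V w ** T) = T ** V w ** T" for w
      by (simp add: matrix_transpose_mul T V_sym matrix_mul_assoc)
    fix q :: "'a \<Rightarrow> real" and B assume q: "q \<in> borel_measurable F" "\<And>w. \<bar>q w\<bar> \<le> B"
    have i: "integrable M (\<lambda>w. q w * X w $ k)" "integrable M (\<lambda>w. q w * (X w $ k * X w $ l))"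
        "integrable M (\<lambda>w. q w * V w $ k $ l)" for k l
      by (rule integrable_bounded_mult[OF X_comp_int from_F[OF q(1)] q(2)]
          integrable_bounded_mult[OF XX_int from_F[OF q(1)] q(2)]
          integrable_bounded_mult[OF V_int from_F[OF q(1)] q(2)])+
    show "(\<integral>w. q w * (T *v X w) $ i \<partial>M) = 0" for i
    proof -
      have "q w * (T *v X w) $ i = (\<Sum>k\<in>UNIV. T $ i $ k * (q w * X w $ k))" for w
        unfolding TX by (simp add: sum_distrib_left mult_ac)
      then show ?thesis by (simp add: i first[OF q])
    qed
    show "(\<integral>w. q w * ((T *v X w) $ i * (T *v X w) $ j) \<partial>M) = (\<integral>w. q w * (T ** V w ** T) $ i $ j \<partial>M)" for i j
    proof -
      have "q w * ((T *v X w) $ i * (T *v X w) $ j) =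
          (\<Sum>k\<in>UNIV. \<Sum>l\<in>UNIV. T $ i $ k * T $ j $ l * (q w * (X w $ k * X w $ l)))" for w
        unfolding TX sum_product by (simp add: sum_distrib_left mult_ac)
      moreover have "q w * (T ** V w ** T) $ i $ j =
          (\<Sum>k\<in>UNIV. \<Sum>l\<in>UNIV. T $ i $ k * T $ j $ l * (q w * V w $ k $ l))" for w
        unfolding TV by (subst sum.swap) (simp add: sum_distrib_left mult_ac)
      ultimately show ?thesis by (simp add: i second[OF q])
    qed
  qed
qed

text \<open>The defining property of conditional expectation, tested with bounded weights. The
  version built by \<open>mat_cond_exp\<close> is measurable with respect to the past and symmetric
  at every point, whereas the matrices \<open>V k\<close> of the theorem agree with it only almost
  surely.\<close>

lemma cond_moments_martingale_difference:
  fixes X :: "nat \<Rightarrow> 'a \<Rightarrow> real ^ 'd"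
  assumes "prob_space M" "finite_filtration M n F" "martingale_difference M n F X" "k \<in> {1..n}"
  shows "cond_moments M (F (k - 1)) (X k)
    (mat_cond_exp M (F (k - 1)) (\<lambda>w. outer_prod (X k w) (X k w)))"
proof -
  interpret prob_space M by fact
  have sub: "subalgebra M (F (k - 1))" and sub': "subalgebra M (F k)"
    using assms(2,4) unfolding finite_filtration_def by auto
  interpret finite_measure_subalgebra M "F (k - 1)" by unfold_locales (rule sub)
  interpret sigma_finite_subalgebra M "F (k - 1)"
    by (rule finite_measure_subalgebra_is_sigma_finite) unfold_locales
  have "X k \<in> borel_measurable (F k)" and sq: "integrable M (\<lambda>w. (norm (X k w))\<^sup>2)"
    and ce: "AE w in M. vec_cond_exp M (F (k - 1)) (X k) w = 0"
    using assms(3,4) unfolding martingale_difference_def by auto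
  then have Xm [measurable]: "X k \<in> borel_measurable M" using measurable_from_subalg[OF sub'] by blast
  note XX = integrable_component_mult[OF Xm sq] and X1 = integrable_component[OF Xm sq]
    and bm = integrable_bounded_mult[OF _ measurable_from_subalg[OF sub]]
  let ?V = "mat_cond_exp M (F (k - 1)) (\<lambda>w. outer_prod (X k w) (X k w))"
  have V: "?V w $ i $ j = real_cond_exp M (F (k - 1)) (\<lambda>w. X k w $ i * X k w $ j) w" for w i j
    by (simp add: mat_cond_exp_def outer_prod_def)
  show ?thesis
  proof (unfold_locales)
    show "subalgebra M (F (k - 1))" by (rule sub)
    show "X k \<in> borel_measurable M" by (rule Xm)
    show "integrable M (\<lambda>w. (norm (X k w))\<^sup>2)" by (rule sq)
    have "(\<lambda>w. \<chi> i j. ?V w $ i $ j) \<in> borel_measurable (F (k - 1))"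
      unfolding V by (intro borel_measurable_vec_lambda) simp
    then show "?V \<in> borel_measurable (F (k - 1))" by simp
    show "integrable M (\<lambda>w. ?V w $ i $ j)" for i j
      unfolding V by (rule real_cond_exp_int(1)[OF XX])
    show "transpose (?V w) = ?V w" for w
    proof -
      have "?V w $ i $ j = ?V w $ j $ i" for i j unfolding V by (simp only: mult.commute)
      then show ?thesis by (simp add: vec_eq_iff transpose_def)
    qed
    fix q :: "'a \<Rightarrow> real" and B assume q: "q \<in> borel_measurable (F (k - 1))" "\<And>w. \<bar>q w\<bar> \<le> B"
    show "(\<integral>w. q w * X k w $ i \<partial>M) = 0" for i
    proof -
      have "(\<integral>w. q w * X k w $ i \<partial>M) = (\<integral>w. q w * real_cond_exp M (F (k - 1)) (\<lambda>w. X k w $ i) w \<partial>M)"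
        by (rule real_cond_exp_intg(2)[symmetric, OF bm[OF X1 q] q(1)]) measurable
      also have "\<dots> = (\<integral>w. 0 \<partial>M)"
      proof (rule integral_cong_AE)
        show "AE w in M. q w * real_cond_exp M (F (k - 1)) (\<lambda>w. X k w $ i) w = 0"
          using ce by eventually_elim (auto simp: vec_cond_exp_def vec_eq_iff)
      qed (use measurable_from_subalg[OF sub q(1)] in measurable)
      finally show ?thesis by simp
    qed
    show "(\<integral>w. q w * (X k w $ i * X k w $ j) \<partial>M) = (\<integral>w. q w * ?V w $ i $ j \<partial>M)" for i j
      unfolding V by (rule real_cond_exp_intg(2)[symmetric, OF bm[OF XX q] q(1)]) measurable
  qed
qed

lemma matrix_mult_zero [simp]: "A ** (0 :: real ^ 'k ^ 'n) = 0" "(0 :: real ^ 'n ^ 'm) ** B = 0"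
  by (simp_all add: matrix_matrix_mult_def vec_eq_iff)

lemma matrix_add_rdistrib: "(A + B) ** C = A ** C + B ** C" for A B :: "real ^ 'n ^ 'm"
  by (simp add: matrix_matrix_mult_def vec_eq_iff sum.distrib distrib_right)

lemma matrix_conj_sum: "T ** (\<Sum>i\<in>I. A i) ** T = (\<Sum>i\<in>I. T ** A i ** T)"
  for T :: "real ^ 'n ^ 'n"
  by (induction I rule: infinite_finite_induct) (simp_all add: matrix_add_ldistrib matrix_add_rdistrib)

lemma pos_def_conj:
  fixes A :: "real ^ 'n ^ 'n"
  assumes A: "pos_def_matrix A" and T: "pos_def_matrix T"
  shows "pos_def_matrix (T ** A ** T)"
  unfolding pos_def_matrix_def
proof (intro conjI allI impI)
  have sym: "transpose A = A" "transpose T = T" using A T by (auto simp: pos_def_matrix_def)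
  show "transpose (T ** A ** T) = T ** A ** T"
    by (simp add: matrix_transpose_mul sym matrix_mul_assoc)
  fix x :: "real ^ 'n" assume "x \<noteq> 0"
  then have "T *v x \<noteq> 0" using T unfolding pos_def_matrix_def by (metis inner_zero_right less_irrefl)
  then have "0 < (T *v x) \<bullet> (A *v (T *v x))" using A unfolding pos_def_matrix_def by blast
  then show "0 < x \<bullet> ((T ** A ** T) *v x)"
    by (simp add: inner_mv_symm[OF sym(2)] matrix_vector_mul_assoc[symmetric])
qed

section \<open>Normalisation, telescoping of the exchanges, and comparison of constants\<close>

theorem theorem1:
  fixes M :: "'a measure"
    and n :: nat
    and F :: "nat \<Rightarrow> 'a measure"
    and X :: "nat \<Rightarrow> 'a \<Rightarrow> real ^ 'd"
    and V P :: "nat \<Rightarrow> 'a \<Rightarrow> real ^ 'd ^ 'd"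
    and S :: "'a \<Rightarrow> real ^ 'd"
    and \<Sigma> :: "real ^ 'd ^ 'd"
    and N :: "'b measure"
    and Z :: "'b \<Rightarrow> real ^ 'd"
    and h :: "real ^ 'd \<Rightarrow> real"
  assumes "prob_space M"
    and "n \<ge> 1"
    and "finite_filtration M n F"
    and "martingale_difference M n F X"
    and "\<And>k. k \<in> {1..n} \<Longrightarrow>
           AE \<omega> in M. V k \<omega> = mat_cond_exp M (F (k - 1)) (\<lambda>\<omega>'. outer_prod (X k \<omega>') (X k \<omega>')) \<omega>"
    and "S = (\<lambda>\<omega>. \<Sum>i=1..n. X i \<omega>)"
    and "P = (\<lambda>k \<omega>. \<Sum>i=k..n. V i \<omega>)"
    and "\<Sigma> = covariance_matrix M S"
    and "pos_def_matrix \<Sigma>"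
    and "\<And>k. k \<in> {1..n} \<Longrightarrow> AE \<omega> in M. pos_def_matrix (P k \<omega>)"
    and "AE \<omega> in M. P 1 \<omega> = \<Sigma>"
    and "prob_space N"
    and "distributed N lborel Z (\<lambda>x. ennreal (std_gaussian_density x))"
    and "twice_differentiable h"
    and "M2 h < \<infinity>"
  shows "ennreal \<bar>(\<integral>\<omega>. h (matrix_inv (matrix_sqrt \<Sigma>) *v S \<omega>) \<partial>M) - (\<integral>\<omega>. h (Z \<omega>) \<partial>N)\<bar>
    \<le> ennreal (3 * pi / 8 * sqrt (real CARD('d))) * M2 h *
       (\<Sum>k=1..n. \<integral>\<^sup>+ \<omega>. ennreal
          (sqrt (spectral_norm (matrix_sqrt \<Sigma> ** matrix_inv (P k \<omega>) ** matrix_sqrt \<Sigma>)) *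
           norm (matrix_inv (matrix_sqrt \<Sigma>) *v X k \<omega>) ^ 3) \<partial>M)"
proof -
  interpret prob_space M by fact
  define L where "L = enn2real (M2 h)"
  have M2L: "M2 h = ennreal L" using assms(15) by (simp add: L_def)
  have diff: "h differentiable (at x)" for x
    using assms(14) by (simp add: twice_differentiable_def)
  interpret smooth_fun h "grad h" L
    by unfold_locales (auto simp: L_def intro: gderiv_grad diff grad_Lipschitz assms(15))
  define R where "R = matrix_sqrt \<Sigma>"
  define T where "T = matrix_inv R"
  have R: "pos_def_matrix R" "R ** R = \<Sigma>"
    using matrix_sqrt_props[OF assms(9)] by (simp_all add: R_def)
  have TR: "T ** R = mat 1" "R ** T = mat 1"
    using matrix_inv_mult[OF pos_def_invertible[OF R(1)]] by (simp_all add: T_def)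
  have T: "pos_def_matrix T" "transpose T = T"
    using pos_def_inv[OF R(1)] by (simp_all add: T_def pos_def_matrix_def)
  have T\<Sigma>: "T ** \<Sigma> ** T = mat 1"
  proof -
    have "T ** \<Sigma> ** T = (T ** R) ** (R ** T)" by (simp only: R(2)[symmetric] matrix_mul_assoc)
    then show ?thesis by (simp add: TR)
  qed
  define VC where "VC k = mat_cond_exp M (F (k - 1)) (\<lambda>w. outer_prod (X k w) (X k w))" for k
  define Y where "Y k w = T *v X k w" for k w
  define Vn where "Vn k w = T ** VC k w ** T" for k w
  \<comment> \<open>Almost surely this is \<open>P k\<close> normalised, but it is defined from the
    conditional covariances before \<open>k\<close> instead of those from \<open>k\<close> on. Its
    measurability is then immediate.\<close>
  define Q where "Q k w = mat 1 - (\<Sum>i=1..<k. Vn i w)" for k w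
  define W where "W k w = matrix_inv (Q k w)" for k w
  define Sp where "Sp k w = (\<Sum>i=1..<k. Y i w)" for k w
  \<comment> \<open>For \<open>k = n + 1\<close> the remaining covariance is 0 and has no inverse,
    so smoothing is replaced by \<open>h\<close> itself.\<close>
  define U where "U k w x = (if k \<le> n then smooth (W k w) x else h x)" for k w x
  define p where "p k w = sqrt (spectral_norm (W k w))" for k w

  have QSuc: "Q k w = Q (Suc k) w + Vn k w" and SpSuc: "Sp (Suc k) w = Sp k w + Y k w"
    if "k \<in> {1..n}" for k w
    using that by (simp_all add: Q_def Sp_def)

  have cm: "cond_moments M (F (k - 1)) (Y k) (Vn k)" if "k \<in> {1..n}" for k
    using cond_moments.cond_moments_linear[OF cond_moments_martingale_difference[OF assms(1,3,4) that] T(2)]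
    unfolding Y_def[abs_def] Vn_def[abs_def] VC_def .

  have up: "f \<in> borel_measurable (F j)" if "f \<in> borel_measurable (F i)" "i \<le> j" "j \<le> n"
    for f :: "'a \<Rightarrow> 'e :: topological_space" and i j
    using assms(3) that unfolding finite_filtration_def by (blast intro: measurable_from_subalg)
  have toM: "f \<in> borel_measurable M" if "f \<in> borel_measurable (F i)" "i \<le> n"
    for f :: "'a \<Rightarrow> 'e :: topological_space" and i
    using assms(3) that unfolding finite_filtration_def by (blast intro: measurable_from_subalg)
  have Ym: "Y i \<in> borel_measurable (F i)" if "i \<in> {1..n}" for i
  proof -
    have [measurable]: "X i \<in> borel_measurable (F i)"
      using assms(4) that unfolding martingale_difference_def by blast
    show ?thesis unfolding Y_def[abs_def] by measurable
  qed
  have Spm: "Sp k \<in> borel_measurable (F (k - 1))" if "k \<le> Suc n" for k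
    unfolding Sp_def[abs_def] using that
    by (intro borel_measurable_sum up[OF Ym]) auto
  \<comment> \<open>\<open>Vn i\<close> is measurable for \<open>F (i - 1)\<close> and the largest
    index in \<open>Q k\<close> is \<open>k - 1\<close>, so \<open>Q k\<close> is known at time
    \<open>k - 2\<close>; the gain of two steps is what makes \<open>Q (Suc k)\<close> known at time
    \<open>k - 1\<close>.\<close>
  have Qm: "Q k \<in> borel_measurable (F j)" if "k \<le> j + 2" "k \<le> Suc n" "j \<le> n" for k j
    unfolding Q_def[abs_def] using that
    by (intro borel_measurable_diff borel_measurable_const borel_measurable_sum
        up[OF cond_moments.V_meas[OF cm]]) auto
  have Wm: "W k \<in> borel_measurable (F j)" if "k \<le> j + 2" "k \<le> Suc n" "j \<le> n" for k j
    using Qm[OF that] unfolding W_def[abs_def] by measurable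
  have WmM [measurable]: "W k \<in> borel_measurable M" and SpmM [measurable]: "Sp k \<in> borel_measurable M"
    if "k \<le> Suc n" for k
    using toM[OF Wm[of k n]] toM[OF Spm[of k]] that by auto

  \<comment> \<open>All almost sure facts are collected in one event, on which the later estimates
    hold pointwise.\<close>
  define ok where "ok w \<longleftrightarrow> (\<forall>k\<in>{1..n}. pos_def_matrix (Q k w) \<and> psd_matrix (Vn k w) \<and>
      W k w = R ** matrix_inv (P k w) ** R) \<and> Q (Suc n) w = 0" for w
  have ok: "AE w in M. ok w"
  proof -
    have "AE w in M. \<forall>k\<in>{1..n}. V k w = VC k w"
      using assms(5) unfolding VC_def by (intro AE_ball_countable') auto
    moreover have "AE w in M. \<forall>k\<in>{1..n}. pos_def_matrix (P k w)"
      using assms(10) by (intro AE_ball_countable') auto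
    moreover have "AE w in M. \<forall>k\<in>{1..n}. psd_matrix (Vn k w)"
      using cond_moments.V_psd[OF cm] by (intro AE_ball_countable') auto
    ultimately show ?thesis using assms(11)
    proof eventually_elim
      case (elim w)
      have PV: "P k w = (\<Sum>i=k..<Suc n. VC i w)" if "1 \<le> k" for k
        unfolding assms(7) atLeastLessThanSuc_atLeastAtMost
        using elim(1) that by (intro sum.cong) auto
      have Vns: "(\<Sum>i\<in>I. Vn i w) = T ** (\<Sum>i\<in>I. VC i w) ** T" for I
        unfolding Vn_def by (rule matrix_conj_sum[symmetric])
      \<comment> \<open>Here \<open>P 1 = \<Sigma>\<close> enters: the normalised conditional
        covariances add up to the identity, which identifies \<open>Q k\<close> with the tail
        sum.\<close>
      have total: "T ** (\<Sum>i=1..<Suc n. VC i w) ** T = mat 1"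
        using PV[of 1] elim(4) T\<Sigma> by simp
      have QP: "Q k w = T ** P k w ** T" if "k \<in> {1..n}" for k
      proof -
        have "(\<Sum>i=1..<k. VC i w) + (\<Sum>i=k..<Suc n. VC i w) = (\<Sum>i=1..<Suc n. VC i w)"
          using that by (intro sum.atLeastLessThan_concat) auto
        then have "T ** (\<Sum>i=1..<k. VC i w) ** T + T ** P k w ** T = mat 1"
          unfolding matrix_add_rdistrib[symmetric] matrix_add_ldistrib[symmetric]
          using that total PV[of k] by (simp only: atLeastAtMost_iff)
        then show ?thesis unfolding Q_def Vns by (simp add: algebra_simps)
      qed
      have "Q (Suc n) w = 0" unfolding Q_def Vns total by simp
      moreover have "pos_def_matrix (Q k w) \<and> psd_matrix (Vn k w) \<and> W k w = R ** matrix_inv (P k w) ** R"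
        if k: "k \<in> {1..n}" for k
      proof (intro conjI)
        have Pk: "pos_def_matrix (P k w)" using elim(2) k by blast
        show "pos_def_matrix (Q k w)" unfolding QP[OF k] by (rule pos_def_conj[OF Pk T(1)])
        show "psd_matrix (Vn k w)" using elim(3) k by blast
        have "Q k w ** (R ** matrix_inv (P k w) ** R) = T ** (P k w ** ((T ** R) ** (matrix_inv (P k w) ** R)))"
          unfolding QP[OF k] by (simp only: matrix_mul_assoc)
        also have "\<dots> = T ** ((P k w ** matrix_inv (P k w)) ** R)"
          by (simp add: TR matrix_mul_assoc)
        also have "\<dots> = mat 1" by (simp add: matrix_inv_mult[OF pos_def_invertible[OF Pk]] TR)
        finally show "W k w = R ** matrix_inv (P k w) ** R"
          unfolding W_def by (rule matrix_inv_eqI)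
      qed
      ultimately show ?case unfolding ok_def by blast
    qed
  qed

  have Sp_sq: "integrable M (\<lambda>w. (norm (Sp k w))\<^sup>2)" if "k \<le> Suc n" for k
    using that
  proof (induction k)
    case (Suc k)
    show ?case
    proof (cases "k = 0")
      case False
      then have k: "k \<in> {1..n}" using Suc.prems by auto
      show ?thesis
      proof (rule Bochner_Integration.integrable_bound)
        show "integrable M (\<lambda>w. 2 * (norm (Sp k w))\<^sup>2 + 2 * (norm (Y k w))\<^sup>2)"
          using Suc cond_moments.X_sq[OF cm[OF k]] by (intro Bochner_Integration.integrable_add integrable_mult_right) auto
        show "(\<lambda>w. (norm (Sp (Suc k) w))\<^sup>2) \<in> borel_measurable M"
          using SpmM[OF Suc.prems] by measurable
        show "AE w in M. norm ((norm (Sp (Suc k) w))\<^sup>2) \<le> norm (2 * (norm (Sp k w))\<^sup>2 + 2 * (norm (Y k w))\<^sup>2)"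
        proof (rule AE_I2)
          fix w
          have "(norm (Sp k w + Y k w))\<^sup>2 \<le> (norm (Sp k w) + norm (Y k w))\<^sup>2"
            by (intro power_mono norm_triangle_ineq) simp
          also have "\<dots> \<le> 2 * (norm (Sp k w))\<^sup>2 + 2 * (norm (Y k w))\<^sup>2"
            using sum_squares_bound[of "norm (Sp k w)" "norm (Y k w)"] by (simp add: power2_sum)
          finally show "norm ((norm (Sp (Suc k) w))\<^sup>2) \<le> norm (2 * (norm (Sp k w))\<^sup>2 + 2 * (norm (Y k w))\<^sup>2)"
            by (simp add: SpSuc[OF k])
        qed
      qed
    qed (simp add: Sp_def)
  qed (simp add: Sp_def)
  have h_int: "integrable M (\<lambda>w. h (Sp k w))" if k: "k \<le> Suc n" for k
  proof (rule Bochner_Integration.integrable_bound)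
    let ?g = "norm (grad h 0)"
    show "integrable M (\<lambda>w. \<bar>h 0\<bar> + ?g * (1 + (norm (Sp k w))\<^sup>2) + L / 2 * (norm (Sp k w))\<^sup>2)"
      using Sp_sq[OF k] by simp
    show "(\<lambda>w. h (Sp k w)) \<in> borel_measurable M" using SpmM[OF k] by measurable
    show "AE w in M. norm (h (Sp k w)) \<le> norm (\<bar>h 0\<bar> + ?g * (1 + (norm (Sp k w))\<^sup>2) + L / 2 * (norm (Sp k w))\<^sup>2)"
    proof (rule AE_I2)
      fix w
      have "2 * norm (Sp k w) \<le> 1 + (norm (Sp k w))\<^sup>2"
        using sum_squares_bound[of 1 "norm (Sp k w)"] by simp
      then have "norm (Sp k w) \<le> 1 + (norm (Sp k w))\<^sup>2" using norm_ge_zero[of "Sp k w"] by linarith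
      then have "?g * norm (Sp k w) \<le> ?g * (1 + (norm (Sp k w))\<^sup>2)" by (intro mult_left_mono) auto
      then have "\<bar>h (Sp k w)\<bar> \<le> \<bar>h 0\<bar> + ?g * (1 + (norm (Sp k w))\<^sup>2) + L / 2 * (norm (Sp k w))\<^sup>2"
        using abs_h_le[of "Sp k w"] by linarith
      then show "norm (h (Sp k w)) \<le> norm (\<bar>h 0\<bar> + ?g * (1 + (norm (Sp k w))\<^sup>2) + L / 2 * (norm (Sp k w))\<^sup>2)"
        unfolding real_norm_def by linarith
    qed
  qed
  have Qtr: "integrable M (\<lambda>w. trace (Q k w))" if "k \<le> Suc n" for k
  proof -
    have "trace (Q k w) = real CARD('d) - (\<Sum>i=1..<k. trace (Vn i w))" for w
      unfolding Q_def trace_sub trace_I by (simp add: trace_def sum.swap[of _ _ "UNIV :: 'd set"])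
    moreover have "integrable M (\<lambda>w. \<Sum>i=1..<k. trace (Vn i w))"
      using that by (intro Bochner_Integration.integrable_sum cond_moments.trace_int[OF cm]) auto
    ultimately show ?thesis by simp
  qed
  \<comment> \<open>Smoothing changes \<open>h\<close> by at most a multiple of the trace of
    \<open>Q j\<close>, which is integrable, and \<open>h\<close> itself grows at most
    quadratically.\<close>
  have U_int: "integrable M (\<lambda>w. U j w (Sp k w))" if j: "j \<in> {1..Suc n}" and k: "k \<le> Suc n" for j k
  proof (cases "j \<le> n")
    case True
    show ?thesis
    proof (rule Bochner_Integration.integrable_bound)
      show "integrable M (\<lambda>w. \<bar>h (Sp k w)\<bar> + L / 2 * \<bar>trace (Q j w)\<bar>)"
        using h_int[OF k] Qtr[of j] True by simp
      show "(\<lambda>w. U j w (Sp k w)) \<in> borel_measurable M"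
        using WmM[of j] SpmM[OF k] True unfolding U_def by simp
      show "AE w in M. norm (U j w (Sp k w)) \<le> norm (\<bar>h (Sp k w)\<bar> + L / 2 * \<bar>trace (Q j w)\<bar>)"
        using ok
      proof eventually_elim
        case (elim w)
        then have "pos_def_matrix (Q j w)" using True j unfolding ok_def by auto
        from smooth_sub_le[OF this, of "Sp k w"] pos_def_trace_pos[OF this]
        have "\<bar>U j w (Sp k w) - h (Sp k w)\<bar> \<le> L / 2 * \<bar>trace (Q j w)\<bar>"
          using True by (simp add: U_def W_def)
        then show ?case unfolding real_norm_def by linarith
      qed
    qed
  qed (use h_int[OF k] in \<open>simp add: U_def\<close>)

  let ?B = "\<lambda>k. \<integral>\<^sup>+w. ennreal (p k w * norm (Y k w) ^ 3) \<partial>M"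
  have step: "ennreal \<bar>(\<integral>w. U (Suc k) w (Sp (Suc k) w) \<partial>M) - (\<integral>w. U k w (Sp k w) \<partial>M)\<bar> \<le>
      ennreal (L * (sqrt 5 / 2)) * ?B k" if k: "k \<in> {1..n}" for k
  proof -
    interpret cond_moments M "F (k - 1)" "Y k" "Vn k" by (rule cm[OF k])
    define H where "H w = smooth_hess (W (Suc k) w) (Sp k w)" for w
    define D :: "'a \<Rightarrow> real ^ 'd ^ 'd"
      \<comment> \<open>Clamping to the interval from \<open>- L\<close> to \<open>L\<close> makes
        the bound required of the weight hold at every point. On \<open>ok\<close>, for
        \<open>k < n\<close>, the Hessian already satisfies it and nothing changes.\<close>
      where "D w = (\<chi> i j. max (- L) (min L (H w $ i $ j)))" for w
    define G where "G w = (if k < n then smooth_grad (W (Suc k) w) (Sp k w) else grad h (Sp k w))" for w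
    define A where "A = {w \<in> space (F (k - 1)). k < n \<and> trace (Vn k w) * spectral_norm (W k w) \<le> 4 / 5}"
    have k': "k - 1 \<le> n" "Suc k \<le> Suc n" "k \<le> k - 1 + 2" "Suc k \<le> k - 1 + 2" using k by auto
    have [measurable]: "Sp k \<in> borel_measurable (F (k - 1))" using k by (intro Spm) simp
    have [measurable]: "W k \<in> borel_measurable (F (k - 1))"
        "W (Suc k) \<in> borel_measurable (F (k - 1))"
      using k k' by (auto intro!: Wm)
    note [measurable] = measurable_trace_F
    have HD: "D w = H w" if "ok w" "k < n" for w
    proof -
      have "pos_def_matrix (W (Suc k) w)"
        unfolding W_def using that by (intro pos_def_inv) (auto simp: ok_def)
      from smooth_hess_bound[OF this, of "Sp k w"]
      have "max (- L) (min L (H w $ i $ j)) = H w $ i $ j" for i j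
        unfolding H_def abs_le_iff max_def min_def by (smt (verit))
      then show ?thesis unfolding D_def by (simp add: vec_eq_iff)
    qed
    have psq: "(p k w)\<^sup>2 = spectral_norm (W k w)" "0 < spectral_norm (W k w)" if "ok w" for w
    proof -
      show "0 < spectral_norm (W k w)"
        unfolding W_def using that k by (intro spectral_norm_pos_def_pos pos_def_inv) (auto simp: ok_def)
      then show "(p k w)\<^sup>2 = spectral_norm (W k w)" by (simp add: p_def)
    qed
    have coer: "(norm y)\<^sup>2 / spectral_norm (W k w) \<le> y \<bullet> (Q k w *v y)" if "ok w" for y w
      using that k coercive_inverse_spectral_norm[of "Q k w" y] by (auto simp: ok_def W_def)
    have Vle: "y \<bullet> (Vn k w *v y) \<le> trace (Vn k w) * (norm y)\<^sup>2" if "ok w" for y w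
      using that k by (intro psd_le_trace) (auto simp: ok_def)
    have last: "Q n w = Vn n w" if "ok w" "k = n" for w
      using QSuc[of n w] k that by (simp add: ok_def)
    have pdS: "pos_def_matrix (Q (Suc k) w)" and psdV: "psd_matrix (Vn k w)" if "ok w" "k < n" for w
      using that k by (auto simp: ok_def)
    \<comment> \<open>The form of \<open>Vn k\<close> is at most its trace, hence at most 4/5 of the
      least eigenvalue of \<open>Q k\<close>; subtracting it leaves a fifth, so inverting costs a
      factor 5 in the precision.\<close>
    have \<kappa>: "v \<bullet> (W (Suc k) w *v v) \<le> (sqrt 5 * p k w * norm v)\<^sup>2" if "ok w" "w \<in> A" for w v
    proof -
      have kn: "k < n" and tr: "trace (Vn k w) * spectral_norm (W k w) \<le> 4 / 5"
        using that(2) by (auto simp: A_def)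
      let ?s = "spectral_norm (W k w)"
      have s: "?s > 0" by (rule psq(2)[OF that(1)])
      have tr': "trace (Vn k w) \<le> 4 / (5 * ?s)" using tr s by (simp add: field_simps)
      have "1 / (5 * ?s) * (norm y)\<^sup>2 \<le> y \<bullet> (Q (Suc k) w *v y)" for y
      proof -
        have "trace (Vn k w) * (norm y)\<^sup>2 \<le> 4 / (5 * ?s) * (norm y)\<^sup>2"
          using tr' by (rule mult_right_mono) simp
        moreover have "1 / (5 * ?s) * (norm y)\<^sup>2 = (norm y)\<^sup>2 / ?s - 4 / (5 * ?s) * (norm y)\<^sup>2"
          using s by (simp add: field_simps)
        moreover have "y \<bullet> (Q (Suc k) w *v y) = y \<bullet> (Q k w *v y) - y \<bullet> (Vn k w *v y)"
          unfolding QSuc[OF k] by (simp add: matrix_vector_mult_add_rdistrib inner_add_right)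
        ultimately show ?thesis using coer[OF that(1), of y] Vle[OF that(1), of y] by linarith
      qed
      then have "v \<bullet> (W (Suc k) w *v v) \<le> (norm v)\<^sup>2 / (1 / (5 * ?s))"
        unfolding W_def[of "Suc k"] using s by (intro inverse_form_le pdS that kn) auto
      also have "\<dots> = (sqrt 5 * p k w * norm v)\<^sup>2"
        using s by (simp add: power_mult_distrib psq(1)[OF that(1)])
      finally show ?thesis .
    qed
    have p0: "0 \<le> p k w" for w
      unfolding p_def spectral_norm_def by (intro real_sqrt_ge_zero onorm_pos_le) simp
    show ?thesis
    proof (rule lindeberg_step[where A = A and G = G and D = D and a = "\<lambda>w. U (Suc k) w (Sp k w)"])
      show "0 \<le> L" by (rule L_nonneg)
      show "A \<in> sets (F (k - 1))" unfolding A_def by measurable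
      show "p k \<in> borel_measurable (F (k - 1))" unfolding p_def[abs_def] by measurable
      show "0 \<le> p k w" for w by (rule p0)
      show "G \<in> borel_measurable (F (k - 1))" unfolding G_def[abs_def] by measurable
      show "D \<in> borel_measurable (F (k - 1))" unfolding D_def[abs_def] H_def[abs_def] by measurable
      show "\<bar>D w $ i $ j\<bar> \<le> L" for w i j unfolding D_def using L_nonneg by auto
      show "integrable M (\<lambda>w. U (Suc k) w (Sp k w))" "integrable M (\<lambda>w. U (Suc k) w (Sp (Suc k) w))"
          "integrable M (\<lambda>w. U k w (Sp k w))"
        using k by (auto intro!: U_int)
      show "AE w in M. \<bar>U (Suc k) w (Sp (Suc k) w) - U (Suc k) w (Sp k w) - G w \<bullet> Y k w\<bar> \<le> L / 2 * (norm (Y k w))\<^sup>2"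
        using ok
      proof eventually_elim
        case (elim w)
        show ?case
        proof (cases "k < n")
          case True
          then show ?thesis
            using smooth_taylor1[OF pos_def_inv[OF pdS[OF elim]], of "Sp k w" "Y k w"]
            by (simp add: U_def G_def SpSuc[OF k] W_def)
        next
          case False
          then show ?thesis
            unfolding SpSuc[OF k] using taylor1[of "Sp k w" "Y k w"] k by (simp add: U_def G_def)
        qed
      qed
      show "AE w in M. \<bar>U k w (Sp k w) - U (Suc k) w (Sp k w)\<bar> \<le> L / 2 * trace (Vn k w)"
        using ok
      proof eventually_elim
        case (elim w)
        show ?case
        proof (cases "k < n")
          case True
          then show ?thesis
            using smooth_add_le[OF pdS[OF elim] psdV[OF elim], of "Sp k w"] QSuc[OF k, of w]
            by (simp add: U_def W_def)
        next
          case False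
          \<comment> \<open>In the last exchange the base function is \<open>h\<close> and the whole
            Gaussian covariance \<open>Q n\<close> is \<open>Vn n\<close>, which is therefore
            positive definite.\<close>
          then have "k = n" using k by simp
          moreover have "pos_def_matrix (Vn n w)"
            using elim k last[OF elim \<open>k = n\<close>] \<open>k = n\<close> unfolding ok_def by metis
          ultimately show ?thesis
            using smooth_sub_le[of "Vn n w" "Sp n w"] by (simp add: U_def W_def last[OF elim])
        qed
      qed
      show "AE w in M. w \<in> A \<longrightarrow> \<bar>U (Suc k) w (Sp (Suc k) w) - U (Suc k) w (Sp k w) - G w \<bullet> Y k w -
          (Y k w \<bullet> (D w *v Y k w)) / 2\<bar> \<le> L * (sqrt 5 * p k w) / 6 * norm (Y k w) ^ 3"
        using ok
      proof (eventually_elim, intro impI)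
        fix w assume *: "ok w" "w \<in> A"
        then have kn: "k < n" by (simp add: A_def)
        show "\<bar>U (Suc k) w (Sp (Suc k) w) - U (Suc k) w (Sp k w) - G w \<bullet> Y k w -
          (Y k w \<bullet> (D w *v Y k w)) / 2\<bar> \<le> L * (sqrt 5 * p k w) / 6 * norm (Y k w) ^ 3"
          using smooth_taylor2[OF _ \<kappa>[OF *], of "Sp k w"] pos_def_inv[OF pdS[OF *(1) kn]] p0[of w] kn
          by (simp add: U_def G_def SpSuc[OF k] HD[OF *(1) kn] H_def W_def)
      qed
      show "AE w in M. w \<in> A \<longrightarrow> \<bar>U k w (Sp k w) - U (Suc k) w (Sp k w) - (Vn k w \<bullet> D w) / 2\<bar>
          \<le> L * (sqrt 5 * p k w) / 3 * sqrt (trace (Vn k w)) ^ 3"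
        using ok
      proof (eventually_elim, intro impI)
        fix w assume *: "ok w" "w \<in> A"
        then have kn: "k < n" by (simp add: A_def)
        show "\<bar>U k w (Sp k w) - U (Suc k) w (Sp k w) - (Vn k w \<bullet> D w) / 2\<bar>
          \<le> L * (sqrt 5 * p k w) / 3 * sqrt (trace (Vn k w)) ^ 3"
          using smooth_add_taylor[OF pdS[OF *(1) kn] psdV[OF *(1) kn] \<kappa>[OF *, unfolded W_def[of "Suc k"]], of "Sp k w"]
            p0[of w] kn QSuc[OF k, of w]
          by (simp add: U_def HD[OF *(1) kn] H_def W_def)
      qed
      show "AE w in M. w \<notin> A \<longrightarrow> 4 / 5 \<le> (p k w)\<^sup>2 * trace (Vn k w)"
        using ok AE_space
      proof (eventually_elim, intro impI)
        fix w assume *: "ok w" "w \<in> space M" "w \<notin> A"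
        have s: "spectral_norm (W k w) > 0" by (rule psq(2)[OF *(1)])
        show "4 / 5 \<le> (p k w)\<^sup>2 * trace (Vn k w)"
        proof (cases "k < n")
          case True
          have "w \<in> space (F (k - 1))" using *(2) sub unfolding subalgebra_def by simp
          then show ?thesis using True *(3) by (simp add: A_def psq(1)[OF *(1)] mult.commute)
        next
          case False
          \<comment> \<open>With \<open>Q n = Vn n\<close> the trace is at least the least
            eigenvalue of \<open>Q n\<close>, so the product on the right is at least 1 and the
            threshold is met automatically.\<close>
          then have kn: "k = n" using k by simp
          obtain y :: "real ^ 'd" where y: "norm y = 1" using vector_choose_size[of 1] by auto
          have "1 / spectral_norm (W k w) \<le> trace (Vn k w)"
            using coer[OF *(1), of y] Vle[OF *(1), of y] last[OF *(1) kn] kn y by simp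
          then show ?thesis using s by (simp add: psq(1)[OF *(1)] field_simps)
        qed
      qed
    qed
  qed

  \<comment> \<open>\<open>Sp 1\<close> is an empty sum and \<open>Q 1\<close> is the identity, so
    the integrand is constant in \<open>w\<close>.\<close>
  have start: "(\<integral>w. U 1 w (Sp 1 w) \<partial>M) = (\<integral>w. h (Z w) \<partial>N)"
  proof -
    have Zd: "distr N lborel Z = density lborel (\<lambda>x. ennreal (std_gaussian_density x))"
      using assms(13) by (rule distributed_distr_eq_density)
    have Zm [measurable]: "Z \<in> measurable N lborel" using assms(13) by (rule distributed_measurable)
    have "prob_space (density lborel (\<lambda>x :: real ^ 'd. ennreal (std_gaussian_density x)))"
      unfolding Zd[symmetric] by (rule prob_space.prob_space_distr[OF assms(12) Zm])
    then have g: "gaussian (mat 1) = distr N lborel Z"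
      unfolding Zd by (rule gaussian_mat_1)
    have "matrix_inv (mat 1) = (mat 1 :: real ^ 'd ^ 'd)" by (rule matrix_inv_eqI) simp
    then have "U 1 w (Sp 1 w) = (\<integral>y. h y \<partial>gaussian (mat 1))" for w
      using assms(2) by (simp add: U_def W_def Q_def Sp_def smooth_def)
    then have "(\<integral>w. U 1 w (Sp 1 w) \<partial>M) = (\<integral>y. h y \<partial>gaussian (mat 1))"
      by (simp add: prob_space)
    also have "\<dots> = (\<integral>w. h (Z w) \<partial>N)"
      unfolding g by (rule integral_distr) measurable
    finally show ?thesis .
  qed
  have stop: "U (Suc n) w (Sp (Suc n) w) = h (T *v S w)" for w
    unfolding U_def Sp_def Y_def assms(6) atLeastLessThanSuc_atLeastAtMost
    by (simp add: linear_sum[OF matrix_vector_mul_linear])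
  let ?E = "\<lambda>k. \<integral>w. U k w (Sp k w) \<partial>M"
  have "ennreal \<bar>(\<integral>w. h (T *v S w) \<partial>M) - (\<integral>w. h (Z w) \<partial>N)\<bar> = ennreal \<bar>\<Sum>k=1..n. ?E (Suc k) - ?E k\<bar>"
    using sum_Suc_diff[of 1 n ?E] by (simp only: start stop)
  also have "\<dots> \<le> ennreal (\<Sum>k=1..n. \<bar>?E (Suc k) - ?E k\<bar>)"
    by (intro ennreal_leI sum_abs)
  also have "\<dots> = (\<Sum>k=1..n. ennreal \<bar>?E (Suc k) - ?E k\<bar>)"
    by (simp add: sum_ennreal)
  also have "\<dots> \<le> (\<Sum>k=1..n. ennreal (L * (sqrt 5 / 2)) * ?B k)"
    by (intro sum_mono step)
  also have "\<dots> = ennreal (L * (sqrt 5 / 2)) * (\<Sum>k=1..n. ?B k)"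
    by (simp add: sum_distrib_left)
  also have "(\<Sum>k=1..n. ?B k) = (\<Sum>k=1..n. \<integral>\<^sup>+ w. ennreal
          (sqrt (spectral_norm (R ** matrix_inv (P k w) ** R)) * norm (T *v X k w) ^ 3) \<partial>M)"
  proof (intro sum.cong refl nn_integral_cong_AE)
    fix k assume k: "k \<in> {1..n}"
    show "AE w in M. ennreal (p k w * norm (Y k w) ^ 3) =
        ennreal (sqrt (spectral_norm (R ** matrix_inv (P k w) ** R)) * norm (T *v X k w) ^ 3)"
      using ok by eventually_elim (use k in \<open>simp add: p_def Y_def ok_def\<close>)
  qed
  also have "ennreal (L * (sqrt 5 / 2)) \<le> ennreal (3 * pi / 8 * sqrt (real CARD('d))) * M2 h"
  proof -
    \<comment> \<open>A crude lower bound for \<open>pi\<close> is enough: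
      \<open>sin (pi / 6) = 1 / 2\<close> gives \<open>3 \<le> pi\<close>, and
      \<open>sqrt 5 / 2 \<le> 9 / 8 \<le> 3 * pi / 8\<close>.\<close>
    have "sin (pi / 6) \<le> pi / 6" by (rule sin_x_le_x) simp
    then have "3 \<le> pi" by (simp add: sin_30)
    moreover have "sqrt 5 \<le> 9 / 4" by (rule real_le_lsqrt) (simp_all add: power2_eq_square)
    ultimately have "sqrt 5 / 2 \<le> 3 * pi / 8" by simp
    also have "\<dots> \<le> 3 * pi / 8 * sqrt (real CARD('d))"
    proof -
      have "1 \<le> CARD('d)" by (simp add: Suc_leI)
      then show ?thesis by (simp add: mult_le_cancel_left1)
    qed
    finally have "L * (sqrt 5 / 2) \<le> L * (3 * pi / 8 * sqrt (real CARD('d)))"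
      using L_nonneg by (rule mult_left_mono)
    then have "ennreal (L * (sqrt 5 / 2)) \<le> ennreal ((3 * pi / 8 * sqrt (real CARD('d))) * L)"
      by (intro ennreal_leI) (simp add: mult.commute)
    also have "\<dots> = ennreal (3 * pi / 8 * sqrt (real CARD('d))) * M2 h"
      unfolding M2L using L_nonneg by (intro ennreal_mult) auto
    finally show ?thesis .
  qed
  finally show ?thesis
    unfolding R_def[symmetric] T_def[symmetric] by (simp add: mult_right_mono)
qed

end
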